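(* Let $p=2k+1>2$ be an odd integer ($k\in\mathbb Z$) and let $\mathbf p=(p-2,p,p)$. Then the quotient metric $g(\mathbf p)$ on the quaternion Kähler quotient $M(\mathbf p)=\mu_{\mathbf p}^{-1}(0)/S^1(\mathbf p)$ of the quaternionic hyperbolic plane is complete and $U(2)$-invariant, and the total space $M(\mathbf p)$ can be identified (diffeomorphically) with the complex unit disk bundle $\mathcal L_{p}\to\mathbb{CP}^1$ with first Chern class equal to $p$.
   Context: Let $\mathbb H$ be the quaternions with standard units $i,j,k$. The quaternionic hyperbolic plane $\mathbb H\mathcal H^2$ is the open unit ball $\{\mathbf x=(x_1,x_2)\in\mathbb H^2:|x_1|^2+|x_2|^2<1\}$ with the Riemannian metric $$g=\frac{1}{1-|\mathbf x|^2}\Bigl(|d\mathbf x|^2+\frac{1}{1-|\mathbf x|^2}|\langle d\mathbf x,\mathbf x\rangle|^2\Bigr),\qquad \langle d\mathbf x,\mathbf x\rangle=\sum_\alpha \overline{dx_\alpha}\,x_\alpha .$$ For $\mathbf p=(p_0,p_1,p_2)\in\mathbb Z^3$ the circle action is $$\varphi^{\mathbf p}_t(x_1,x_2)=(e^{2\pi i p_1t}x_1e^{-2\pi i p_0t},\ e^{2\pi i p_2t}x_2e^{-2\pi i p_0t}),$$ with $t\in[0,1)$ in general; when all weights are odd one uses the effective quotient circle, $t\in[0,1/2)$. The circle is denoted $S^1(\mathbf p)$. The zero set of the moment map is $$\mu_{\mathbf p}^{-1}(0)=\{\mathbf x\in\mathbb H\mathcal H^2:\ -ip_0+p_1\bar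 x_1ix_1+p_2\bar x_2ix_2=0\}.$$ The metric $g(\mathbf p)$ on $M(\mathbf p)=\mu_{\mathbf p}^{-1}(0)/S^1(\mathbf p)$ is obtained by restricting $g$ to $\mu_{\mathbf p}^{-1}(0)$ and making the projection a Riemannian submersion. "$U(2)$-invariant" means that $U(2)$ acts by isometries. For a positive integer $s$, the complex unit disk bundle $\mathcal L_s\to\mathbb{CP}^1$ with first Chern class $s$ is the quotient of $S^3\times\{\alpha\in\mathbb C:|\alpha|<1\}$, where $S^3=\{\mathbf v\in\mathbb C^2:\|\mathbf v\|=1\}$, by the circle action $\tau\cdot(\mathbf v,\alpha)=(\tau\mathbf v,\tau^s\alpha)$, $\tau\in S^1$, with projection to $S^3/S^1\cong\mathbb{CP}^1$. *)

theory Defs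
  imports "HOL-Analysis.Analysis"
begin

section \<open>Smooth maps, submanifolds and tangent spaces in Euclidean space\<close>

fun Ck_on :: "nat \<Rightarrow> ('a::real_normed_vector \<Rightarrow> 'b::real_normed_vector) \<Rightarrow> 'a set \<Rightarrow> bool" where
  "Ck_on 0 f S \<longleftrightarrow> continuous_on S f"
| "Ck_on (Suc n) f S \<longleftrightarrow>
     (\<forall>x\<in>S. f differentiable (at x)) \<and> (\<forall>v. Ck_on n (\<lambda>x. frechet_derivative f (at x) v) S)"

text \<open>For an arbitrary set, smoothness means that there are local smooth extensions to open
  subsets of the ambient space; on open sets this is the usual notion.\<close>

definition smooth_on :: "'a::real_normed_vector set \<Rightarrow> ('a \<Rightarrow> 'b::real_normed_vector) \<Rightarrow> bool" where
  "smooth_on S f \<longleftrightarrow>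
     (\<forall>x\<in>S. \<exists>U F. open U \<and> x \<in> U \<and> (\<forall>n. Ck_on n F U) \<and> (\<forall>y\<in>S \<inter> U. F y = f y))"

definition smooth_submanifold :: "nat \<Rightarrow> 'a::euclidean_space set \<Rightarrow> bool" where
  "smooth_submanifold n Z \<longleftrightarrow>
     (\<forall>x\<in>Z. \<exists>U (F :: 'a \<Rightarrow> 'a) F' S. open U \<and> x \<in> U \<and> open (F ` U) \<and>
        smooth_on U F \<and> smooth_on (F ` U) F' \<and> (\<forall>y\<in>U. F' (F y) = y) \<and>
        subspace S \<and> dim S = n \<and> F ` (U \<inter> Z) = F ` U \<inter> S)"

definition tangent_space :: "'a::euclidean_space set \<Rightarrow> 'a \<Rightarrow> 'a set" where
  "tangent_space Z x = {v. \<exists>\<gamma> e. e > 0 \<and> smooth_on {-e<..<e} \<gamma> \<and> \<gamma> ` {-e<..<e} \<subseteq> Z \<and> \<gamma> 0 = x \<and>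
     (\<gamma> has_vector_derivative v) (at 0)}"

text \<open>For smooth f the derivative frechet_derivative f (at x within Z) is in general
  determined only on tangent vectors to Z; below it is applied to such vectors only.\<close>

definition smooth_submersion_on ::
    "'a::euclidean_space set \<Rightarrow> 'a set \<Rightarrow> ('a \<Rightarrow> 'e::euclidean_space) \<Rightarrow> bool" where
  "smooth_submersion_on Z W f \<longleftrightarrow>
     smooth_on W f \<and> (\<forall>x\<in>W. frechet_derivative f (at x within Z) ` tangent_space Z x = UNIV)"

section \<open>Abstract smooth manifolds\<close>

text \<open>A chart is a pair of a domain and a coordinate map; the values of the coordinate map outside
  of the domain are irrelevant.\<close>

type_synonym ('p, 'e) chart = "'p set \<times> ('p \<Rightarrow> 'e)"

definition topological_chart :: "'p topology \<Rightarrow> ('p, 'e::euclidean_space) chart \<Rightarrow> bool" where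
  "topological_chart X = (\<lambda>(U, \<phi>). openin X U \<and> open (\<phi> ` U) \<and>
     homeomorphic_map (subtopology X U) (top_of_set (\<phi> ` U)) \<phi>)"

text \<open>Given a map F between manifolds, its representation in a chart of the source and a chart of
  the target, and the domain of this representation.\<close>

definition chart_rep ::
    "('p, 'e) chart \<Rightarrow> ('q, 'f) chart \<Rightarrow> ('p \<Rightarrow> 'q) \<Rightarrow> 'e \<Rightarrow> 'f" where
  "chart_rep c d F = snd d \<circ> F \<circ> inv_into (fst c) (snd c)"

definition chart_rep_dom ::
    "('p, 'e) chart \<Rightarrow> ('q, 'f) chart \<Rightarrow> ('p \<Rightarrow> 'q) \<Rightarrow> 'e set" where
  "chart_rep_dom c d F = snd c ` {q \<in> fst c. F q \<in> fst d}"

definition smooth_manifold :: "'p topology \<Rightarrow> ('p, 'e::euclidean_space) chart set \<Rightarrow> bool" where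
  "smooth_manifold X A \<longleftrightarrow> Hausdorff_space X \<and> second_countable X \<and>
     (\<forall>c\<in>A. topological_chart X c) \<and> (\<Union>c\<in>A. fst c) = topspace X \<and>
     (\<forall>c\<in>A. \<forall>d\<in>A. smooth_on (chart_rep_dom c d id) (chart_rep c d id))"

definition smooth_map ::
    "'p topology \<Rightarrow> ('p, 'e::euclidean_space) chart set \<Rightarrow>
     'q topology \<Rightarrow> ('q, 'f::euclidean_space) chart set \<Rightarrow> ('p \<Rightarrow> 'q) \<Rightarrow> bool" where
  "smooth_map X A Y B F \<longleftrightarrow> continuous_map X Y F \<and>
     (\<forall>c\<in>A. \<forall>d\<in>B. smooth_on (chart_rep_dom c d F) (chart_rep c d F))"

definition diffeomorphism ::
    "'p topology \<Rightarrow> ('p, 'e::euclidean_space) chart set \<Rightarrow>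
     'q topology \<Rightarrow> ('q, 'f::euclidean_space) chart set \<Rightarrow> ('p \<Rightarrow> 'q) \<Rightarrow> bool" where
  "diffeomorphism X A Y B F \<longleftrightarrow>
     (\<exists>F'. homeomorphic_maps X Y F F' \<and> smooth_map X A Y B F \<and> smooth_map Y B X A F')"

section \<open>Riemannian metrics\<close>

text \<open>A metric is given by its components in all charts of the atlas: G c q a b is the inner
  product, at the point q in the domain of the chart c, of the tangent vectors with coordinates
  a and b in that chart.\<close>

type_synonym ('p, 'e) chart_metric = "('p, 'e) chart \<Rightarrow> 'p \<Rightarrow> 'e \<Rightarrow> 'e \<Rightarrow> real"

text \<open>The derivative of F at q, expressed in a chart around q and a chart around F q.\<close>

definition chart_deriv ::
    "('p, 'e::euclidean_space) chart \<Rightarrow> ('q, 'f::euclidean_space) chart \<Rightarrow> ('p \<Rightarrow> 'q) \<Rightarrow> 'p \<Rightarrow> 'e \<Rightarrow> 'f" where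
  "chart_deriv c d F q = frechet_derivative (chart_rep c d F) (at (snd c q))"

definition preserves_metric ::
    "('p, 'e::euclidean_space) chart set \<Rightarrow> ('p, 'e) chart_metric \<Rightarrow> ('p \<Rightarrow> 'p) \<Rightarrow> bool" where
  "preserves_metric A G F \<longleftrightarrow>
     (\<forall>c\<in>A. \<forall>d\<in>A. \<forall>q\<in>fst c. F q \<in> fst d \<longrightarrow>
        (\<forall>a b. G d (F q) (chart_deriv c d F q a) (chart_deriv c d F q b) = G c q a b))"

text \<open>The last clause is the transformation law under changes of coordinates.\<close>

definition riemannian_metric ::
    "('p, 'e::euclidean_space) chart set \<Rightarrow> ('p, 'e) chart_metric \<Rightarrow> bool" where
  "riemannian_metric A G \<longleftrightarrow>
     (\<forall>c\<in>A. \<forall>q\<in>fst c. bilinear (G c q) \<and> (\<forall>a b. G c q a b = G c q b a) \<and>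
        (\<forall>a. a \<noteq> 0 \<longrightarrow> G c q a a > 0)) \<and>
     (\<forall>c\<in>A. \<forall>a b. smooth_on (snd c ` fst c) (\<lambda>u. G c (inv_into (fst c) (snd c) u) a b)) \<and>
     preserves_metric A G id"

definition isometry ::
    "'p topology \<Rightarrow> ('p, 'e::euclidean_space) chart set \<Rightarrow> ('p, 'e) chart_metric \<Rightarrow> ('p \<Rightarrow> 'p) \<Rightarrow> bool" where
  "isometry X A G F \<longleftrightarrow> diffeomorphism X A X A F \<and> preserves_metric A G F"

text \<open>As for piecewise C1 differentiability in the library, a curve may fail to be
  differentiable at finitely many points without one-sided bounds on the derivative there. The length
  is an extended nonnegative Lebesgue integral, so these curves do not change the infimum below.\<close>

definition piecewise_C1_curve ::
    "'p topology \<Rightarrow> ('p, 'e::euclidean_space) chart set \<Rightarrow> (real \<Rightarrow> 'p) \<Rightarrow> bool" where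
  "piecewise_C1_curve X A \<gamma> \<longleftrightarrow> pathin X \<gamma> \<and>
     (\<exists>S. finite S \<and> (\<forall>c\<in>A. (snd c \<circ> \<gamma>) C1_differentiable_on {t \<in> {0<..<1} - S. \<gamma> t \<in> fst c}))"

definition curve_speed ::
    "('p, 'e::euclidean_space) chart set \<Rightarrow> ('p, 'e) chart_metric \<Rightarrow> (real \<Rightarrow> 'p) \<Rightarrow> real \<Rightarrow> real" where
  "curve_speed A G \<gamma> t =
     (let c = (SOME c. c \<in> A \<and> \<gamma> t \<in> fst c); v = vector_derivative (snd c \<circ> \<gamma>) (at t)
      in sqrt (G c (\<gamma> t) v v))"

definition curve_length ::
    "('p, 'e::euclidean_space) chart set \<Rightarrow> ('p, 'e) chart_metric \<Rightarrow> (real \<Rightarrow> 'p) \<Rightarrow> ennreal" where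
  "curve_length A G \<gamma> = (\<integral>\<^sup>+t\<in>{0..1}. ennreal (curve_speed A G \<gamma> t) \<partial>lborel)"

definition riemannian_dist ::
    "'p topology \<Rightarrow> ('p, 'e::euclidean_space) chart set \<Rightarrow> ('p, 'e) chart_metric \<Rightarrow> 'p \<Rightarrow> 'p \<Rightarrow> real" where
  "riemannian_dist X A G q r =
     enn2real (INF \<gamma>\<in>{\<gamma>. piecewise_C1_curve X A \<gamma> \<and> \<gamma> 0 = q \<and> \<gamma> 1 = r}. curve_length A G \<gamma>)"

text \<open>Points in different components would get distance 0, because enn2real maps infinity to 0; the
  first conjunct therefore also forces the manifold to be connected.\<close>

definition riemannian_complete ::
    "'p topology \<Rightarrow> ('p, 'e::euclidean_space) chart set \<Rightarrow> ('p, 'e) chart_metric \<Rightarrow> bool" where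
  "riemannian_complete X A G \<longleftrightarrow>
     Metric_space (topspace X) (riemannian_dist X A G) \<and>
     Metric_space.mcomplete (topspace X) (riemannian_dist X A G)"

section \<open>Quotients of submanifolds of Euclidean space\<close>

text \<open>The quotient of Z is the set of orbits, pr being the projection that maps a point to its
  orbit.\<close>

definition quotient_topology :: "'a::euclidean_space set \<Rightarrow> ('a \<Rightarrow> 'p) \<Rightarrow> 'p topology" where
  "quotient_topology Z pr =
     topology (\<lambda>W. W \<subseteq> pr ` Z \<and> openin (top_of_set Z) {x \<in> Z. pr x \<in> W})"

lemma openin_quotient_topology:
  "openin (quotient_topology Z pr) W \<longleftrightarrow>
     W \<subseteq> pr ` Z \<and> openin (top_of_set Z) {x \<in> Z. pr x \<in> W}"
proof -
  have "istopology (\<lambda>W. W \<subseteq> pr ` Z \<and> openin (top_of_set Z) {x \<in> Z. pr x \<in> W})"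
    unfolding istopology_def
  proof (intro conjI allI impI)
    fix S T
    assume S: "S \<subseteq> pr ` Z \<and> openin (top_of_set Z) {x \<in> Z. pr x \<in> S}"
      and T: "T \<subseteq> pr ` Z \<and> openin (top_of_set Z) {x \<in> Z. pr x \<in> T}"
    have "{x \<in> Z. pr x \<in> S \<inter> T} = {x \<in> Z. pr x \<in> S} \<inter> {x \<in> Z. pr x \<in> T}" by auto
    with S T show "openin (top_of_set Z) {x \<in> Z. pr x \<in> S \<inter> T}"
      by (simp only: openin_Int)
    show "S \<inter> T \<subseteq> pr ` Z" using S by blast
  next
    fix \<K>
    assume K: "\<forall>K\<in>\<K>. K \<subseteq> pr ` Z \<and> openin (top_of_set Z) {x \<in> Z. pr x \<in> K}"
    then show "\<Union>\<K> \<subseteq> pr ` Z" by blast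
    have "{x \<in> Z. pr x \<in> \<Union>\<K>} = (\<Union>K\<in>\<K>. {x \<in> Z. pr x \<in> K})" by auto
    with K show "openin (top_of_set Z) {x \<in> Z. pr x \<in> \<Union>\<K>}" by auto
  qed
  then show ?thesis by (simp add: quotient_topology_def topology_inverse')
qed

text \<open>The smooth structure for which the projection is a smooth submersion. If such a structure
  exists then it is unique and its maximal atlas is the following one.\<close>

definition quotient_atlas ::
    "'a::euclidean_space set \<Rightarrow> ('a \<Rightarrow> 'p) \<Rightarrow> ('p, 'e::euclidean_space) chart set" where
  "quotient_atlas Z pr = {c. topological_chart (quotient_topology Z pr) c \<and>
     smooth_submersion_on Z {x \<in> Z. pr x \<in> fst c} (snd c \<circ> pr)}"

text \<open>In the following, g x is an inner product on the tangent space of Z at x.\<close>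

definition horizontal_space ::
    "'a::euclidean_space set \<Rightarrow> ('a \<Rightarrow> 'a \<Rightarrow> 'a \<Rightarrow> real) \<Rightarrow> ('a \<Rightarrow> 'e::euclidean_space) \<Rightarrow> 'a \<Rightarrow> 'a set" where
  "horizontal_space Z g f x = {v \<in> tangent_space Z x.
     \<forall>w\<in>tangent_space Z x. frechet_derivative f (at x within Z) w = 0 \<longrightarrow> g x v w = 0}"

definition riemannian_submersion ::
    "'a::euclidean_space set \<Rightarrow> ('a \<Rightarrow> 'a \<Rightarrow> 'a \<Rightarrow> real) \<Rightarrow> ('p, 'e::euclidean_space) chart set \<Rightarrow>
     ('p, 'e) chart_metric \<Rightarrow> ('a \<Rightarrow> 'p) \<Rightarrow> bool" where
  "riemannian_submersion Z g A G pr \<longleftrightarrow>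
     (\<forall>c\<in>A. smooth_submersion_on Z {x \<in> Z. pr x \<in> fst c} (snd c \<circ> pr) \<and>
        (\<forall>x\<in>Z. pr x \<in> fst c \<longrightarrow>
           (let D = frechet_derivative (snd c \<circ> pr) (at x within Z);
                H = horizontal_space Z g (snd c \<circ> pr) x
            in \<forall>v\<in>H. \<forall>w\<in>H. G c (pr x) (D v) (D w) = g x v w)))"

text \<open>The inner product of horizontal lifts. It is independent of the chosen point over q exactly if
  the projection is a Riemannian submersion for this metric.\<close>

definition quotient_metric ::
    "'a::euclidean_space set \<Rightarrow> ('a \<Rightarrow> 'a \<Rightarrow> 'a \<Rightarrow> real) \<Rightarrow> ('a \<Rightarrow> 'p) \<Rightarrow>
     ('p, 'e::euclidean_space) chart_metric" where
  "quotient_metric Z g pr c q a b =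
     (let x = (SOME x. x \<in> Z \<and> pr x = q);
          lift = (\<lambda>a. THE v. v \<in> horizontal_space Z g (snd c \<circ> pr) x \<and>
                    frechet_derivative (snd c \<circ> pr) (at x within Z) v = a)
      in g x (lift a) (lift b))"

section \<open>Quaternions\<close>

text \<open>The pair (z, w) of complex numbers is the quaternion z + w j. The norm and the inner product on
  the product type are the standard ones of the quaternions.\<close>

type_synonym quat = "complex \<times> complex"

definition quat_mult :: "quat \<Rightarrow> quat \<Rightarrow> quat" (infixl "*\<^sub>H" 70) where
  "x *\<^sub>H y = (fst x * fst y - snd x * cnj (snd y), fst x * snd y + snd x * cnj (fst y))"

definition quat_cnj :: "quat \<Rightarrow> quat" where
  "quat_cnj x = (cnj (fst x), - snd x)"

definition quat_of_complex :: "complex \<Rightarrow> quat" where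
  "quat_of_complex z = (z, 0)"

definition quat_i :: quat where "quat_i = (\<i>, 0)"
definition quat_j :: quat where "quat_j = (0, 1)"
definition quat_k :: quat where "quat_k = (0, \<i>)"

lemma quat_units:
  "quat_i *\<^sub>H quat_i = - quat_of_complex 1" "quat_j *\<^sub>H quat_j = - quat_of_complex 1"
  "quat_k *\<^sub>H quat_k = - quat_of_complex 1"
  "quat_i *\<^sub>H quat_j = quat_k" "quat_j *\<^sub>H quat_k = quat_i" "quat_k *\<^sub>H quat_i = quat_j"
  "quat_j *\<^sub>H quat_i = - quat_k" "quat_k *\<^sub>H quat_j = - quat_i" "quat_i *\<^sub>H quat_k = - quat_j"
  by (simp_all add: quat_mult_def quat_of_complex_def quat_i_def quat_j_def quat_k_def)

lemma quat_mult_assoc: "(x *\<^sub>H y) *\<^sub>H z = x *\<^sub>H (y *\<^sub>H z)"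
  by (simp add: quat_mult_def algebra_simps)

lemma quat_mult_one: "quat_of_complex 1 *\<^sub>H x = x" "x *\<^sub>H quat_of_complex 1 = x"
  by (simp_all add: quat_mult_def quat_of_complex_def)

lemma bilinear_quat_mult: "bilinear (*\<^sub>H)"
  by (auto simp: bilinear_def linear_iff quat_mult_def algebra_simps scaleR_conv_of_real)

lemma quat_cnj_mult: "quat_cnj (x *\<^sub>H y) = quat_cnj y *\<^sub>H quat_cnj x"
  by (simp add: quat_mult_def quat_cnj_def algebra_simps)

lemma quat_norm_square: "quat_cnj x *\<^sub>H x = quat_of_complex (of_real ((norm x)\<^sup>2))"
proof -
  have "(norm x)\<^sup>2 = (norm (fst x))\<^sup>2 + (norm (snd x))\<^sup>2"
    by (simp add: norm_prod_def)
  then show ?thesis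
    by (simp only: quat_mult_def quat_cnj_def quat_of_complex_def of_real_add complex_norm_square)
       (simp add: mult.commute)
qed

section \<open>The quaternionic hyperbolic plane and its circle quotients\<close>

definition hyperbolic_plane :: "(quat \<times> quat) set" where
  "hyperbolic_plane = {x. (norm (fst x))\<^sup>2 + (norm (snd x))\<^sup>2 < 1}"

definition quat_pairing :: "quat \<times> quat \<Rightarrow> quat \<times> quat \<Rightarrow> quat" where
  "quat_pairing v x = quat_cnj (fst v) *\<^sub>H fst x + quat_cnj (snd v) *\<^sub>H snd x"

text \<open>The symmetric bilinear form obtained by polarization from the line element.\<close>

definition hyperbolic_metric ::
    "quat \<times> quat \<Rightarrow> quat \<times> quat \<Rightarrow> quat \<times> quat \<Rightarrow> real" where
  "hyperbolic_metric x v w =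
     1 / (1 - (norm x)\<^sup>2) *
       (v \<bullet> w + 1 / (1 - (norm x)\<^sup>2) * (quat_pairing v x \<bullet> quat_pairing w x))"

lemma hyperbolic_metric_line_element:
  "hyperbolic_metric x v v =
     1 / (1 - (norm x)\<^sup>2) *
       ((norm v)\<^sup>2 + 1 / (1 - (norm x)\<^sup>2) * (norm (quat_pairing v x))\<^sup>2)"
  by (simp add: hyperbolic_metric_def power2_norm_eq_inner)

type_synonym weights = "int \<times> int \<times> int"

definition circle_action :: "weights \<Rightarrow> real \<Rightarrow> quat \<times> quat \<Rightarrow> quat \<times> quat" where
  "circle_action = (\<lambda>(p0, p1, p2) t (x1, x2).
     let e = (\<lambda>m::int. quat_of_complex (exp (2 * of_real pi * \<i> * of_int m * of_real t)))
     in (e p1 *\<^sub>H x1 *\<^sub>H e (- p0), e p2 *\<^sub>H x2 *\<^sub>H e (- p0)))"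

definition circle_params :: "weights \<Rightarrow> real set" where
  "circle_params = (\<lambda>(p0, p1, p2).
     if odd p0 \<and> odd p1 \<and> odd p2 then {0..<1/2} else {0..<1})"

definition circle_orbit :: "weights \<Rightarrow> quat \<times> quat \<Rightarrow> (quat \<times> quat) set" where
  "circle_orbit p x = (\<lambda>t. circle_action p t x) ` circle_params p"

definition moment_zero :: "weights \<Rightarrow> (quat \<times> quat) set" where
  "moment_zero = (\<lambda>(p0, p1, p2). {(x1, x2) \<in> hyperbolic_plane.
     - (real_of_int p0 *\<^sub>R quat_i)
     + real_of_int p1 *\<^sub>R (quat_cnj x1 *\<^sub>H quat_i *\<^sub>H x1)
     + real_of_int p2 *\<^sub>R (quat_cnj x2 *\<^sub>H quat_i *\<^sub>H x2) = 0})"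

definition qk_quotient :: "weights \<Rightarrow> (quat \<times> quat) set topology" where
  "qk_quotient p = quotient_topology (moment_zero p) (circle_orbit p)"

definition qk_atlas :: "weights \<Rightarrow> ((quat \<times> quat) set, real^4) chart set" where
  "qk_atlas p = quotient_atlas (moment_zero p) (circle_orbit p)"

definition qk_metric :: "weights \<Rightarrow> ((quat \<times> quat) set, real^4) chart_metric" where
  "qk_metric p = quotient_metric (moment_zero p) hyperbolic_metric (circle_orbit p)"

section \<open>The action of U(2)\<close>

definition unitary_group :: "(complex^2^2) set" where
  "unitary_group = {A. map_matrix cnj (transpose A) ** A = mat 1}"

text \<open>U(2) acts on pairs of quaternions through its inclusion in Sp(2), by left multiplication, and
  on the quotient by taking images of orbits.\<close>

definition unitary_action :: "complex^2^2 \<Rightarrow> quat \<times> quat \<Rightarrow> quat \<times> quat" where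
  "unitary_action A = (\<lambda>(x1, x2).
     (quat_of_complex (A $ 1 $ 1) *\<^sub>H x1 + quat_of_complex (A $ 1 $ 2) *\<^sub>H x2,
      quat_of_complex (A $ 2 $ 1) *\<^sub>H x1 + quat_of_complex (A $ 2 $ 2) *\<^sub>H x2))"

definition acts_by_isometries ::
    "(complex^2^2 \<Rightarrow> 'p \<Rightarrow> 'p) \<Rightarrow> 'p topology \<Rightarrow> ('p, 'e::euclidean_space) chart set \<Rightarrow>
     ('p, 'e) chart_metric \<Rightarrow> bool" where
  "acts_by_isometries act X A G \<longleftrightarrow>
     (\<forall>q\<in>topspace X. act (mat 1) q = q) \<and>
     (\<forall>S\<in>unitary_group. \<forall>T\<in>unitary_group. \<forall>q\<in>topspace X. act (S ** T) q = act S (act T q)) \<and>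
     continuous_map (prod_topology (top_of_set unitary_group) X) X (\<lambda>(T, q). act T q) \<and>
     (\<forall>T\<in>unitary_group. isometry X A G (act T))"

definition U2_invariant :: "weights \<Rightarrow> bool" where
  "U2_invariant p \<longleftrightarrow>
     acts_by_isometries (\<lambda>T q. unitary_action T ` q) (qk_quotient p) (qk_atlas p) (qk_metric p)"

section \<open>Disk bundles over the complex projective line\<close>

definition disk_bundle_cover :: "((complex^2) \<times> complex) set" where
  "disk_bundle_cover = {v. norm v = 1} \<times> {\<alpha>. norm \<alpha> < 1}"

definition disk_bundle_orbit :: "int \<Rightarrow> (complex^2) \<times> complex \<Rightarrow> ((complex^2) \<times> complex) set" where
  "disk_bundle_orbit s = (\<lambda>(v, \<alpha>). {(\<tau> *s v, \<tau> powi s * \<alpha>) | \<tau>. norm \<tau> = 1})"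

definition disk_bundle :: "int \<Rightarrow> ((complex^2) \<times> complex) set topology" where
  "disk_bundle s = quotient_topology disk_bundle_cover (disk_bundle_orbit s)"

definition disk_bundle_atlas :: "int \<Rightarrow> (((complex^2) \<times> complex) set, real^4) chart set" where
  "disk_bundle_atlas s = quotient_atlas disk_bundle_cover (disk_bundle_orbit s)"

end

theory Submission
  imports Defs
begin

text \<open>
  Put \<open>n = p\<close> and write the two quaternions as \<open>x\<^sub>a = z\<^sub>a + w\<^sub>a j\<close>. The moment map vanishes exactly if the
  vectors \<open>z\<close> and \<open>w\<close> of \<open>\<complex>\<^sup>2\<close> are orthogonal and \<open>|z|\<^sup>2 - |w|\<^sup>2 = (n - 2) / n\<close>, and a unit
  complex number \<open>\<tau>\<close> of the effective circle acts by \<open>(z, w) \<mapsto> (\<tau> z, \<tau>\<^sup>n\<^sup>-\<^sup>1 w)\<close>. Hence \<open>z\<close> never vanishes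
  and \<open>w\<close> is a multiple \<open>\<beta>\<close> of the unit vector \<open>(- cnj z\<^sub>2, cnj z\<^sub>1) / |z|\<close>. This vector has weight \<open>-1\<close>,
  so \<open>\<beta>\<close> has weight \<open>n\<close>, and the condition \<open>|z|\<^sup>2 + |w|\<^sup>2 < 1\<close> becomes \<open>n |\<beta>|\<^sup>2 < 1\<close>. Therefore
  \<open>x \<mapsto> (z / |z|, \<surd>n \<beta>)\<close> is an equivariant diffeomorphism from the level set to the product of the
  3-sphere with the unit disk, on which the circle acts with the weights 1 and \<open>n\<close>. The quotient of the
  latter is the disk bundle of degree \<open>n\<close>.

  The differential geometry of the two quotients is reduced to slices, that is, local sections together
  with the orbit coordinates. For the sphere times the disk they are the affine coordinates of the
  projective line with a normalized phase (\<open>disk_bundle_slice\<close>), and the equivariant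
  diffeomorphism carries them to the level set. The atlas of the quotient contains all charts that
  are submersions; each of them has smooth local sections, because a smooth injection with invertible
  derivative has a smooth inverse (\<open>local_section\<close>). So all maps induced by equivariant maps are
  smooth (\<open>smooth_map_induced\<close>).

  The horizontal lift of a tangent vector is the difference of an arbitrary lift and its component along
  the orbit, and linear isometries that cover a map of the quotient intertwine horizontal lifts
  (\<open>lift_covering\<close>). Applied to the circle this makes the metric of the quotient well defined, and applied
  to \<open>U(2)\<close>, which commutes with the circle and preserves the level set, it gives the invariance.

  For the completeness, an invariant function whose gradient is bounded for the metric of the ball
  descends to a Lipschitz function of the quotient. The invariant polynomials separate the orbits, so the
  Riemannian distance is a metric. The function \<open>- ln (1 - |x|\<^sup>2)\<close> has bounded gradient too, and its
  sublevel sets in the quotient are compact. A Cauchy sequence thus stays in a compact set and converges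
  (\<open>complete_if_proper_function\<close>).
\<close>

section \<open>Calculus of smooth maps\<close>

lemma Ck_on_cong:
  assumes "open U" "\<And>x. x \<in> U \<Longrightarrow> f x = g x" "Ck_on n f U"
  shows "Ck_on n g U"
  using assms(2,3)
proof (induction n arbitrary: f g)
  case 0
  then show ?case by (simp cong: continuous_on_cong_simp)
next
  case (Suc n)
  have der: "(g has_derivative frechet_derivative f (at x)) (at x)" if "x \<in> U" for x
  proof -
    have "(f has_derivative frechet_derivative f (at x)) (at x)"
      using Suc.prems(2) that by (simp add: frechet_derivative_works)
    then show ?thesis
      by (rule has_derivative_transform_within_open[OF _ assms(1) that]) (use Suc.prems(1) in auto)
  qed
  then have eq: "frechet_derivative g (at x) = frechet_derivative f (at x)" if "x \<in> U" for x
    using that by (metis frechet_derivative_at)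
  have "Ck_on n (\<lambda>x. frechet_derivative g (at x) v) U" for v
    by (rule Suc.IH[of "\<lambda>x. frechet_derivative f (at x) v"]) (use eq Suc.prems(2) in auto)
  with der show ?case by (auto simp: differentiable_def)
qed

text \<open>The hierarchy of differentiability is defined by the derivatives in fixed directions, so closure
  properties are proved by induction on the order: a rule of differentiation gives the derivative,
  and the following lemma is the induction step.\<close>

lemma Ck_on_SucI:
  assumes "open U" "\<And>x. x \<in> U \<Longrightarrow> (f has_derivative f' x) (at x)"
    and "\<And>v. Ck_on n (\<lambda>x. f' x v) U"
  shows "Ck_on (Suc n) f U"
proof -
  have "f' x = frechet_derivative f (at x)" if "x \<in> U" for x
    using assms(2)[OF that] by (rule frechet_derivative_at)
  then have "Ck_on n (\<lambda>x. frechet_derivative f (at x) v) U" for v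
    by (intro Ck_on_cong[OF assms(1) _ assms(3)[of v]]) simp
  with assms(2) show ?thesis by (auto simp: differentiable_def)
qed

lemma Ck_on_SucD_derivative:
  "Ck_on (Suc n) f U \<Longrightarrow> x \<in> U \<Longrightarrow> (f has_derivative frechet_derivative f (at x)) (at x)"
  by (simp add: frechet_derivative_works)

lemma Ck_on_lower: "Ck_on (Suc n) f U \<Longrightarrow> Ck_on n f U"
proof (induction n arbitrary: f)
  case 0
  then show ?case
    by (auto intro!: continuous_at_imp_continuous_on differentiable_imp_continuous_within)
next
  case (Suc n)
  then show ?case by (metis Ck_on.simps(2))
qed

lemma Ck_on_subset: "Ck_on n f U \<Longrightarrow> V \<subseteq> U \<Longrightarrow> Ck_on n f V"
  by (induction n arbitrary: f) (auto intro: continuous_on_subset)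

lemma Ck_on_local:
  assumes "\<And>x. x \<in> S \<Longrightarrow> \<exists>U. open U \<and> x \<in> U \<and> Ck_on n f U"
  shows "Ck_on n f S"
  using assms
proof (induction n arbitrary: f)
  case 0
  show ?case
    unfolding Ck_on.simps
  proof (rule continuous_at_imp_continuous_on, rule ballI)
    fix x assume "x \<in> S"
    from 0[OF this] obtain U where "open U" "x \<in> U" "continuous_on U f" by auto
    then show "isCont f x" by (simp add: continuous_on_eq_continuous_at)
  qed
next
  case (Suc n)
  show ?case
    unfolding Ck_on.simps
  proof (intro conjI ballI allI)
    fix x assume "x \<in> S"
    from Suc.prems[OF this] show "f differentiable (at x)" by auto
  next
    fix v
    show "Ck_on n (\<lambda>x. frechet_derivative f (at x) v) S"
    proof (rule Suc.IH)
      fix x assume "x \<in> S"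
      from Suc.prems[OF this] obtain U where "open U" "x \<in> U" "Ck_on (Suc n) f U" by blast
      then show "\<exists>U. open U \<and> x \<in> U \<and> Ck_on n (\<lambda>x. frechet_derivative f (at x) v) U"
        by (intro exI[of _ U]) simp
    qed
  qed
qed

lemma Ck_on_const: "Ck_on n (\<lambda>x. c) U"
  by (induction n arbitrary: c) (auto simp: frechet_derivative_const)

lemma Ck_on_bounded_linear:
  assumes "bounded_linear L" "open U" shows "Ck_on n L U"
proof (cases n)
  case 0
  then show ?thesis using assms(1) by (simp add: linear_continuous_on)
next
  case (Suc m)
  show ?thesis unfolding Suc
    by (rule Ck_on_SucI[OF assms(2), where f' = "\<lambda>_. L"])
      (use assms in \<open>auto intro: bounded_linear_imp_has_derivative Ck_on_const\<close>)
qed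

lemma Ck_on_add:
  assumes "open U" "Ck_on n f U" "Ck_on n g U"
  shows "Ck_on n (\<lambda>x. f x + g x) U"
  using assms(2,3)
proof (induction n arbitrary: f g)
  case 0
  then show ?case by (simp add: continuous_on_add)
next
  case (Suc n)
  show ?case
    by (rule Ck_on_SucI[OF assms(1),
          where f' = "\<lambda>x v. frechet_derivative f (at x) v + frechet_derivative g (at x) v"])
      (use Suc in \<open>auto intro!: has_derivative_add Ck_on_SucD_derivative\<close>)
qed

lemma Ck_on_sum:
  assumes "open U" "\<And>i. i \<in> I \<Longrightarrow> Ck_on n (f i) U"
  shows "Ck_on n (\<lambda>x. \<Sum>i\<in>I. f i x) U"
proof (cases "finite I")
  case True
  then show ?thesis using assms(2)
    by (induction I rule: finite_induct) (auto intro: Ck_on_const Ck_on_add[OF assms(1)])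
qed (simp add: Ck_on_const)

lemma Ck_on_bilinear:
  assumes "bounded_bilinear bop" "open U" "Ck_on n f U" "Ck_on n g U"
  shows "Ck_on n (\<lambda>x. bop (f x) (g x)) U"
  using assms(3,4)
proof (induction n arbitrary: f g)
  case 0
  then show ?case using bounded_bilinear.continuous_on[OF assms(1)] by simp
next
  case (Suc n)
  show ?case
  proof (rule Ck_on_SucI[OF assms(2)])
    fix x assume "x \<in> U"
    show "((\<lambda>x. bop (f x) (g x)) has_derivative
        (\<lambda>v. bop (f x) (frechet_derivative g (at x) v) +
             bop (frechet_derivative f (at x) v) (g x))) (at x)"
      using Suc.prems \<open>x \<in> U\<close>
      by (intro bounded_bilinear.FDERIV[OF assms(1)] Ck_on_SucD_derivative)
  next
    fix v
    show "Ck_on n (\<lambda>x. bop (f x) (frechet_derivative g (at x) v) +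
             bop (frechet_derivative f (at x) v) (g x)) U"
      by (intro Ck_on_add[OF assms(2)] Suc.IH)
        (use Suc.prems in \<open>auto intro: Ck_on_lower[OF Suc.prems(1)] Ck_on_lower[OF Suc.prems(2)]\<close>)
  qed
qed

text \<open>The derivative of a composition at x in direction v is the derivative of the outer map in a
  direction that depends on x. Expanding this direction in a basis turns it into a sum of products
  to which the induction hypothesis applies; this is why the middle space is Euclidean.\<close>

lemma Ck_on_compose:
  fixes f :: "'a::real_normed_vector \<Rightarrow> 'b::euclidean_space" and g :: "'b \<Rightarrow> 'c::real_normed_vector"
  assumes "open U" "open V" "Ck_on n f U" "Ck_on n g V" "f ` U \<subseteq> V"
  shows "Ck_on n (\<lambda>x. g (f x)) U"
  using assms(3,4)
proof (induction n arbitrary: g)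
  case 0
  then show ?case using continuous_on_compose2[of V g U f] assms(5) by auto
next
  case (Suc n)
  let ?f' = "\<lambda>x. frechet_derivative f (at x)" and ?g' = "\<lambda>y. frechet_derivative g (at y)"
  show ?case
  proof (rule Ck_on_SucI[OF assms(1)])
    fix x assume x: "x \<in> U"
    have f: "(f has_derivative ?f' x) (at x)"
      using Suc.prems(1) x by (rule Ck_on_SucD_derivative)
    have g: "(g has_derivative ?g' (f x)) (at (f x))"
      using Suc.prems(2) x assms(5) by (blast intro: Ck_on_SucD_derivative)
    interpret g: linear "?g' (f x)" using g by (rule has_derivative_linear)
    have exp: "?g' (f x) w = (\<Sum>b\<in>Basis. (w \<bullet> b) *\<^sub>R ?g' (f x) b)" for w
    proof -
      have "?g' (f x) w = ?g' (f x) (\<Sum>b\<in>Basis. (w \<bullet> b) *\<^sub>R b)"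
        by (simp only: euclidean_representation)
      then show ?thesis by (simp only: g.sum g.scale)
    qed
    show "((\<lambda>x. g (f x)) has_derivative
        (\<lambda>v. \<Sum>b\<in>Basis. (?f' x v \<bullet> b) *\<^sub>R ?g' (f x) b)) (at x)"
      using has_derivative_compose[OF f g] by (rule has_derivative_eq_rhs) (rule ext, rule exp)
  next
    fix v
    show "Ck_on n (\<lambda>x. \<Sum>b\<in>Basis. (?f' x v \<bullet> b) *\<^sub>R ?g' (f x) b) U"
    proof (intro Ck_on_sum[OF assms(1)] Ck_on_bilinear[OF bounded_bilinear_scaleR assms(1)])
      fix b :: 'b
      show "Ck_on n (\<lambda>x. ?f' x v \<bullet> b) U"
        using Suc.prems(1)
        by (intro Ck_on_bilinear[OF bounded_bilinear_inner assms(1)] Ck_on_const) auto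
      show "Ck_on n (\<lambda>x. ?g' (f x) b) U"
        using Suc.prems(2) Ck_on_lower[OF Suc.prems(1)] by (intro Suc.IH) auto
    qed
  qed
qed

lemma smooth_onE:
  assumes "smooth_on S f" "x \<in> S"
  obtains U F where "open U" "x \<in> U" "\<forall>n. Ck_on n F U" "\<forall>y. y \<in> S \<longrightarrow> y \<in> U \<longrightarrow> F y = f y"
proof -
  from assms have "\<exists>U F. open U \<and> x \<in> U \<and> (\<forall>n. Ck_on n F U) \<and> (\<forall>y\<in>S \<inter> U. F y = f y)"
    unfolding smooth_on_def by (rule bspec)
  then obtain U F where 1: "open U" "x \<in> U" "\<forall>n. Ck_on n F U" "\<forall>y\<in>S \<inter> U. F y = f y"
    by (elim exE conjE)
  show thesis
    by (rule that[OF 1(1,2,3)]) (use 1(4) in simp)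
qed

lemma smooth_onI:
  assumes "\<And>x. x \<in> S \<Longrightarrow>
    \<exists>U F. open U \<and> x \<in> U \<and> (\<forall>n. Ck_on n F U) \<and> (\<forall>y. y \<in> S \<longrightarrow> y \<in> U \<longrightarrow> F y = f y)"
  shows "smooth_on S f"
  unfolding smooth_on_def
proof
  fix x assume "x \<in> S"
  then obtain U F where 1: "open U" "x \<in> U" "\<forall>n. Ck_on n F U" "\<forall>y. y \<in> S \<longrightarrow> y \<in> U \<longrightarrow> F y = f y"
    using assms[OF \<open>x \<in> S\<close>] by (elim exE conjE)
  show "\<exists>U F. open U \<and> x \<in> U \<and> (\<forall>n. Ck_on n F U) \<and> (\<forall>y\<in>S \<inter> U. F y = f y)"
    by (rule exI[of _ U], rule exI[of _ F], intro conjI 1(1-3) ballI 1(4)[rule_format]) simp_all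
qed

lemma smooth_on_witness:
  assumes "open U" "x \<in> U" "\<And>n. Ck_on n F U" "\<And>y. y \<in> S \<Longrightarrow> y \<in> U \<Longrightarrow> F y = f y"
  shows "\<exists>U F. open U \<and> x \<in> U \<and> (\<forall>n. Ck_on n F U) \<and> (\<forall>y. y \<in> S \<longrightarrow> y \<in> U \<longrightarrow> F y = f y)"
  by (rule exI[of _ U], rule exI[of _ F], intro conjI allI impI assms)

lemma smooth_on_open_iff:
  assumes "open S" shows "smooth_on S f \<longleftrightarrow> (\<forall>n. Ck_on n f S)"
proof
  assume f: "smooth_on S f"
  show "\<forall>n. Ck_on n f S"
  proof (rule allI, rule Ck_on_local)
    fix n x assume "x \<in> S"
    with f obtain U F where UF: "open U" "x \<in> U" "\<forall>n. Ck_on n F U"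
      "\<forall>y. y \<in> S \<longrightarrow> y \<in> U \<longrightarrow> F y = f y"
      by (rule smooth_onE)
    note UF = UF[rule_format]
    have "Ck_on n f (S \<inter> U)"
      by (rule Ck_on_cong[OF _ _ Ck_on_subset[OF UF(3)]]) (use UF(1,4) assms in auto)
    then show "\<exists>U. open U \<and> x \<in> U \<and> Ck_on n f U"
      using UF(1,2) assms \<open>x \<in> S\<close> by (intro exI[of _ "S \<inter> U"]) auto
  qed
next
  assume f: "\<forall>n. Ck_on n f S"
  show "smooth_on S f"
    by (rule smooth_onI, rule exI[of _ S], rule exI[of _ f], intro conjI allI impI refl assms f[rule_format])
qed

lemma smooth_on_subset:
  assumes "smooth_on S f" "T \<subseteq> S" shows "smooth_on T f"
proof (rule smooth_onI)
  fix x assume "x \<in> T"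
  then have "x \<in> S" using assms(2) by blast
  with assms(1) obtain U F where UF: "open U" "x \<in> U" "\<forall>n. Ck_on n F U"
    "\<forall>y. y \<in> S \<longrightarrow> y \<in> U \<longrightarrow> F y = f y"
    by (rule smooth_onE)
    note UF = UF[rule_format]
  show "\<exists>U F. open U \<and> x \<in> U \<and> (\<forall>n. Ck_on n F U) \<and> (\<forall>y. y \<in> T \<longrightarrow> y \<in> U \<longrightarrow> F y = f y)"
    by (rule smooth_on_witness[OF UF(1-3)]) (use UF(4) assms(2) in auto)
qed

lemma smooth_on_cong:
  assumes "smooth_on S f" "\<And>x. x \<in> S \<Longrightarrow> f x = g x" shows "smooth_on S g"
proof (rule smooth_onI)
  fix x assume "x \<in> S"
  with assms(1) obtain U F where UF: "open U" "x \<in> U" "\<forall>n. Ck_on n F U"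
    "\<forall>y. y \<in> S \<longrightarrow> y \<in> U \<longrightarrow> F y = f y"
    by (rule smooth_onE)
    note UF = UF[rule_format]
  show "\<exists>U F. open U \<and> x \<in> U \<and> (\<forall>n. Ck_on n F U) \<and> (\<forall>y. y \<in> S \<longrightarrow> y \<in> U \<longrightarrow> F y = g y)"
    by (rule smooth_on_witness[OF UF(1-3)]) (simp add: UF(4) assms(2))
qed

lemma smooth_on_local:
  assumes "\<And>x. x \<in> S \<Longrightarrow> \<exists>U. open U \<and> x \<in> U \<and> smooth_on (S \<inter> U) f"
  shows "smooth_on S f"
proof (rule smooth_onI)
  fix x assume "x \<in> S"
  then obtain U where U: "open U" "x \<in> U" "smooth_on (S \<inter> U) f" using assms by blast
  have "x \<in> S \<inter> U" using U(2) \<open>x \<in> S\<close> by blast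
  with U(3) obtain U' F where F: "open U'" "x \<in> U'" "\<forall>n. Ck_on n F U'"
    "\<forall>y. y \<in> S \<inter> U \<longrightarrow> y \<in> U' \<longrightarrow> F y = f y"
    by (rule smooth_onE)
    note F = F[rule_format]
  show "\<exists>U F. open U \<and> x \<in> U \<and> (\<forall>n. Ck_on n F U) \<and> (\<forall>y. y \<in> S \<longrightarrow> y \<in> U \<longrightarrow> F y = f y)"
    by (rule smooth_on_witness[of "U \<inter> U'" _ F])
      (use U F in \<open>auto intro: Ck_on_subset[OF F(3)]\<close>)
qed

lemma smooth_on_const: "smooth_on S (\<lambda>x. c)"
  by (rule smooth_onI, rule smooth_on_witness[OF open_UNIV UNIV_I Ck_on_const]) simp

lemma smooth_on_bounded_linear: "bounded_linear L \<Longrightarrow> smooth_on S L"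
  by (rule smooth_onI, rule smooth_on_witness[OF open_UNIV UNIV_I Ck_on_bounded_linear]) simp_all

lemma smooth_on_linear:
  fixes L :: "'a::euclidean_space \<Rightarrow> 'b::real_normed_vector"
  shows "linear L \<Longrightarrow> smooth_on S L"
  by (simp add: smooth_on_bounded_linear linear_conv_bounded_linear)

lemma smooth_on_ident: "smooth_on S (\<lambda>x. x)"
  by (rule smooth_on_bounded_linear) (rule bounded_linear_ident)

lemma smooth_on_bilinear:
  assumes "bounded_bilinear bop" "smooth_on S f" "smooth_on S g"
  shows "smooth_on S (\<lambda>x. bop (f x) (g x))"
proof (rule smooth_onI)
  fix x assume "x \<in> S"
  obtain U F where F: "open U" "x \<in> U" "\<forall>n. Ck_on n F U"
    "\<forall>y. y \<in> S \<longrightarrow> y \<in> U \<longrightarrow> F y = f y"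
    by (rule smooth_onE[OF assms(2) \<open>x \<in> S\<close>])
    note F = F[rule_format]
  obtain V G where G: "open V" "x \<in> V" "\<forall>n. Ck_on n G V"
    "\<forall>y. y \<in> S \<longrightarrow> y \<in> V \<longrightarrow> G y = g y"
    by (rule smooth_onE[OF assms(3) \<open>x \<in> S\<close>])
    note G = G[rule_format]
  have "Ck_on n (\<lambda>x. bop (F x) (G x)) (U \<inter> V)" for n

    by (intro Ck_on_bilinear[OF assms(1)] Ck_on_subset[OF F(3)] Ck_on_subset[OF G(3)] open_Int F G) auto
  then show "\<exists>U F. open U \<and> x \<in> U \<and> (\<forall>n. Ck_on n F U) \<and>
      (\<forall>y. y \<in> S \<longrightarrow> y \<in> U \<longrightarrow> F y = bop (f y) (g y))"
    using F(1,2,4) G(1,2,4) by (intro smooth_on_witness[of "U \<inter> V" _ "\<lambda>x. bop (F x) (G x)"]) auto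
qed

lemma smooth_on_add:
  assumes "smooth_on S f" "smooth_on S g"
  shows "smooth_on S (\<lambda>x. f x + g x)"
proof (rule smooth_onI)
  fix x assume "x \<in> S"
  obtain U F where F: "open U" "x \<in> U" "\<forall>n. Ck_on n F U"
    "\<forall>y. y \<in> S \<longrightarrow> y \<in> U \<longrightarrow> F y = f y"
    by (rule smooth_onE[OF assms(1) \<open>x \<in> S\<close>])
    note F = F[rule_format]
  obtain V G where G: "open V" "x \<in> V" "\<forall>n. Ck_on n G V"
    "\<forall>y. y \<in> S \<longrightarrow> y \<in> V \<longrightarrow> G y = g y"
    by (rule smooth_onE[OF assms(2) \<open>x \<in> S\<close>])
    note G = G[rule_format]
  have "Ck_on n (\<lambda>x. F x + G x) (U \<inter> V)" for n

    by (intro Ck_on_add Ck_on_subset[OF F(3)] Ck_on_subset[OF G(3)] open_Int F G) auto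
  then show "\<exists>U F. open U \<and> x \<in> U \<and> (\<forall>n. Ck_on n F U) \<and>
      (\<forall>y. y \<in> S \<longrightarrow> y \<in> U \<longrightarrow> F y = f y + g y)"
    using F(1,2,4) G(1,2,4) by (intro smooth_on_witness[of "U \<inter> V" _ "\<lambda>x. F x + G x"]) auto
qed

lemma smooth_on_compose:
  fixes f :: "'a::real_normed_vector \<Rightarrow> 'b::euclidean_space" and g :: "'b \<Rightarrow> 'c::real_normed_vector"
  assumes "smooth_on S f" "smooth_on T g" "f ` S \<subseteq> T"
  shows "smooth_on S (\<lambda>x. g (f x))"
proof (rule smooth_onI)
  fix x assume "x \<in> S"
  obtain U F where F: "open U" "x \<in> U" "\<forall>n. Ck_on n F U"
    "\<forall>y. y \<in> S \<longrightarrow> y \<in> U \<longrightarrow> F y = f y"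
    by (rule smooth_onE[OF assms(1) \<open>x \<in> S\<close>])
    note F = F[rule_format]
  obtain V G where G: "open V" "f x \<in> V" "\<forall>n. Ck_on n G V"
    "\<forall>y. y \<in> T \<longrightarrow> y \<in> V \<longrightarrow> G y = g y"
    by (rule smooth_onE[OF assms(2), of "f x"]) (use assms(3) \<open>x \<in> S\<close> in blast)
    note G = G[rule_format]
  have "continuous_on U F" using F(3)[of 0] by simp
  then have op: "open (U \<inter> F -` V)"
    using F(1) G(1) by (rule continuous_open_preimage)
  have "Ck_on n (\<lambda>x. G (F x)) (U \<inter> F -` V)" for n
    by (rule Ck_on_compose[OF op G(1) Ck_on_subset[OF F(3)] G(3)]) auto
  then show "\<exists>U F. open U \<and> x \<in> U \<and> (\<forall>n. Ck_on n F U) \<and>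
      (\<forall>y. y \<in> S \<longrightarrow> y \<in> U \<longrightarrow> F y = g (f y))"
    using op F(2,4) G(2,4) assms(3) \<open>x \<in> S\<close>
    by (intro smooth_on_witness[of "U \<inter> F -` V" _ "\<lambda>x. G (F x)"]) auto
qed

lemma smooth_on_linear_compose:
  fixes f :: "'a::real_normed_vector \<Rightarrow> 'b::euclidean_space"
  assumes "linear L" "smooth_on S f" shows "smooth_on S (\<lambda>x. L (f x))"
  using smooth_on_compose[OF assms(2) smooth_on_linear[OF assms(1), of UNIV]] by simp

lemma smooth_on_Pair:
  fixes f :: "'a::real_normed_vector \<Rightarrow> 'b::euclidean_space" and g :: "'a \<Rightarrow> 'c::euclidean_space"
  assumes "smooth_on S f" "smooth_on S g"
  shows "smooth_on S (\<lambda>x. (f x, g x))"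
proof -
  have "smooth_on S (\<lambda>x. (f x, 0) + (0, g x))"
    by (intro smooth_on_add smooth_on_linear_compose[where L = "\<lambda>y. (y, 0)"]
        smooth_on_linear_compose[where L = "\<lambda>y. (0, y)"] assms) (auto simp: linear_iff)
  then show ?thesis by simp
qed

lemma smooth_on_uminus:
  fixes f :: "'a::real_normed_vector \<Rightarrow> 'b::euclidean_space"
  shows "smooth_on S f \<Longrightarrow> smooth_on S (\<lambda>x. - f x)"
  by (rule smooth_on_linear_compose) (auto simp: linear_iff)

lemma smooth_on_diff:
  fixes f :: "'a::real_normed_vector \<Rightarrow> 'b::euclidean_space"
  shows "smooth_on S f \<Longrightarrow> smooth_on S g \<Longrightarrow> smooth_on S (\<lambda>x. f x - g x)"
  using smooth_on_add[OF _ smooth_on_uminus] by fastforce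

lemma smooth_on_mult:
  fixes f g :: "'a::real_normed_vector \<Rightarrow> 'b::real_normed_algebra"
  shows "smooth_on S f \<Longrightarrow> smooth_on S g \<Longrightarrow> smooth_on S (\<lambda>x. f x * g x)"
  by (rule smooth_on_bilinear[OF bounded_bilinear_mult])

lemma smooth_on_scaleR:
  "smooth_on S f \<Longrightarrow> smooth_on S g \<Longrightarrow> smooth_on S (\<lambda>x. f x *\<^sub>R g x)"
  by (rule smooth_on_bilinear[OF bounded_bilinear_scaleR])

lemma smooth_on_inner:
  "smooth_on S f \<Longrightarrow> smooth_on S g \<Longrightarrow> smooth_on S (\<lambda>x. f x \<bullet> g x)"
  by (rule smooth_on_bilinear[OF bounded_bilinear_inner])

lemma smooth_on_power:
  fixes f :: "'a::real_normed_vector \<Rightarrow> 'b::real_normed_algebra_1"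
  shows "smooth_on S f \<Longrightarrow> smooth_on S (\<lambda>x. f x ^ n)"
  by (induction n) (auto intro: smooth_on_const smooth_on_mult)

lemma smooth_on_norm_power2:
  fixes f :: "'a::real_normed_vector \<Rightarrow> 'b::euclidean_space"
  assumes "smooth_on S f" shows "smooth_on S (\<lambda>x. (norm (f x))\<^sup>2)"
  unfolding power2_norm_eq_inner using assms by (intro smooth_on_inner)

text \<open>The derivative of the inverse is a product of inverses, so the order of differentiability can be
  raised step by step. The derivatives of the square root and of cis are likewise expressed by these
  functions themselves.\<close>

lemma Ck_on_inverse:
  "Ck_on n (inverse :: 'b \<Rightarrow> 'b::{real_normed_field, euclidean_space}) (- {0})"
proof (induction n)
  case 0
  then show ?case by (auto intro!: continuous_intros)
next
  case (Suc n)
  show ?case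
  proof (rule Ck_on_SucI)
    fix x :: 'b assume "x \<in> - {0}"
    then show "(inverse has_derivative (\<lambda>h. - (inverse x * h * inverse x))) (at x)"
      by (intro has_derivative_inverse') simp
  next
    fix v :: 'b
    have "Ck_on n (\<lambda>x. (inverse x * inverse x) * (- v)) (- {0})"
      by (intro Ck_on_bilinear[OF bounded_bilinear_mult] Suc Ck_on_const) auto
    then show "Ck_on n (\<lambda>x. - (inverse x * v * inverse x)) (- {0})"
      by (simp add: mult_ac)
  qed auto
qed

lemma smooth_on_inverse:
  fixes f :: "'a::real_normed_vector \<Rightarrow> 'b::{real_normed_field, euclidean_space}"
  assumes "smooth_on S f" "\<And>x. x \<in> S \<Longrightarrow> f x \<noteq> 0"
  shows "smooth_on S (\<lambda>x. inverse (f x))"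
proof -
  have "smooth_on (- {0}) (inverse :: 'b \<Rightarrow> 'b)"
    by (subst smooth_on_open_iff) (auto intro: Ck_on_inverse)
  moreover have "f ` S \<subseteq> - {0}" using assms(2) by auto
  ultimately show ?thesis by (rule smooth_on_compose[OF assms(1)])
qed

lemma smooth_on_divide:
  fixes f g :: "'a::real_normed_vector \<Rightarrow> 'b::{real_normed_field, euclidean_space}"
  assumes "smooth_on S f" "smooth_on S g" "\<And>x. x \<in> S \<Longrightarrow> g x \<noteq> 0"
  shows "smooth_on S (\<lambda>x. f x / g x)"
  unfolding divide_inverse using assms by (intro smooth_on_mult smooth_on_inverse)

lemma Ck_on_sqrt: "Ck_on n sqrt {0<..}"
proof (induction n)
  case 0
  then show ?case by (auto intro!: continuous_intros)
next
  case (Suc n)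
  show ?case
  proof (rule Ck_on_SucI)
    fix x :: real assume "x \<in> {0<..}"
    then have "(sqrt has_real_derivative inverse (sqrt x) / 2) (at x)"
      by (intro DERIV_real_sqrt) simp
    then show "(sqrt has_derivative (\<lambda>h. inverse (sqrt x) / 2 * h)) (at x)"
      by (simp only: has_field_derivative_def)
  next
    fix v :: real
    have "Ck_on n (\<lambda>x. inverse (sqrt x)) {0<..}"
      by (rule Ck_on_compose[OF _ _ Suc Ck_on_inverse]) auto
    then have "Ck_on n (\<lambda>x. inverse (sqrt x) * (v / 2)) {0<..}"
      by (intro Ck_on_bilinear[OF bounded_bilinear_mult] Ck_on_const) auto
    then show "Ck_on n (\<lambda>x. inverse (sqrt x) / 2 * v) {0<..}" by simp
  qed auto
qed

lemma smooth_on_sqrt: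
  assumes "smooth_on S f" "\<And>x. x \<in> S \<Longrightarrow> 0 < f x"
  shows "smooth_on S (\<lambda>x. sqrt (f x))"
proof -
  have "smooth_on {0<..} sqrt"
    by (subst smooth_on_open_iff) (auto intro: Ck_on_sqrt)
  moreover have "f ` S \<subseteq> {0<..}" using assms(2) by auto
  ultimately show ?thesis by (rule smooth_on_compose[OF assms(1)])
qed

lemma smooth_on_norm:
  fixes f :: "'a::real_normed_vector \<Rightarrow> 'b::euclidean_space"
  assumes "smooth_on S f" "\<And>x. x \<in> S \<Longrightarrow> f x \<noteq> 0"
  shows "smooth_on S (\<lambda>x. norm (f x))"
  unfolding norm_eq_sqrt_inner using assms by (intro smooth_on_sqrt smooth_on_inner) auto

lemma smooth_on_cis: "smooth_on S cis"
proof -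
  have "Ck_on n cis UNIV" for n
  proof (induction n)
    case 0
    then show ?case by (auto intro!: continuous_intros)
  next
    case (Suc n)
    show ?case
    proof (rule Ck_on_SucI)
      fix x :: real
      show "(cis has_derivative (\<lambda>h. cis x * (\<i> * of_real h))) (at x)"
        using has_derivative_compose[OF
            bounded_linear_imp_has_derivative[OF
              bounded_linear_compose[OF bounded_linear_mult_right bounded_linear_of_real]]
            DERIV_exp[unfolded has_field_derivative_def], of \<i> x]
        by (simp add: cis_conv_exp[abs_def])
    next
      fix v :: real
      show "Ck_on n (\<lambda>x. cis x * (\<i> * of_real v)) UNIV"
        by (intro Ck_on_bilinear[OF bounded_bilinear_mult] Ck_on_const Suc) auto
    qed auto
  qed
  then have "smooth_on UNIV cis" unfolding smooth_on_open_iff[OF open_UNIV] ..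
  then show ?thesis by (rule smooth_on_subset) simp
qed

lemma smooth_on_imp_continuous_on: "smooth_on S f \<Longrightarrow> continuous_on S f"
  unfolding continuous_on_eq_continuous_within
proof
  fix x assume "smooth_on S f" "x \<in> S"
  then obtain U F where F: "open U" "x \<in> U" "\<forall>n. Ck_on n F U"
    "\<forall>y. y \<in> S \<longrightarrow> y \<in> U \<longrightarrow> F y = f y"
    by (rule smooth_onE)
    note F = F[rule_format]
  have "isCont F x"
    using F(1,2) F(3)[of 0] by (simp add: continuous_on_eq_continuous_at)
  then have "continuous (at x within S) F" using continuous_at_imp_continuous_within by blast
  moreover have "eventually (\<lambda>y. y \<in> S \<inter> U) (at x within S)"
    using F(1,2) \<open>x \<in> S\<close> by (auto simp: eventually_at_topological)
  then have "eventually (\<lambda>y. F y = f y) (at x within S)"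
    by eventually_elim (use F(4) in auto)
  moreover have "F x = f x" using F \<open>x \<in> S\<close> by auto
  ultimately show "continuous (at x within S) f"
    unfolding continuous_within by (metis (mono_tags, lifting) tendsto_cong)
qed

lemma smooth_on_has_derivative:
  assumes "smooth_on S f" "x \<in> S"
  shows "(f has_derivative frechet_derivative f (at x within S)) (at x within S)"
proof -
  obtain U F where F: "open U" "x \<in> U" "\<forall>n. Ck_on n F U"
    "\<forall>y. y \<in> S \<longrightarrow> y \<in> U \<longrightarrow> F y = f y"
    using assms by (rule smooth_onE)
    note F = F[rule_format]
  from F(3)[of "Suc 0"] have "(F has_derivative frechet_derivative F (at x)) (at x)"
    using F(2) by (rule Ck_on_SucD_derivative)
  then have "(F has_derivative frechet_derivative F (at x)) (at x within S)"
    by (rule has_derivative_at_withinI)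
  then have "(f has_derivative frechet_derivative F (at x)) (at x within S)"
    by (rule has_derivative_transform_eventually)
      (use F(1,2,4) assms(2) in \<open>auto simp: eventually_at_topological\<close>)
  then show ?thesis by (auto simp: differentiable_def frechet_derivative_works[symmetric])
qed

lemma smooth_on_open_has_derivative:
  assumes "smooth_on S f" "x \<in> S" "open S"
  shows "(f has_derivative frechet_derivative f (at x)) (at x)"
  using smooth_on_has_derivative[OF assms(1,2)] unfolding at_within_open[OF assms(2,3)] .

lemma smooth_on_frechet_derivative:
  assumes "smooth_on S f" "open S"
  shows "smooth_on S (\<lambda>x. frechet_derivative f (at x) v)"
  unfolding smooth_on_open_iff[OF assms(2)]
proof
  fix n
  from assms(1) have "Ck_on (Suc n) f S" unfolding smooth_on_open_iff[OF assms(2)] ..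
  then show "Ck_on n (\<lambda>x. frechet_derivative f (at x) v) S" by simp
qed

section \<open>Smooth inverses and tangent spaces\<close>

lemma Ck_on_prod:
  fixes f :: "'i \<Rightarrow> 'a::real_normed_vector \<Rightarrow> real"
  assumes "open U" "\<And>i. i \<in> I \<Longrightarrow> Ck_on n (f i) U"
  shows "Ck_on n (\<lambda>x. \<Prod>i\<in>I. f i x) U"
proof (cases "finite I")
  case True
  then show ?thesis using assms(2)
  proof (induction I rule: finite_induct)
    case empty
    show ?case by (simp add: Ck_on_const)
  next
    case (insert i I)
    have "Ck_on n (\<lambda>x. f i x * (\<Prod>i\<in>I. f i x)) U"
      by (rule Ck_on_bilinear[OF bounded_bilinear_mult assms(1)]) (simp_all add: insert)
    then show ?case by (simp add: insert)
  qed
qed (simp add: Ck_on_const)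

lemma Ck_on_det:
  fixes M :: "'a::real_normed_vector \<Rightarrow> real^'n^'n"
  assumes "open U" "\<And>i j. Ck_on n (\<lambda>x. M x $ i $ j) U"
  shows "Ck_on n (\<lambda>x. det (M x)) U"
  unfolding det_def
  by (rule Ck_on_sum[OF assms(1)],
      rule Ck_on_bilinear[OF bounded_bilinear_mult assms(1) Ck_on_const],
      rule Ck_on_prod[OF assms(1)], rule assms(2))

lemma Ck_on_vec_lambda:
  fixes F :: "'a::real_normed_vector \<Rightarrow> 'n::finite \<Rightarrow> real"
  assumes "open U" "\<And>k. Ck_on n (\<lambda>x. F x k) U"
  shows "Ck_on n (\<lambda>x. \<chi> k. F x k) U"
proof -
  have "(\<chi> k. F x k) = (\<Sum>k\<in>UNIV. F x k *\<^sub>R axis k 1)" for x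
    by (simp add: vec_eq_iff axis_def if_distrib cong: if_cong)
  moreover have "Ck_on n (\<lambda>x. \<Sum>k\<in>UNIV. F x k *\<^sub>R axis k (1::real)) U"
    by (rule Ck_on_sum[OF assms(1)],
        rule Ck_on_bilinear[OF bounded_bilinear_scaleR assms(1) assms(2) Ck_on_const])
  ultimately show ?thesis by simp
qed

text \<open>The derivative of the inverse is the inverse matrix, whose entries are by Cramer's rule
  rational functions of the entries of the derivative; so each order of differentiability of the
  inverse gives the next one.\<close>

lemma smooth_inverse:
  fixes f :: "real^'n \<Rightarrow> real^'n" and g :: "real^'n \<Rightarrow> real^'n"
  assumes U: "open U" and f: "smooth_on U f" and gf: "\<And>x. x \<in> U \<Longrightarrow> g (f x) = x"
    and surj: "\<And>x. x \<in> U \<Longrightarrow> surj (frechet_derivative f (at x))"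
  shows "open (f ` U)" "smooth_on (f ` U) g"
proof -
  let ?f' = "\<lambda>x. frechet_derivative f (at x)"
  have cont: "continuous_on U f" using f by (rule smooth_on_imp_continuous_on)
  have inj: "inj_on f U" using gf by (rule inj_on_inverseI)
  show op: "open (f ` U)" by (rule invariance_of_domain[OF cont U inj])
  have fder: "(f has_derivative ?f' x) (at x)" if "x \<in> U" for x
    by (rule smooth_on_open_has_derivative[OF f that U])
  define M where "M x = matrix (?f' x)" for x
  have lin: "linear (?f' x)" if "x \<in> U" for x
    using fder[OF that] by (rule has_derivative_linear)
  have M: "M x *v v = ?f' x v" if "x \<in> U" for x v
    unfolding M_def using matrix_works[of "?f' x" v] lin[OF that]
    by (simp add: linear_def scalar_mult_eq_scaleR[abs_def])
  have detM: "det (M x) \<noteq> 0" if xU: "x \<in> U" for x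
  proof -
    obtain h where h: "linear h" "?f' x \<circ> h = id"
      using linear_surjective_right_inverse[OF lin[OF xU] surj[OF xU]] by auto
    have "M x ** matrix h = mat 1"
      unfolding M_def using h lin[OF xU] by (metis matrix_compose matrix_id_mat_1)
    then show ?thesis by (metis det_I det_mul mult_zero_left zero_neq_one)
  qed
  define G' where "G' x v = (\<chi> k. det (\<chi> i j. if j = k then v $ i else M x $ i $ j) / det (M x))"
    for x v
  have G': "M x *v y = v \<longleftrightarrow> y = G' x v" if "x \<in> U" for x y v
    unfolding G'_def using cramer[OF detM[OF that]] by simp
  have gder: "(g has_derivative G' (g y)) (at y)" if "y \<in> f ` U" for y
  proof -
    obtain x where x: "x \<in> U" "y = f x" using \<open>y \<in> f ` U\<close> by auto
    have "?f' x \<circ> G' x = id"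
    proof (rule ext)
      fix v show "(?f' x \<circ> G' x) v = id v"
        using G'[OF x(1), of "G' x v" v] M[OF x(1)] by simp
    qed
    with has_derivative_inverse_strong[OF U x(1) cont gf fder[OF x(1)], of "G' x"]
    show ?thesis using gf[OF x(1)] x by simp
  qed
  have "Ck_on n g (f ` U)" for n
  proof (induction n)
    case 0
    have "continuous_on (f ` U) g"
      by (rule continuous_at_imp_continuous_on, rule ballI, rule has_derivative_continuous, rule gder)
    then show ?case by simp
  next
    case (Suc n)
    have Mg: "Ck_on n (\<lambda>y. M (g y) $ i $ j) (f ` U)" for i j
    proof -
      have "smooth_on U (\<lambda>x. ?f' x (axis j 1) $ i)"
        using smooth_on_linear_compose[OF _ smooth_on_frechet_derivative[OF f U], of "\<lambda>v. v $ i"]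
        by (simp add: linear_iff)
      then have "Ck_on n (\<lambda>x. ?f' x (axis j 1) $ i) U"
        unfolding smooth_on_open_iff[OF U] ..
      then have "Ck_on n (\<lambda>y. ?f' (g y) (axis j 1) $ i) (f ` U)"
        by (rule Ck_on_compose[OF op U Suc]) (use gf in auto)
      then show ?thesis by (simp add: M_def matrix_def)
    qed
    show ?case
    proof (rule Ck_on_SucI[OF op gder])
      fix v
      show "Ck_on n (\<lambda>y. G' (g y) v) (f ` U)"
        unfolding G'_def divide_inverse
      proof (rule Ck_on_vec_lambda[OF op], rule Ck_on_bilinear[OF bounded_bilinear_mult op])
        fix k
        show "Ck_on n (\<lambda>y. det (\<chi> i j. if j = k then v $ i else M (g y) $ i $ j)) (f ` U)"
        proof (rule Ck_on_det[OF op])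
          fix i j
          show "Ck_on n (\<lambda>y. (\<chi> i j. if j = k then v $ i else M (g y) $ i $ j) $ i $ j) (f ` U)"
            by (cases "j = k") (simp_all add: Ck_on_const Mg)
        qed
        have d: "Ck_on n (\<lambda>y. det (M (g y))) (f ` U)"
          by (rule Ck_on_det[OF op Mg])
        have sub: "(\<lambda>y. det (M (g y))) ` f ` U \<subseteq> - {0}" using gf detM by auto
        show "Ck_on n (\<lambda>y. inverse (det (M (g y)))) (f ` U)"
          by (rule Ck_on_compose[OF op _ d Ck_on_inverse sub]) (simp add: open_Compl)
      qed
    qed
  qed
  then show "smooth_on (f ` U) g" unfolding smooth_on_open_iff[OF op] by blast
qed

lemma tangent_spaceI:
  assumes "e > 0" "smooth_on {-e<..<e} \<gamma>" "\<gamma> ` {-e<..<e} \<subseteq> Z" "\<gamma> 0 = x"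
    "(\<gamma> has_vector_derivative v) (at 0)"
  shows "v \<in> tangent_space Z x"
  unfolding tangent_space_def using assms by blast

lemma tangent_spaceE:
  assumes "v \<in> tangent_space Z x"
  obtains \<gamma> e where "e > 0" "smooth_on {-e<..<e} \<gamma>" "\<gamma> ` {-e<..<e} \<subseteq> Z" "\<gamma> 0 = x"
    "(\<gamma> has_vector_derivative v) (at 0)"
  using assms unfolding tangent_space_def by blast

text \<open>The derivative within Z is only determined on tangent vectors, and there it is the velocity of
  image curves.\<close>

lemma has_vector_derivative_along_curve:
  assumes f: "(f has_derivative D) (at x within Z)"
    and \<gamma>: "(\<gamma> has_vector_derivative v) (at 0)" "\<gamma> 0 = x"
    and e: "e > 0" "\<gamma> ` {-e<..<e} \<subseteq> Z"
  shows "((\<lambda>t. f (\<gamma> t)) has_vector_derivative D v) (at (0::real))"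
proof -
  have "(\<gamma> has_vector_derivative v) (at 0 within {-e<..<e})"
    using \<gamma>(1) by (rule has_vector_derivative_at_within)
  moreover have "(f has_derivative D) (at (\<gamma> 0) within \<gamma> ` {-e<..<e})"
    using f e(2) \<gamma>(2) by (metis has_derivative_subset)
  ultimately have "(f \<circ> \<gamma> has_vector_derivative D v) (at 0 within {-e<..<e})"
    by (rule vector_derivative_diff_chain_within)
  then show ?thesis using e(1) by (simp add: at_within_open[of 0 "{-e<..<e}"] o_def)
qed

lemma smooth_along_line:
  fixes F :: "'a::euclidean_space \<Rightarrow> 'b::real_normed_vector"
  assumes "open V" "smooth_on V F" "u \<in> V"
  obtains e where "e > 0" "smooth_on {-e<..<e} (\<lambda>t. F (u + t *\<^sub>R a))"
    "\<And>t. t \<in> {-e<..<e} \<Longrightarrow> u + t *\<^sub>R a \<in> V"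
    "((\<lambda>t. F (u + t *\<^sub>R a)) has_vector_derivative frechet_derivative F (at u) a) (at 0)"
proof -
  let ?l = "\<lambda>t::real. u + t *\<^sub>R a"
  have "open (?l -` V)"
    by (rule open_vimage[OF assms(1)]) (intro continuous_intros)
  moreover have "0 \<in> ?l -` V" using assms(3) by simp
  ultimately obtain e where e: "e > 0" "ball 0 e \<subseteq> ?l -` V"
    by (rule openE)
  have V: "u + t *\<^sub>R a \<in> V" if "t \<in> {-e<..<e}" for t
  proof -
    have "t \<in> ball 0 e" using that by (simp add: dist_real_def abs_less_iff)
    with e(2) have "t \<in> ?l -` V" by (rule subsetD)
    then show ?thesis by simp
  qed
  have sm: "smooth_on {-e<..<e} (\<lambda>t. F (u + t *\<^sub>R a))"
  proof (rule smooth_on_compose[OF _ assms(2)])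
    show "smooth_on {-e<..<e} ?l"
      by (intro smooth_on_add smooth_on_const smooth_on_scaleR smooth_on_ident)
    show "?l ` {-e<..<e} \<subseteq> V" using V by auto
  qed
  have l: "(?l has_vector_derivative a) (at 0)"
    unfolding has_vector_derivative_def by (rule derivative_eq_intros refl | simp)+
  have "(F has_derivative frechet_derivative F (at u)) (at (?l 0))"
    using smooth_on_open_has_derivative[OF assms(2,3,1)] by simp
  then have "(F \<circ> ?l has_vector_derivative frechet_derivative F (at u) a) (at 0)"
    by (rule vector_derivative_diff_chain_within[OF l has_derivative_at_withinI])
  then show thesis using that[OF e(1) sm V] by (simp add: o_def)
qed

lemma tangent_space_smooth_image:
  fixes F :: "'b::euclidean_space \<Rightarrow> 'a::euclidean_space"
  assumes "open V" "smooth_on V F" "F ` V \<subseteq> Z" "u \<in> V"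
  shows "frechet_derivative F (at u) a \<in> tangent_space Z (F u)"
proof -
  obtain e where e: "e > 0" "smooth_on {-e<..<e} (\<lambda>t. F (u + t *\<^sub>R a))"
    "\<And>t. t \<in> {-e<..<e} \<Longrightarrow> u + t *\<^sub>R a \<in> V"
    "((\<lambda>t. F (u + t *\<^sub>R a)) has_vector_derivative frechet_derivative F (at u) a) (at 0)"
    using smooth_along_line[OF assms(1,2,4), of a] by blast
  show ?thesis
    by (rule tangent_spaceI[OF e(1,2) _ _ e(4)]) (use e(3) assms(3) in auto)
qed

lemma tangent_space_linear_image:
  fixes \<Phi> :: "'a::euclidean_space \<Rightarrow> 'b::euclidean_space"
  assumes "linear \<Phi>" "\<Phi> ` Z \<subseteq> Z'" "v \<in> tangent_space Z x"
  shows "\<Phi> v \<in> tangent_space Z' (\<Phi> x)"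
proof -
  from assms(3) obtain \<gamma> e where \<gamma>: "e > 0" "smooth_on {-e<..<e} \<gamma>" "\<gamma> ` {-e<..<e} \<subseteq> Z" "\<gamma> 0 = x"
    "(\<gamma> has_vector_derivative v) (at 0)" by (rule tangent_spaceE)
  have bl: "bounded_linear \<Phi>" using assms(1) by (simp add: linear_conv_bounded_linear)
  show ?thesis
  proof (rule tangent_spaceI[OF \<gamma>(1)])
    show "smooth_on {-e<..<e} (\<lambda>t. \<Phi> (\<gamma> t))"
      by (rule smooth_on_linear_compose[OF assms(1) \<gamma>(2)])
    show "((\<lambda>t. \<Phi> (\<gamma> t)) has_vector_derivative \<Phi> v) (at 0)"
      by (rule bounded_linear.has_vector_derivative[OF bl \<gamma>(5)])
  qed (use \<gamma>(3,4) assms(2) in auto)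
qed

text \<open>In a flattening chart F the tangent space is the preimage of the linear subspace under the
  derivative of F.\<close>

lemma tangent_space_submanifold:
  fixes Z :: "'a::euclidean_space set"
  assumes "smooth_submanifold n Z" "x \<in> Z"
  shows "subspace (tangent_space Z x)" "dim (tangent_space Z x) = n"
proof -
  obtain U and F :: "'a \<Rightarrow> 'a" and F' S where U: "open U" "x \<in> U" "open (F ` U)"
    and F: "smooth_on U F" "smooth_on (F ` U) F'" "\<forall>y\<in>U. F' (F y) = y"
    and S: "subspace S" "dim S = n" "F ` (U \<inter> Z) = F ` U \<inter> S"
    using assms unfolding smooth_submanifold_def by meson
  have Fx: "F x \<in> F ` U" "F x \<in> S" using U(2) S(3) assms(2) by auto
  define D where "D = frechet_derivative F (at x)"
  define D' where "D' = frechet_derivative F' (at (F x))"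
  have D: "(F has_derivative D) (at x)"
    unfolding D_def by (rule smooth_on_open_has_derivative[OF F(1) U(2,1)])
  have D': "(F' has_derivative D') (at (F x))"
    unfolding D'_def by (rule smooth_on_open_has_derivative[OF F(2) Fx(1) U(3)])
  have linD: "linear D" and linD': "linear D'"
    using D D' by (auto intro: has_derivative_linear)
  have D'D: "D' (D v) = v" for v
  proof -
    have "((\<lambda>y. F' (F y)) has_derivative (\<lambda>v. D' (D v))) (at x)"
      by (rule has_derivative_compose[OF D D'])
    moreover have "((\<lambda>y. F' (F y)) has_derivative (\<lambda>v. v)) (at x)"
      by (rule has_derivative_transform_within_open[OF has_derivative_ident U(1,2)])
        (use F(3) in auto)
    ultimately show ?thesis by (metis has_derivative_unique)
  qed
  have "tangent_space Z x = D' ` S"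
  proof (intro equalityI subsetI)
    fix v assume "v \<in> tangent_space Z x"
    then obtain \<gamma> e where \<gamma>: "e > 0" "smooth_on {-e<..<e} \<gamma>" "\<gamma> ` {-e<..<e} \<subseteq> Z" "\<gamma> 0 = x"
      "(\<gamma> has_vector_derivative v) (at 0)" by (rule tangent_spaceE)
    have der: "((\<lambda>t. F (\<gamma> t)) has_vector_derivative D v) (at 0)"
      by (rule has_vector_derivative_along_curve[OF has_derivative_at_withinI[OF D] \<gamma>(5,4) \<gamma>(1) \<gamma>(3)])
    have "isCont \<gamma> 0" using \<gamma>(5) by (rule has_vector_derivative_continuous)
    then have "eventually (\<lambda>t. \<gamma> t \<in> U) (at 0)"
      using U(1,2) \<gamma>(4) by (auto simp: isCont_def topological_tendstoD)
    moreover have "eventually (\<lambda>t. t \<in> {-e<..<e}) (at (0::real))"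
      using \<gamma>(1) by (intro eventually_at_in_open') auto
    ultimately have ev: "eventually (\<lambda>t. F (\<gamma> t) \<in> S) (at 0)"
    proof eventually_elim
      case (elim t)
      then show ?case using S(3) \<gamma>(3) by blast
    qed
    have "D v \<bullet> c = 0" if c: "c \<in> orthogonal_comp S" for c
    proof -
      have d: "((\<lambda>t. F (\<gamma> t) \<bullet> c) has_vector_derivative D v \<bullet> c) (at 0)"
        by (rule bounded_linear.has_vector_derivative[OF bounded_linear_inner_left der])
      have perp: "y \<bullet> c = 0" if "y \<in> S" for y
        using c that by (auto simp: orthogonal_comp_def orthogonal_def inner_commute)
      have "eventually (\<lambda>t. F (\<gamma> t) \<bullet> c = 0) (at 0)"
        using ev by eventually_elim (rule perp)
      moreover have "F (\<gamma> 0) \<bullet> c = 0" using perp[OF Fx(2)] \<gamma>(4) by simp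
      ultimately have "((\<lambda>t::real. 0::real) has_vector_derivative D v \<bullet> c) (at 0)"
        using has_derivative_transform_eventually[OF d[unfolded has_vector_derivative_def],
            of "\<lambda>t. 0"]
        by (simp add: has_vector_derivative_def)
      then show ?thesis
        by (rule vector_derivative_unique_at[OF _ has_vector_derivative_const])
    qed
    then have "D v \<in> orthogonal_comp (orthogonal_comp S)"
      by (auto simp: orthogonal_comp_def orthogonal_def inner_commute)
    then have "D v \<in> S" using orthogonal_comp_self[OF S(1)] by simp
    then show "v \<in> D' ` S" using D'D by (metis imageI)
  next
    fix v assume "v \<in> D' ` S"
    then obtain s where s: "s \<in> S" "v = D' s" by auto
    obtain e where e: "e > 0" "smooth_on {-e<..<e} (\<lambda>t. F' (F x + t *\<^sub>R s))"
      "\<And>t. t \<in> {-e<..<e} \<Longrightarrow> F x + t *\<^sub>R s \<in> F ` U"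
      "((\<lambda>t. F' (F x + t *\<^sub>R s)) has_vector_derivative D' s) (at 0)"
      using smooth_along_line[OF U(3) F(2) Fx(1), of s] unfolding D'_def by blast
    have "F' (F x + t *\<^sub>R s) \<in> Z" if "t \<in> {-e<..<e}" for t
    proof -
      have "F x + t *\<^sub>R s \<in> F ` U \<inter> S"
        using e(3)[OF that] S(1) s(1) Fx(2) by (auto intro: subspace_add subspace_scale)
      then have "F x + t *\<^sub>R s \<in> F ` (U \<inter> Z)" unfolding S(3) .
      then obtain y where "y \<in> U" "y \<in> Z" "F x + t *\<^sub>R s = F y" by auto
      then show ?thesis using F(3) by simp
    qed
    then show "v \<in> tangent_space Z x"
      unfolding s(2) by (intro tangent_spaceI[OF e(1,2) _ _ e(4)]) (use F(3) U(2) in auto)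
  qed
  moreover have "dim (D' ` S) = dim S"
  proof -
    have "surj D'" using D'D by (metis surjI)
    then have "inj D'" using linD' by (simp add: linear_surjective_imp_injective)
    then have "inj_on D' (span S)" by (rule inj_on_subset) simp
    with linD' show ?thesis by (rule dim_image_eq)
  qed
  ultimately show "subspace (tangent_space Z x)" "dim (tangent_space Z x) = n"
    using S(2) linear_subspace_image[OF linD' S(1)] by simp_all
qed

section \<open>Quotients with slices\<close>

text \<open>A slice is a section \<open>\<sigma>\<close> of the projection over an open set of coordinates V, together with the
  map \<open>\<psi>\<close> that sends every point whose orbit meets the slice to the coordinates of its orbit.\<close>

definition slice ::
    "'a::euclidean_space set \<Rightarrow> ('a \<Rightarrow> 'p) \<Rightarrow> (real^4) set \<Rightarrow> (real^4 \<Rightarrow> 'a) \<Rightarrow> ('a \<Rightarrow> real^4) \<Rightarrow> bool" where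
  "slice Z pr V \<sigma> \<psi> \<longleftrightarrow> open V \<and> smooth_on V \<sigma> \<and> \<sigma> ` V \<subseteq> Z \<and> (\<forall>u\<in>V. \<psi> (\<sigma> u) = u) \<and>
     openin (top_of_set Z) {x \<in> Z. pr x \<in> pr ` \<sigma> ` V} \<and>
     smooth_on {x \<in> Z. pr x \<in> pr ` \<sigma> ` V} \<psi> \<and>
     (\<forall>x\<in>Z. \<forall>y\<in>Z. pr x \<in> pr ` \<sigma> ` V \<longrightarrow> pr x = pr y \<longrightarrow> \<psi> x = \<psi> y)"

lemma sliceD:
  assumes "slice Z pr V \<sigma> \<psi>"
  shows "open V" "smooth_on V \<sigma>" "\<And>u. u \<in> V \<Longrightarrow> \<sigma> u \<in> Z" "\<And>u. u \<in> V \<Longrightarrow> \<psi> (\<sigma> u) = u"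
    "openin (top_of_set Z) {x \<in> Z. pr x \<in> pr ` \<sigma> ` V}" "smooth_on {x \<in> Z. pr x \<in> pr ` \<sigma> ` V} \<psi>"
    "\<And>x y. x \<in> Z \<Longrightarrow> y \<in> Z \<Longrightarrow> pr x \<in> pr ` \<sigma> ` V \<Longrightarrow> pr x = pr y \<Longrightarrow> \<psi> x = \<psi> y"
  using assms unfolding slice_def by (blast+)

lemma slice_coordinates:
  assumes "slice Z pr V \<sigma> \<psi>" "x \<in> Z" "pr x \<in> pr ` \<sigma> ` V"
  shows "\<psi> x \<in> V" "pr (\<sigma> (\<psi> x)) = pr x"
proof -
  from assms(3) obtain u where u: "u \<in> V" "pr x = pr (\<sigma> u)" by blast
  have "\<psi> x = \<psi> (\<sigma> u)"
    by (rule sliceD(7)[OF assms(1,2) sliceD(3)[OF assms(1) u(1)] assms(3) u(2)])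
  then have "\<psi> x = u" using sliceD(4)[OF assms(1) u(1)] by simp
  with u show "\<psi> x \<in> V" "pr (\<sigma> (\<psi> x)) = pr x" by simp_all
qed

lemma at_within_openin:
  assumes "openin (top_of_set Z) W" "x \<in> W"
  shows "at x within W = at x within Z"
proof -
  obtain T where T: "open T" "W = Z \<inter> T" using assms(1) by (auto simp: openin_open)
  show ?thesis by (rule at_within_nhd[of x T]) (use T assms(2) in auto)
qed

lemma smooth_on_openin_has_derivative:
  assumes "smooth_on W f" "openin (top_of_set Z) W" "x \<in> W"
  shows "(f has_derivative frechet_derivative f (at x within Z)) (at x within Z)"
  using smooth_on_has_derivative[OF assms(1,3)] unfolding at_within_openin[OF assms(2,3)] .

lemma curve_eventually_in_openin:
  assumes "openin (top_of_set Z) W" "\<gamma> 0 \<in> W" "(\<gamma> has_vector_derivative v) (at (0::real))"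
    "e > 0" "\<gamma> ` {-e<..<e} \<subseteq> Z"
  shows "eventually (\<lambda>t. \<gamma> t \<in> W) (at 0)"
proof -
  obtain T where T: "open T" "W = Z \<inter> T" using assms(1) by (auto simp: openin_open)
  have "isCont \<gamma> 0" using assms(3) by (rule has_vector_derivative_continuous)
  then have "eventually (\<lambda>t. \<gamma> t \<in> T) (at 0)"
    using T assms(2) by (auto simp: isCont_def topological_tendstoD)
  moreover have "eventually (\<lambda>t. t \<in> {-e<..<e}) (at (0::real))"
    using assms(4) by (intro eventually_at_in_open') auto
  ultimately show ?thesis
  proof eventually_elim
    case (elim t)
    then show ?case using T(2) assms(5) by blast
  qed
qed

lemma second_countable_top_of_set:
  "second_countable (top_of_set (S :: 'a::second_countable_topology set))"
proof -
  obtain B :: "'a set set" where B: "countable B" "topological_basis B"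
    using ex_countable_basis by blast
  have "second_countable (euclidean :: 'a topology)"
    unfolding second_countable_def
  proof (intro exI[of _ B] conjI ballI allI impI)
    show "\<And>V. V \<in> B \<Longrightarrow> openin euclidean V" using topological_basis_open[OF B(2)] by simp
    fix U :: "'a set" and x :: 'a assume "openin euclidean U \<and> x \<in> U"
    then show "\<exists>V\<in>B. x \<in> V \<and> V \<subseteq> U" using topological_basisE[OF B(2), of U x] by auto
  qed (rule B)
  then show ?thesis by (rule second_countable_subtopology)
qed

text \<open>What is needed from a free action of a compact group by diffeomorphisms: a slice through every
  point, maps of Z that preserve the orbits and act transitively on each of them (these make the
  projection open), and invariant functions that separate the orbits (these make the quotient a
  Hausdorff space).\<close>

locale smooth_quotient =
  fixes Z :: "'a::euclidean_space set" and pr :: "'a \<Rightarrow> 'p"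
  assumes slices: "x \<in> Z \<Longrightarrow> \<exists>V \<sigma> \<psi>. slice Z pr V \<sigma> \<psi> \<and> x \<in> \<sigma> ` V"
    and translate: "x \<in> Z \<Longrightarrow> y \<in> Z \<Longrightarrow> pr x = pr y \<Longrightarrow>
      \<exists>\<Phi>. continuous_on Z \<Phi> \<and> \<Phi> ` Z \<subseteq> Z \<and> (\<forall>z\<in>Z. pr (\<Phi> z) = pr z) \<and> \<Phi> x = y"
    and separate: "x \<in> Z \<Longrightarrow> y \<in> Z \<Longrightarrow> pr x \<noteq> pr y \<Longrightarrow>
      \<exists>h :: 'a \<Rightarrow> complex. continuous_on Z h \<and> (\<forall>z\<in>Z. \<forall>z'\<in>Z. pr z = pr z' \<longrightarrow> h z = h z') \<and> h x \<noteq> h y"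
begin

abbreviation X :: "'p topology" where "X \<equiv> quotient_topology Z pr"
abbreviation A :: "('p, real^4) chart set" where "A \<equiv> quotient_atlas Z pr"

definition rep :: "'p \<Rightarrow> 'a" where "rep q = (SOME x. x \<in> Z \<and> pr x = q)"

lemma rep: "q \<in> pr ` Z \<Longrightarrow> rep q \<in> Z" "q \<in> pr ` Z \<Longrightarrow> pr (rep q) = q"
proof -
  assume "q \<in> pr ` Z"
  then have "\<exists>x. x \<in> Z \<and> pr x = q" by blast
  from someI_ex[OF this] show "rep q \<in> Z" "pr (rep q) = q" unfolding rep_def by simp_all
qed

lemma topspace_X: "topspace X = pr ` Z"
proof
  show "topspace X \<subseteq> pr ` Z"
    using openin_quotient_topology[of Z pr "topspace X"] by simp
  have "{x \<in> Z. pr x \<in> pr ` Z} = Z" by blast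
  then have "openin X (pr ` Z)" unfolding openin_quotient_topology by simp
  then show "pr ` Z \<subseteq> topspace X" by (rule openin_subset)
qed

lemma continuous_map_pr: "continuous_map (top_of_set Z) X pr"
  unfolding continuous_map_def by (auto simp: topspace_X openin_quotient_topology)

lemma continuous_map_from_quotient:
  assumes "continuous_map (top_of_set Z) Y (\<lambda>x. f (pr x))"
  shows "continuous_map X Y f"
  unfolding continuous_map_def
proof (intro conjI allI impI)
  show "f \<in> topspace X \<rightarrow> topspace Y"
    using assms unfolding continuous_map_def by (auto simp: topspace_X)
  fix U assume "openin Y U"
  then have "openin (top_of_set Z) {x \<in> topspace (top_of_set Z). f (pr x) \<in> U}"
    using assms unfolding continuous_map_def by blast
  moreover have "{x \<in> Z. pr x \<in> {q \<in> topspace X. f q \<in> U}} = {x \<in> Z. f (pr x) \<in> U}"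
    by (auto simp: topspace_X)
  ultimately show "openin X {q \<in> topspace X. f q \<in> U}"
    unfolding openin_quotient_topology by (simp add: topspace_X)
qed

text \<open>The saturation of an open set is open, because it contains the preimages of this set under the
  maps that move a given point within its orbit.\<close>

lemma open_map_pr: "open_map (top_of_set Z) X pr"
  unfolding open_map_def
proof (intro allI impI)
  fix W assume W: "openin (top_of_set Z) W"
  then have WZ: "W \<subseteq> Z" by (rule openin_imp_subset)
  have "openin (top_of_set Z) {x \<in> Z. pr x \<in> pr ` W}"
  proof (subst openin_subopen, rule ballI)
    fix y assume "y \<in> {x \<in> Z. pr x \<in> pr ` W}"
    then obtain x where x: "y \<in> Z" "x \<in> W" "pr y = pr x" by blast
    then obtain \<Phi> where \<Phi>: "continuous_on Z \<Phi>" "\<Phi> ` Z \<subseteq> Z" "\<forall>z\<in>Z. pr (\<Phi> z) = pr z" "\<Phi> y = x"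
      using translate[of y x] WZ by blast
    have "openin (top_of_set Z) (Z \<inter> \<Phi> -` W)"
      by (rule continuous_openin_preimage[OF \<Phi>(1) _ W]) (use \<Phi>(2) in auto)
    moreover have "y \<in> Z \<inter> \<Phi> -` W" using x \<Phi>(4) by simp
    moreover have "Z \<inter> \<Phi> -` W \<subseteq> {x \<in> Z. pr x \<in> pr ` W}"
    proof
      fix z assume z: "z \<in> Z \<inter> \<Phi> -` W"
      then have "pr z = pr (\<Phi> z)" using \<Phi>(3) by simp
      then show "z \<in> {x \<in> Z. pr x \<in> pr ` W}" using z by blast
    qed
    ultimately show "\<exists>T. openin (top_of_set Z) T \<and> y \<in> T \<and> T \<subseteq> {x \<in> Z. pr x \<in> pr ` W}"
      by blast
  qed
  then show "openin X (pr ` W)" unfolding openin_quotient_topology using WZ by blast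
qed

lemma second_countable_X: "second_countable X"
  by (rule second_countable_open_map_image[OF continuous_map_pr open_map_pr _ second_countable_top_of_set])
    (simp add: topspace_X)

lemma Hausdorff_X: "Hausdorff_space X"
  unfolding Hausdorff_space_def
proof (intro allI impI, elim conjE)
  fix q r assume qr: "q \<in> topspace X" "r \<in> topspace X" "q \<noteq> r"
  then have "q \<in> pr ` Z" "r \<in> pr ` Z" by (simp_all add: topspace_X)
  then obtain x y where x: "x \<in> Z" "pr x = q" and y: "y \<in> Z" "pr y = r" by blast
  then obtain h :: "'a \<Rightarrow> complex" where h: "continuous_on Z h"
    "\<forall>z\<in>Z. \<forall>z'\<in>Z. pr z = pr z' \<longrightarrow> h z = h z'" "h x \<noteq> h y"
    using separate[of x y] qr(3) by blast
  have hr: "h (rep (pr z)) = h z" if "z \<in> Z" for z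
    using h(2) rep[of "pr z"] that by blast
  have "continuous_map (top_of_set Z) euclidean h" using h(1) by simp
  then have c: "continuous_map X euclidean (\<lambda>q. h (rep q))"
    by (intro continuous_map_from_quotient) (simp add: hr cong: continuous_on_cong)
  obtain U V where UV: "open U" "open V" "h x \<in> U" "h y \<in> V" "U \<inter> V = {}"
    using hausdorff[OF h(3)] by blast
  have "openin X {q \<in> topspace X. h (rep q) \<in> U}" "openin X {q \<in> topspace X. h (rep q) \<in> V}"
    using c UV(1,2) unfolding continuous_map_def by simp_all
  moreover have "q \<in> {q \<in> topspace X. h (rep q) \<in> U}" "r \<in> {q \<in> topspace X. h (rep q) \<in> V}"
    using qr UV hr x y by auto
  moreover have "disjnt {q \<in> topspace X. h (rep q) \<in> U} {q \<in> topspace X. h (rep q) \<in> V}"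
    using UV(5) by (auto simp: disjnt_def)
  ultimately show "\<exists>U V. openin X U \<and> openin X V \<and> q \<in> U \<and> r \<in> V \<and> disjnt U V" by blast
qed

lemma atlasD:
  assumes "c \<in> A"
  shows "openin X (fst c)" "open (snd c ` fst c)" "inj_on (snd c) (fst c)"
    "fst c \<subseteq> pr ` Z" "openin (top_of_set Z) {x \<in> Z. pr x \<in> fst c}"
    "smooth_on {x \<in> Z. pr x \<in> fst c} (\<lambda>x. snd c (pr x))"
    "\<And>x. x \<in> Z \<Longrightarrow> pr x \<in> fst c \<Longrightarrow>
       frechet_derivative (snd c \<circ> pr) (at x within Z) ` tangent_space Z x = UNIV"
    "continuous_map (subtopology X (fst c)) (top_of_set (snd c ` fst c)) (snd c)"
proof -
  have c: "topological_chart X c" "smooth_submersion_on Z {x \<in> Z. pr x \<in> fst c} (snd c \<circ> pr)"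
    using assms unfolding quotient_atlas_def by simp_all
  then have tc: "openin X (fst c)" "open (snd c ` fst c)"
    "homeomorphic_map (subtopology X (fst c)) (top_of_set (snd c ` fst c)) (snd c)"
    unfolding topological_chart_def by (auto simp: case_prod_beta)
  show "openin X (fst c)" "open (snd c ` fst c)" by (rule tc)+
  have ts: "topspace (subtopology X (fst c)) = fst c"
    using openin_subset[OF tc(1)] by auto
  show "inj_on (snd c) (fst c)"
    using homeomorphic_imp_injective_map[OF tc(3)] unfolding ts .
  show "continuous_map (subtopology X (fst c)) (top_of_set (snd c ` fst c)) (snd c)"
    by (rule homeomorphic_imp_continuous_map[OF tc(3)])
  show "fst c \<subseteq> pr ` Z" "openin (top_of_set Z) {x \<in> Z. pr x \<in> fst c}"
    using tc(1) unfolding openin_quotient_topology by simp_all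
  show "smooth_on {x \<in> Z. pr x \<in> fst c} (\<lambda>x. snd c (pr x))"
    using c(2) unfolding smooth_submersion_on_def comp_def by simp
  show "frechet_derivative (snd c \<circ> pr) (at x within Z) ` tangent_space Z x = UNIV"
    if "x \<in> Z" "pr x \<in> fst c" for x
    using c(2) that unfolding smooth_submersion_on_def by simp
qed

lemma atlas_has_derivative:
  assumes "c \<in> A" "x \<in> Z" "pr x \<in> fst c"
  shows "((snd c \<circ> pr) has_derivative frechet_derivative (snd c \<circ> pr) (at x within Z)) (at x within Z)"
proof -
  have "smooth_on {x \<in> Z. pr x \<in> fst c} (snd c \<circ> pr)"
    using atlasD(6)[OF assms(1)] by (simp add: comp_def)
  then show ?thesis
    by (rule smooth_on_openin_has_derivative[OF _ atlasD(5)[OF assms(1)]]) (use assms in simp)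
qed

text \<open>A slice through x turns the chart map into a map between open sets of the same dimension, whose
  derivative is onto because the chart map is a submersion and tangent vectors at x project to
  the slice. Its smooth inverse followed by the slice is a section.\<close>

lemma local_section:
  assumes c: "c \<in> A" and x: "x \<in> Z" "pr x \<in> fst c"
  obtains N s where "open N" "snd c (pr x) \<in> N" "N \<subseteq> snd c ` fst c" "smooth_on N s"
    "s (snd c (pr x)) = x" "\<And>u. u \<in> N \<Longrightarrow> s u \<in> Z" "\<And>u. u \<in> N \<Longrightarrow> pr (s u) \<in> fst c"
    "\<And>u. u \<in> N \<Longrightarrow> snd c (pr (s u)) = u"
proof -
  obtain V \<sigma> \<psi> where sl: "slice Z pr V \<sigma> \<psi>" and "x \<in> \<sigma> ` V" using slices[OF x(1)] by blast
  then obtain u0 where u0: "u0 \<in> V" "x = \<sigma> u0" by blast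
  note V = sliceD[OF sl]
  let ?W = "{x \<in> Z. pr x \<in> fst c}" and ?W' = "{x \<in> Z. pr x \<in> pr ` \<sigma> ` V}"
  obtain T where T: "open T" "?W = Z \<inter> T" using atlasD(5)[OF c] by (auto simp: openin_open)
  define V1 where "V1 = V \<inter> \<sigma> -` T"
  have V1: "open V1" unfolding V1_def
    by (rule continuous_open_preimage[OF smooth_on_imp_continuous_on[OF V(2)] V(1) T(1)])
  have V1_iff: "u \<in> V1 \<longleftrightarrow> u \<in> V \<and> pr (\<sigma> u) \<in> fst c" for u
  proof -
    have "\<sigma> u \<in> T \<longleftrightarrow> pr (\<sigma> u) \<in> fst c" if "u \<in> V"
      using V(3)[OF that] T(2) by blast
    then show ?thesis unfolding V1_def by blast
  qed
  have u0V1: "u0 \<in> V1" using u0 x V1_iff by simp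
  define \<kappa> where "\<kappa> u = snd c (pr (\<sigma> u))" for u
  define g where "g y = \<psi> (rep (inv_into (fst c) (snd c) y))" for y
  have sm: "smooth_on V1 \<kappa>" unfolding \<kappa>_def
  proof (rule smooth_on_compose[OF _ atlasD(6)[OF c]])
    show "smooth_on V1 \<sigma>" by (rule smooth_on_subset[OF V(2)]) (simp add: V1_def)
    show "\<sigma> ` V1 \<subseteq> ?W" using V1_iff V(3) by auto
  qed
  have g\<kappa>: "g (\<kappa> u) = u" if "u \<in> V1" for u
  proof -
    have u: "u \<in> V" "pr (\<sigma> u) \<in> fst c" using that V1_iff by simp_all
    have "inv_into (fst c) (snd c) (\<kappa> u) = pr (\<sigma> u)"
      unfolding \<kappa>_def by (rule inv_into_f_f[OF atlasD(3)[OF c] u(2)])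
    moreover have "\<psi> (rep (pr (\<sigma> u))) = \<psi> (\<sigma> u)"
      using rep[of "pr (\<sigma> u)"] V(3)[OF u(1)] u(1) by (intro V(7)) auto
    ultimately show ?thesis unfolding g_def using V(4)[OF u(1)] by simp
  qed
  have surj: "surj (frechet_derivative \<kappa> (at u))" if uV1: "u \<in> V1" for u
  proof -
    have "\<exists>b. frechet_derivative \<kappa> (at u) b = a" for a
    proof -
    have u: "u \<in> V" "pr (\<sigma> u) \<in> fst c" using uV1 V1_iff by simp_all
    have "a \<in> frechet_derivative (snd c \<circ> pr) (at (\<sigma> u) within Z) ` tangent_space Z (\<sigma> u)"
      using atlasD(7)[OF c V(3)[OF u(1)] u(2)] by simp
    then obtain v where v: "v \<in> tangent_space Z (\<sigma> u)"
      "a = frechet_derivative (snd c \<circ> pr) (at (\<sigma> u) within Z) v" by blast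
    from v(1) obtain \<gamma> e where \<gamma>: "e > 0" "smooth_on {-e<..<e} \<gamma>" "\<gamma> ` {-e<..<e} \<subseteq> Z" "\<gamma> 0 = \<sigma> u"
      "(\<gamma> has_vector_derivative v) (at 0)" by (rule tangent_spaceE)
    have a: "((\<lambda>t. (snd c \<circ> pr) (\<gamma> t)) has_vector_derivative a) (at 0)"
      unfolding v(2)
      by (rule has_vector_derivative_along_curve[OF atlas_has_derivative[OF c V(3)[OF u(1)] u(2)] \<gamma>(5,4,1,3)])
    have inW': "\<sigma> u \<in> ?W'" using u(1) V(3) by blast
    have "((\<lambda>t. \<psi> (\<gamma> t)) has_vector_derivative frechet_derivative \<psi> (at (\<sigma> u) within Z) v) (at 0)"
      (is "(_ has_vector_derivative ?b) _")
      by (rule has_vector_derivative_along_curve[OF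
            smooth_on_openin_has_derivative[OF V(6,5) inW'] \<gamma>(5,4,1,3)])
    moreover have "(\<kappa> has_derivative frechet_derivative \<kappa> (at u)) (at (\<psi> (\<gamma> 0)))"
      using smooth_on_open_has_derivative[OF sm uV1 V1] \<gamma>(4) V(4)[OF u(1)] by simp
    ultimately have b: "((\<lambda>t. \<kappa> (\<psi> (\<gamma> t))) has_vector_derivative frechet_derivative \<kappa> (at u) ?b) (at 0)"
      using vector_derivative_diff_chain_within[of "\<lambda>t. \<psi> (\<gamma> t)" ?b 0 UNIV \<kappa> "frechet_derivative \<kappa> (at u)"]
        has_derivative_at_withinI by (auto simp: o_def)
    have "eventually (\<lambda>t. \<gamma> t \<in> ?W') (at 0)"
      by (rule curve_eventually_in_openin[OF V(5) _ \<gamma>(5,1,3)]) (use inW' \<gamma>(4) in simp)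
    then have "eventually (\<lambda>t. (snd c \<circ> pr) (\<gamma> t) = \<kappa> (\<psi> (\<gamma> t))) (at 0)"
    proof eventually_elim
      case (elim t)
      then show ?case using slice_coordinates(2)[OF sl, of "\<gamma> t"] by (simp add: \<kappa>_def)
    qed
    moreover have "(snd c \<circ> pr) (\<gamma> 0) = \<kappa> (\<psi> (\<gamma> 0))"
      using \<gamma>(4) V(4)[OF u(1)] by (simp add: \<kappa>_def)
    ultimately have "((\<lambda>t. \<kappa> (\<psi> (\<gamma> t))) has_vector_derivative a) (at 0)"
      using has_derivative_transform_eventually[OF a[unfolded has_vector_derivative_def]]
      by (simp add: has_vector_derivative_def)
    from vector_derivative_unique_at[OF this b] show ?thesis by blast
    qed
    then show ?thesis by (metis surjI surj_def)
  qed
  note inv = smooth_inverse[OF V1 sm g\<kappa> surj]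
  define s where "s y = \<sigma> (g y)" for y
  have s: "s (\<kappa> u) = \<sigma> u" if "u \<in> V1" for u using g\<kappa>[OF that] by (simp add: s_def)
  show thesis
  proof (rule that[of "\<kappa> ` V1" s])
    show "open (\<kappa> ` V1)" by (rule inv(1))
    show "snd c (pr x) \<in> \<kappa> ` V1" using u0V1 u0(2) unfolding \<kappa>_def by blast
    show "\<kappa> ` V1 \<subseteq> snd c ` fst c" using V1_iff unfolding \<kappa>_def by blast
    show "smooth_on (\<kappa> ` V1) s" unfolding s_def
      by (rule smooth_on_compose[OF inv(2) V(2)]) (use g\<kappa> V1_iff in auto)
    show "s (snd c (pr x)) = x" using s[OF u0V1] u0(2) unfolding \<kappa>_def by simp
    fix y assume "y \<in> \<kappa> ` V1"
    then obtain u where u: "u \<in> V1" "y = \<kappa> u" by blast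
    then show "s y \<in> Z" "pr (s y) \<in> fst c" "snd c (pr (s y)) = y"
      using s[OF u(1)] V1_iff V(3) by (auto simp: \<kappa>_def)
  qed
qed

text \<open>The chart given by a slice is a submersion: along the curve in the slice with prescribed coordinate
  velocity the chart moves with this velocity.\<close>

lemma slice_chart_in_atlas:
  assumes sl: "slice Z pr V \<sigma> \<psi>"
  shows "(pr ` \<sigma> ` V, \<lambda>q. \<psi> (rep q)) \<in> A"
proof -
  note V = sliceD[OF sl]
  let ?U = "pr ` \<sigma> ` V" and ?\<phi> = "\<lambda>q. \<psi> (rep q)" and ?W = "{x \<in> Z. pr x \<in> pr ` \<sigma> ` V}"
  have UZ: "?U \<subseteq> pr ` Z" using V(3) by blast
  have \<phi>: "?\<phi> (pr x) = \<psi> x" if "x \<in> Z" "pr x \<in> ?U" for x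
    using rep[of "pr x"] that by (intro V(7)) auto
  have \<phi>\<sigma>: "?\<phi> (pr (\<sigma> u)) = u" if "u \<in> V" for u
  proof -
    have "pr (\<sigma> u) \<in> ?U" using that by blast
    then show ?thesis using \<phi>[OF V(3)[OF that]] V(4)[OF that] by simp
  qed
  have img: "?\<phi> ` ?U = V"
    by (auto simp: \<phi>\<sigma> image_image)
  have opU: "openin X ?U" unfolding openin_quotient_topology using UZ V(5) by blast
  have tsU: "topspace (subtopology X ?U) = ?U" using openin_subset[OF opU] by auto
  have "homeomorphic_maps (subtopology X ?U) (top_of_set V) ?\<phi> (\<lambda>u. pr (\<sigma> u))"
    unfolding homeomorphic_maps_def
  proof (intro conjI ballI)
    show "continuous_map (subtopology X ?U) (top_of_set V) ?\<phi>"
      unfolding continuous_map_def tsU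
    proof (intro conjI allI impI)
      show "?\<phi> \<in> ?U \<rightarrow> topspace (top_of_set V)" using img by auto
      fix O' assume "openin (top_of_set V) O'"
      then have O': "open O'" "O' \<subseteq> V" using V(1) by (auto simp: openin_open_eq)
      have eq: "{x \<in> Z. pr x \<in> {q \<in> ?U. ?\<phi> q \<in> O'}} = ?W \<inter> \<psi> -` O'"
      proof -
        have "pr x \<in> ?U \<and> ?\<phi> (pr x) \<in> O' \<longleftrightarrow> pr x \<in> ?U \<and> \<psi> x \<in> O'" if "x \<in> Z" for x
          using \<phi>[OF that] by (cases "pr x \<in> ?U") simp_all
        then show ?thesis by blast
      qed
      have "openin (top_of_set ?W) (?W \<inter> \<psi> -` O')"
        by (rule continuous_openin_preimage_gen[OF smooth_on_imp_continuous_on[OF V(6)] O'(1)])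
      then have "openin (top_of_set Z) (?W \<inter> \<psi> -` O')"
        using V(5) by (rule openin_trans)
      then have "openin X {q \<in> ?U. ?\<phi> q \<in> O'}"
        unfolding openin_quotient_topology eq using UZ by blast
      then show "openin (subtopology X ?U) {q \<in> ?U. ?\<phi> q \<in> O'}"
        by (subst openin_open_subtopology[OF opU]) blast
    qed
    have "continuous_map (top_of_set V) (top_of_set Z) \<sigma>"
      using smooth_on_imp_continuous_on[OF V(2)] V(3) by auto
    from continuous_map_compose[OF this continuous_map_pr]
    show "continuous_map (top_of_set V) (subtopology X ?U) (\<lambda>u. pr (\<sigma> u))"
      by (simp add: continuous_map_in_subtopology o_def image_subset_iff_funcset[symmetric] image_image)
  next
    fix q assume "q \<in> topspace (subtopology X ?U)"
    then obtain u where "u \<in> V" "q = pr (\<sigma> u)" unfolding tsU by blast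
    then show "pr (\<sigma> (?\<phi> q)) = q" using \<phi>\<sigma> by simp
  next
    fix u assume "u \<in> topspace (top_of_set V)"
    then show "?\<phi> (pr (\<sigma> u)) = u" using \<phi>\<sigma> by simp
  qed
  then have "homeomorphic_map (subtopology X ?U) (top_of_set V) ?\<phi>"
    using homeomorphic_map_maps by blast
  then have tc: "topological_chart X (?U, ?\<phi>)"
    unfolding topological_chart_def prod.case img using opU V(1) by blast
  have sm: "smooth_on ?W (?\<phi> \<circ> pr)"
    by (rule smooth_on_cong[OF V(6)]) (simp add: \<phi>)
  have "\<exists>v\<in>tangent_space Z x. frechet_derivative (?\<phi> \<circ> pr) (at x within Z) v = a" if x: "x \<in> ?W" for x a
  proof -
    from x have xZ: "x \<in> Z" and xU: "pr x \<in> ?U" by simp_all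
    \<comment> \<open>The slice need not pass through x; a curve along it is moved into a slice that does.\<close>
    obtain V' \<sigma>' \<psi>' where sl': "slice Z pr V' \<sigma>' \<psi>'" and "x \<in> \<sigma>' ` V'" using slices[OF xZ] by blast
    then obtain u' where u': "u' \<in> V'" "x = \<sigma>' u'" by blast
    note V' = sliceD[OF sl']
    let ?W' = "{x \<in> Z. pr x \<in> pr ` \<sigma>' ` V'}"
    have \<psi>x: "\<psi> x \<in> V" "pr (\<sigma> (\<psi> x)) = pr x" by (rule slice_coordinates[OF sl xZ xU])+
    obtain T where T: "open T" "?W' = Z \<inter> T" using V'(5) by (auto simp: openin_open)
    define V1 where "V1 = V \<inter> \<sigma> -` T"
    have V1: "open V1" unfolding V1_def
      by (rule continuous_open_preimage[OF smooth_on_imp_continuous_on[OF V(2)] V(1) T(1)])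
    have V1W: "\<sigma> u \<in> ?W'" if "u \<in> V1" for u
      using that V(3)[of u] T(2) unfolding V1_def by blast
    have xW': "pr x \<in> pr ` \<sigma>' ` V'" using u' by blast
    then have "\<sigma> (\<psi> x) \<in> ?W'" using V(3)[OF \<psi>x(1)] \<psi>x(2) by simp
    then have \<psi>xV1: "\<psi> x \<in> V1" unfolding V1_def using T(2) \<psi>x(1) by blast
    let ?F = "\<lambda>u. \<sigma>' (\<psi>' (\<sigma> u))"
    have smF: "smooth_on V1 ?F"
    proof (rule smooth_on_compose[OF smooth_on_compose[OF _ V'(6)] V'(2)])
      show "smooth_on V1 \<sigma>" by (rule smooth_on_subset[OF V(2)]) (simp add: V1_def)
      show "\<sigma> ` V1 \<subseteq> ?W'" using V1W by blast
      show "(\<lambda>u. \<psi>' (\<sigma> u)) ` V1 \<subseteq> V'" using V1W slice_coordinates(1)[OF sl'] by auto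
    qed
    obtain e where e: "e > 0" "smooth_on {-e<..<e} (\<lambda>t. ?F (\<psi> x + t *\<^sub>R a))"
      "\<And>t. t \<in> {-e<..<e} \<Longrightarrow> \<psi> x + t *\<^sub>R a \<in> V1"
      "((\<lambda>t. ?F (\<psi> x + t *\<^sub>R a)) has_vector_derivative frechet_derivative ?F (at (\<psi> x)) a) (at 0)"
      by (rule smooth_along_line[OF V1 smF \<psi>xV1, of a]) blast
    define \<gamma> where "\<gamma> = (\<lambda>t. ?F (\<psi> x + t *\<^sub>R a))"
    have \<gamma>Z: "\<gamma> t \<in> Z" "pr (\<gamma> t) = pr (\<sigma> (\<psi> x + t *\<^sub>R a))" if "t \<in> {-e<..<e}" for t
      using V1W[OF e(3)[OF that]] slice_coordinates[OF sl', of "\<sigma> (\<psi> x + t *\<^sub>R a)"] V'(3)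
      by (auto simp: \<gamma>_def)
    have "\<psi>' (\<sigma> (\<psi> x)) = \<psi>' x"
      by (rule V'(7)[OF V(3)[OF \<psi>x(1)] xZ _ \<psi>x(2)]) (use \<psi>x(2) xW' in simp)
    then have \<gamma>0: "\<gamma> 0 = x" using u' V'(4) by (simp add: \<gamma>_def)
    have \<gamma>': "(\<gamma> has_vector_derivative frechet_derivative ?F (at (\<psi> x)) a) (at 0)"
      using e(4) unfolding \<gamma>_def .
    have \<gamma>img: "\<gamma> ` {-e<..<e} \<subseteq> Z" using \<gamma>Z by blast
    have tan: "frechet_derivative ?F (at (\<psi> x)) a \<in> tangent_space Z x"
      by (rule tangent_spaceI[OF e(1) e(2)[folded \<gamma>_def] \<gamma>img \<gamma>0 \<gamma>'])
    have "((\<lambda>t. (?\<phi> \<circ> pr) (\<gamma> t)) has_vector_derivative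
        frechet_derivative (?\<phi> \<circ> pr) (at x within Z) (frechet_derivative ?F (at (\<psi> x)) a)) (at 0)"
      by (rule has_vector_derivative_along_curve[OF smooth_on_openin_has_derivative[OF sm V(5) x] \<gamma>' \<gamma>0 e(1) \<gamma>img])
    moreover have "((\<lambda>t. (?\<phi> \<circ> pr) (\<gamma> t)) has_vector_derivative a) (at 0)"
    proof (rule has_vector_derivative_transform_within_open)
      show "((\<lambda>t. \<psi> x + t *\<^sub>R a) has_vector_derivative a) (at 0)"
        unfolding has_vector_derivative_def by (rule derivative_eq_intros refl | simp)+
      show "\<psi> x + t *\<^sub>R a = (?\<phi> \<circ> pr) (\<gamma> t)" if "t \<in> {-e<..<e}" for t
        using \<gamma>Z(2)[OF that] \<phi>\<sigma> e(3)[OF that] by (simp add: V1_def)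
    qed (use e(1) in auto)
    ultimately show ?thesis using tan vector_derivative_unique_at by blast
  qed
  then have "smooth_submersion_on Z ?W (?\<phi> \<circ> pr)"
    unfolding smooth_submersion_on_def using sm by (auto simp: image_iff) metis
  then show ?thesis unfolding quotient_atlas_def using tc by simp
qed

lemma chart_at:
  assumes "q \<in> pr ` Z" obtains c where "c \<in> A" "q \<in> fst c"
proof -
  from assms obtain x where x: "x \<in> Z" "q = pr x" by blast
  obtain V \<sigma> \<psi> where "slice Z pr V \<sigma> \<psi>" "x \<in> \<sigma> ` V" using slices[OF x(1)] by blast
  then show thesis using that[OF slice_chart_in_atlas] x(2) by auto
qed

end

text \<open>In charts c and d the induced map is the composition of a local section for c, the map \<open>\<Theta>\<close>,
  and the chart map of d. With the identity for \<open>\<Theta>\<close> this says that the transition maps are smooth.\<close>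

lemma smooth_map_induced:
  fixes pr :: "'a::euclidean_space \<Rightarrow> 'p" and pr' :: "'b::euclidean_space \<Rightarrow> 'q"
  assumes "smooth_quotient Z pr" "smooth_quotient Z' pr'"
    and \<Theta>: "smooth_on Z \<Theta>" "\<Theta> ` Z \<subseteq> Z'" and F: "\<And>x. x \<in> Z \<Longrightarrow> F (pr x) = pr' (\<Theta> x)"
  shows "smooth_map (quotient_topology Z pr) (quotient_atlas Z pr :: ('p, real^4) chart set)
    (quotient_topology Z' pr') (quotient_atlas Z' pr' :: ('q, real^4) chart set) F"
proof -
  interpret Q: smooth_quotient Z pr by fact
  interpret Q': smooth_quotient Z' pr' by fact
  have \<Theta>c: "continuous_map (top_of_set Z) (top_of_set Z') \<Theta>"
    using smooth_on_imp_continuous_on[OF \<Theta>(1)] \<Theta>(2) by auto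
  have "continuous_map (top_of_set Z) Q'.X (\<lambda>x. pr' (\<Theta> x))"
    using continuous_map_compose[OF \<Theta>c Q'.continuous_map_pr] by (simp add: o_def)
  then have "continuous_map (top_of_set Z) Q'.X (\<lambda>x. F (pr x))"
    by (rule continuous_map_eq) (simp add: F)
  then have cont: "continuous_map Q.X Q'.X F" by (rule Q.continuous_map_from_quotient)
  have "smooth_on (chart_rep_dom c d F) (chart_rep c d F)" if c: "c \<in> Q.A" and d: "d \<in> Q'.A" for c d
  proof (rule smooth_on_local)
    fix u assume "u \<in> chart_rep_dom c d F"
    then obtain q where q: "q \<in> fst c" "F q \<in> fst d" "u = snd c q"
      unfolding chart_rep_dom_def by blast
    obtain x where x: "x \<in> Z" "pr x = q" using q(1) Q.atlasD(4)[OF c] by blast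
    with q have xc: "pr x \<in> fst c" by simp
    obtain N s where N: "open N" "snd c (pr x) \<in> N" "N \<subseteq> snd c ` fst c" "smooth_on N s"
      "s (snd c (pr x)) = x" "\<And>u. u \<in> N \<Longrightarrow> s u \<in> Z" "\<And>u. u \<in> N \<Longrightarrow> pr (s u) \<in> fst c"
      "\<And>u. u \<in> N \<Longrightarrow> snd c (pr (s u)) = u"
      by (rule Q.local_section[OF c x(1) xc]) blast
    let ?D = "chart_rep_dom c d F \<inter> N"
    have inv: "inv_into (fst c) (snd c) w = pr (s w)" if "w \<in> N" for w
      by (metis inv_into_f_f[OF Q.atlasD(3)[OF c] N(7)[OF that]] N(8)[OF that])
    have dom: "pr' (\<Theta> (s w)) \<in> fst d" if "w \<in> ?D" for w
    proof -
      from that obtain r where r: "r \<in> fst c" "F r \<in> fst d" "w = snd c r"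
        unfolding chart_rep_dom_def by blast
      have "snd c r = snd c (pr (s w))" using N(8) that r(3) by simp
      then have "r = pr (s w)" using inj_onD[OF Q.atlasD(3)[OF c]] r(1) N(7) that by blast
      then show ?thesis using r(2) F N(6) that by simp
    qed
    have "smooth_on ?D (\<lambda>w. snd d (pr' (\<Theta> (s w))))"
    proof (rule smooth_on_compose[OF smooth_on_compose[OF _ \<Theta>(1)] Q'.atlasD(6)[OF d]])
      show "smooth_on ?D s" by (rule smooth_on_subset[OF N(4)]) simp
      show "s ` ?D \<subseteq> Z" using N(6) by blast
      show "(\<lambda>w. \<Theta> (s w)) ` ?D \<subseteq> {x \<in> Z'. pr' x \<in> fst d}" using dom N(6) \<Theta>(2) by blast
    qed
    then have "smooth_on ?D (chart_rep c d F)"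
      by (rule smooth_on_cong) (simp add: chart_rep_def inv F N(6))
    moreover have "u \<in> N" using N(2) q(3) x(2) by simp
    ultimately show "\<exists>U. open U \<and> u \<in> U \<and> smooth_on (chart_rep_dom c d F \<inter> U) (chart_rep c d F)"
      using N(1) by blast
  qed
  with cont show ?thesis unfolding smooth_map_def by blast
qed

lemma (in smooth_quotient) smooth_manifold_quotient: "smooth_manifold X A"
  unfolding smooth_manifold_def
proof (intro conjI ballI)
  show "Hausdorff_space X" "second_countable X" by (rule Hausdorff_X second_countable_X)+
  show "topological_chart X c" if "c \<in> A" for c using that unfolding quotient_atlas_def by simp
  show "(\<Union>c\<in>A. fst c) = topspace X"
    unfolding topspace_X
  proof (intro equalityI subsetI)
    fix q assume "q \<in> pr ` Z"
    then obtain c where "c \<in> A" "q \<in> fst c" by (rule chart_at)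
    then show "q \<in> (\<Union>c\<in>A. fst c)" by blast
  qed (use atlasD(4) in blast)
  have "smooth_quotient Z pr" by unfold_locales
  from smooth_map_induced[OF this this smooth_on_ident, of id]
  show "smooth_on (chart_rep_dom c d id) (chart_rep c d id)" if "c \<in> A" "d \<in> A" for c d
    using that unfolding smooth_map_def by simp
qed

lemma diffeomorphism_induced:
  fixes pr :: "'a::euclidean_space \<Rightarrow> 'p" and pr' :: "'b::euclidean_space \<Rightarrow> 'q"
  assumes "smooth_quotient Z pr" "smooth_quotient Z' pr'"
    and \<Theta>: "smooth_on Z \<Theta>" "\<Theta> ` Z \<subseteq> Z'" and F: "\<And>x. x \<in> Z \<Longrightarrow> F (pr x) = pr' (\<Theta> x)"
    and \<Theta>': "smooth_on Z' \<Theta>'" "\<Theta>' ` Z' \<subseteq> Z" and F': "\<And>y. y \<in> Z' \<Longrightarrow> F' (pr' y) = pr (\<Theta>' y)"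
    and inv: "\<And>x. x \<in> Z \<Longrightarrow> \<Theta>' (\<Theta> x) = x" "\<And>y. y \<in> Z' \<Longrightarrow> \<Theta> (\<Theta>' y) = y"
  shows "diffeomorphism (quotient_topology Z pr) (quotient_atlas Z pr :: ('p, real^4) chart set)
    (quotient_topology Z' pr') (quotient_atlas Z' pr' :: ('q, real^4) chart set) F"
proof -
  have s: "smooth_map (quotient_topology Z pr) (quotient_atlas Z pr :: ('p, real^4) chart set)
    (quotient_topology Z' pr') (quotient_atlas Z' pr' :: ('q, real^4) chart set) F"
    by (rule smooth_map_induced[OF assms(1,2) \<Theta>]) (rule F)
  have s': "smooth_map (quotient_topology Z' pr') (quotient_atlas Z' pr' :: ('q, real^4) chart set)
    (quotient_topology Z pr) (quotient_atlas Z pr :: ('p, real^4) chart set) F'"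
    by (rule smooth_map_induced[OF assms(2,1) \<Theta>']) (rule F')
  have "F' (F q) = q" if "q \<in> pr ` Z" for q
    using that F F' inv(1) \<Theta>(2) by auto
  moreover have "F (F' q) = q" if "q \<in> pr' ` Z'" for q
    using that F F' inv(2) \<Theta>'(2) by auto
  ultimately have "homeomorphic_maps (quotient_topology Z pr) (quotient_topology Z' pr') F F'"
    using s s' unfolding homeomorphic_maps_def smooth_map_def
      smooth_quotient.topspace_X[OF assms(1)] smooth_quotient.topspace_X[OF assms(2)] by blast
  with s s' show ?thesis unfolding diffeomorphism_def by blast
qed

text \<open>Thanks to this lemma slices have to be constructed only in the model in which they are simple.\<close>

lemma slice_transfer:
  assumes sl: "slice Z' pr' V \<sigma> \<psi>"
    and \<Theta>: "smooth_on Z \<Theta>" "\<Theta> ` Z \<subseteq> Z'" and \<Theta>': "smooth_on Z' \<Theta>'" "\<Theta>' ` Z' \<subseteq> Z"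
    and inv: "\<And>y. y \<in> Z' \<Longrightarrow> \<Theta> (\<Theta>' y) = y"
    and orb: "\<And>x y. x \<in> Z \<Longrightarrow> y \<in> Z \<Longrightarrow> pr x = pr y \<longleftrightarrow> pr' (\<Theta> x) = pr' (\<Theta> y)"
  shows "slice Z pr V (\<lambda>u. \<Theta>' (\<sigma> u)) (\<lambda>x. \<psi> (\<Theta> x))"
proof -
  note V = sliceD[OF sl]
  let ?W = "{x \<in> Z. pr x \<in> pr ` (\<lambda>u. \<Theta>' (\<sigma> u)) ` V}" and ?W' = "{x \<in> Z'. pr' x \<in> pr' ` \<sigma> ` V}"
  have iff: "pr x \<in> pr ` (\<lambda>u. \<Theta>' (\<sigma> u)) ` V \<longleftrightarrow> pr' (\<Theta> x) \<in> pr' ` \<sigma> ` V" if "x \<in> Z" for x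
  proof -
    have "pr x = pr (\<Theta>' (\<sigma> u)) \<longleftrightarrow> pr' (\<Theta> x) = pr' (\<sigma> u)" if "u \<in> V" for u
      using orb[OF \<open>x \<in> Z\<close>, of "\<Theta>' (\<sigma> u)"] V(3)[OF that] \<Theta>'(2) inv by auto
    then show ?thesis by (auto simp: image_iff)
  qed
  have W: "?W = Z \<inter> \<Theta> -` ?W'" using iff \<Theta>(2) by auto
  show ?thesis
    unfolding slice_def
  proof (intro conjI ballI impI)
    show "open V" by (rule V)
    show "smooth_on V (\<lambda>u. \<Theta>' (\<sigma> u))"
      by (rule smooth_on_compose[OF V(2) \<Theta>'(1)]) (use V(3) in blast)
    show "(\<lambda>u. \<Theta>' (\<sigma> u)) ` V \<subseteq> Z" using V(3) \<Theta>'(2) by blast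
    show "\<psi> (\<Theta> (\<Theta>' (\<sigma> u))) = u" if "u \<in> V" for u using V(3,4)[OF that] inv by simp
    show "openin (top_of_set Z) ?W" unfolding W
      by (rule continuous_openin_preimage[OF smooth_on_imp_continuous_on[OF \<Theta>(1)] _ V(5)])
        (use \<Theta>(2) in auto)
    show "smooth_on ?W (\<lambda>x. \<psi> (\<Theta> x))"
      by (rule smooth_on_compose[OF smooth_on_subset[OF \<Theta>(1)] V(6)]) (use W in auto)
    fix x y assume xy: "x \<in> Z" "y \<in> Z" "pr x \<in> pr ` (\<lambda>u. \<Theta>' (\<sigma> u)) ` V" "pr x = pr y"
    show "\<psi> (\<Theta> x) = \<psi> (\<Theta> y)"
      by (rule V(7)) (use xy iff orb[OF xy(1,2)] \<Theta>(2) in auto)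
  qed
qed

section \<open>Quotient metrics\<close>

lemma open_chart_image:
  assumes "topological_chart X c" "openin X O'"
  shows "open (snd c ` (fst c \<inter> O'))"
proof -
  have c: "openin X (fst c)" "open (snd c ` fst c)"
    "homeomorphic_map (subtopology X (fst c)) (top_of_set (snd c ` fst c)) (snd c)"
    using assms(1) unfolding topological_chart_def by (auto simp: case_prod_beta)
  have "openin (subtopology X (fst c)) (fst c \<inter> O')"
    using assms(2) by (simp add: openin_subtopology_Int2)
  then have "openin (top_of_set (snd c ` fst c)) (snd c ` (fst c \<inter> O'))"
    using homeomorphic_imp_open_map[OF c(3)] unfolding open_map_def by blast
  then show ?thesis using c(2) by (simp add: openin_open_eq)
qed

lemma open_chart_rep_dom:
  assumes "topological_chart X c" "continuous_map X Y F" "openin Y (fst d)" "fst c \<subseteq> topspace X"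
  shows "open (chart_rep_dom c d F)"
proof -
  have "openin X {q \<in> topspace X. F q \<in> fst d}"
    using assms(2,3) unfolding continuous_map_def by blast
  moreover have "{q \<in> fst c. F q \<in> fst d} = fst c \<inter> {q \<in> topspace X. F q \<in> fst d}"
    using assms(4) by blast
  ultimately show ?thesis
    unfolding chart_rep_dom_def using open_chart_image[OF assms(1)] by metis
qed

lemma (in smooth_quotient) chart_rep_has_derivative:
  assumes "smooth_map X A X A F" "c \<in> A" "d \<in> A" "q \<in> fst c" "F q \<in> fst d"
  shows "(chart_rep c d F has_derivative chart_deriv c d F q) (at (snd c q))"
proof -
  have F: "continuous_map X X F" "smooth_on (chart_rep_dom c d F) (chart_rep c d F)"
    using assms(1-3) unfolding smooth_map_def by simp_all
  have "topological_chart X c" using assms(2) unfolding quotient_atlas_def by simp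
  then have "open (chart_rep_dom c d F)"
    by (rule open_chart_rep_dom[OF _ F(1) atlasD(1)[OF assms(3)]])
      (use atlasD(4)[OF assms(2)] in \<open>simp add: topspace_X\<close>)
  moreover have "snd c q \<in> chart_rep_dom c d F" unfolding chart_rep_dom_def using assms(4,5) by blast
  ultimately show ?thesis unfolding chart_deriv_def
    by (intro smooth_on_open_has_derivative[OF F(2)])
qed

text \<open>The field \<open>\<xi>\<close> is tangent to the orbits. Any two points of an orbit are related by a linear map
  that preserves Z, the orbits and g. As the dimension of Z exceeds that of the charts by one, \<open>\<xi>\<close>
  spans the vertical directions.\<close>

locale riemannian_quotient = smooth_quotient Z pr
  for Z :: "'a::euclidean_space set" and pr :: "'a \<Rightarrow> 'p" +
  fixes g :: "'a \<Rightarrow> 'a \<Rightarrow> 'a \<Rightarrow> real" and \<xi> :: "'a \<Rightarrow> 'a"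
  assumes submanifold: "smooth_submanifold 5 Z"
    and g_bilinear: "x \<in> Z \<Longrightarrow> bilinear (g x)"
    and g_sym: "x \<in> Z \<Longrightarrow> g x v w = g x w v"
    and g_pos: "x \<in> Z \<Longrightarrow> v \<noteq> 0 \<Longrightarrow> 0 < g x v v"
    and g_smooth: "smooth_on (Z \<times> UNIV \<times> UNIV) (\<lambda>(x, v, w). g x v w)"
    and \<xi>_smooth: "smooth_on Z \<xi>"
    and \<xi>_nonzero: "x \<in> Z \<Longrightarrow> \<xi> x \<noteq> 0"
    and \<xi>_vertical: "x \<in> Z \<Longrightarrow> \<exists>\<gamma> e. e > 0 \<and> smooth_on {-e<..<e} \<gamma> \<and> \<gamma> ` {-e<..<e} \<subseteq> Z \<and>
      \<gamma> 0 = x \<and> (\<gamma> has_vector_derivative \<xi> x) (at 0) \<and> (\<forall>t\<in>{-e<..<e}. pr (\<gamma> t) = pr x)"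
    and isometric_translate: "x \<in> Z \<Longrightarrow> y \<in> Z \<Longrightarrow> pr x = pr y \<Longrightarrow>
      \<exists>\<Phi>. linear \<Phi> \<and> \<Phi> ` Z \<subseteq> Z \<and> (\<forall>z\<in>Z. pr (\<Phi> z) = pr z) \<and> \<Phi> x = y \<and>
        (\<forall>z\<in>Z. \<forall>v w. g (\<Phi> z) (\<Phi> v) (\<Phi> w) = g z v w)"
begin

abbreviation G :: "('p, real^4) chart_metric" where "G \<equiv> quotient_metric Z g pr"
abbreviation T :: "'a \<Rightarrow> 'a set" where "T x \<equiv> tangent_space Z x"
abbreviation D :: "('p, real^4) chart \<Rightarrow> 'a \<Rightarrow> 'a \<Rightarrow> real^4" where
  "D c x \<equiv> frechet_derivative (snd c \<circ> pr) (at x within Z)"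
abbreviation H :: "('p, real^4) chart \<Rightarrow> 'a \<Rightarrow> 'a set" where
  "H c x \<equiv> horizontal_space Z g (snd c \<circ> pr) x"

definition lift :: "('p, real^4) chart \<Rightarrow> 'a \<Rightarrow> real^4 \<Rightarrow> 'a" where
  "lift c x a = (THE v. v \<in> H c x \<and> D c x v = a)"

lemma G_eq: "G c q a b = g (rep q) (lift c (rep q) a) (lift c (rep q) b)"
  unfolding quotient_metric_def rep_def lift_def Let_def ..

lemma \<xi>_pos: "x \<in> Z \<Longrightarrow> 0 < g x (\<xi> x) (\<xi> x)"
  by (simp add: g_pos \<xi>_nonzero)

lemma subspace_T: "x \<in> Z \<Longrightarrow> subspace (T x)"
  by (rule tangent_space_submanifold(1)[OF submanifold])

lemma \<xi>_tangent: assumes "x \<in> Z" shows "\<xi> x \<in> T x"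
  using \<xi>_vertical[OF assms] tangent_spaceI by metis

lemma vertical_derivative_zero:
  assumes "(f has_derivative f') (at x within Z)" "x \<in> Z"
    and "\<And>z. z \<in> Z \<Longrightarrow> pr z = pr x \<Longrightarrow> f z = f x"
  shows "f' (\<xi> x) = 0"
proof -
  obtain \<gamma> e where \<gamma>: "e > 0" "smooth_on {-e<..<e} \<gamma>" "\<gamma> ` {-e<..<e} \<subseteq> Z"
    "\<gamma> 0 = x" "(\<gamma> has_vector_derivative \<xi> x) (at 0)" "\<forall>t\<in>{-e<..<e}. pr (\<gamma> t) = pr x"
    using \<xi>_vertical[OF assms(2)] by (elim exE conjE)
  have "((\<lambda>t. f (\<gamma> t)) has_vector_derivative f' (\<xi> x)) (at 0)"
    by (rule has_vector_derivative_along_curve[OF assms(1) \<gamma>(5,4,1,3)])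
  moreover have "((\<lambda>t. f (\<gamma> t)) has_vector_derivative 0) (at 0)"
  proof (rule has_vector_derivative_transform_within_open[OF has_vector_derivative_const])
    show "f x = f (\<gamma> t)" if "t \<in> {-e<..<e}" for t
    proof -
      have "\<gamma> t \<in> Z" using \<gamma>(3) that by blast
      then show ?thesis using assms(3) \<gamma>(6) that by simp
    qed
  qed (use \<gamma>(1) in auto)
  ultimately show ?thesis by (rule vector_derivative_unique_at)
qed

context
  fixes c :: "('p, real^4) chart" and x :: 'a
  assumes c: "c \<in> A" and x: "x \<in> Z" and xc: "pr x \<in> fst c"
begin

lemma linear_D: "linear (D c x)"
  using atlas_has_derivative[OF c x xc] by (rule has_derivative_linear)

lemma D_\<xi>: "D c x (\<xi> x) = 0"
  by (rule vertical_derivative_zero[OF atlas_has_derivative[OF c x xc] x]) simp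

text \<open>The tangent space has one dimension more than the quotient, so the kernel of the derivative of
  the projection is a line.\<close>

lemma kernel_D:
  assumes w: "w \<in> T x" "D c x w = 0"
  obtains r where "w = r *\<^sub>R \<xi> x"
proof -
  interpret D: linear "D c x" by (rule linear_D)
  define K where "K = {v \<in> T x. D c x v = 0}"
  have subK: "subspace K"
    using subspace_T[OF x] unfolding K_def subspace_def by (auto simp: D.add D.scale D.zero)
  have pre: "\<exists>v. v \<in> T x \<and> D c x v = b" for b
  proof -
    have "b \<in> D c x ` T x" using atlasD(7)[OF c x xc] by simp
    then show ?thesis by blast
  qed
  \<comment> \<open>A linear right inverse s of the derivative with values in the tangent space; its range is
    complementary to the kernel.\<close>
  define s0 where "s0 b = (SOME v. v \<in> T x \<and> D c x v = b)" for b
  have s0: "s0 b \<in> T x" "D c x (s0 b) = b" for b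
    using someI_ex[OF pre[of b]] unfolding s0_def by simp_all
  define s where "s a = (\<Sum>b\<in>Basis. (a \<bullet> b) *\<^sub>R s0 b)" for a
  have lin_s: "linear s"
    unfolding s_def by (rule linearI) (simp_all add: inner_add_left scaleR_add_left sum.distrib scaleR_sum_right)
  have sT: "s a \<in> T x" for a
    unfolding s_def by (intro subspace_sum subspace_scale subspace_T x s0(1))
  have Ds: "D c x (s a) = a" for a
    unfolding s_def by (simp add: D.sum D.scale s0(2) euclidean_representation)
  have "inj s" using Ds by (metis injI)
  then have dim_s: "dim (range s) = 4"
    using dim_image_eq[OF lin_s, of UNIV] by simp
  have "range s \<inter> K = {0}"
  proof
    show "range s \<inter> K \<subseteq> {0}"
    proof
      fix v assume "v \<in> range s \<inter> K"
      then obtain a where a: "v = s a" "D c x v = 0" unfolding K_def by blast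
      then have "a = 0" using Ds by simp
      then show "v \<in> {0}" using a(1) linear_0[OF lin_s] by simp
    qed
    show "{0} \<subseteq> range s \<inter> K"
      using linear_0[OF lin_s] subspace_0[OF subK] by (metis Int_iff empty_subsetI insert_subset rangeI)
  qed
  then have "dim {u + v |u v. u \<in> range s \<and> v \<in> K} = 4 + dim K"
    using dim_sums_Int[OF linear_subspace_image[OF lin_s subspace_UNIV] subK] dim_s by simp
  moreover have "{u + v |u v. u \<in> range s \<and> v \<in> K} \<subseteq> T x"
  proof
    fix y assume "y \<in> {u + v |u v. u \<in> range s \<and> v \<in> K}"
    then obtain a v where "y = s a + v" "v \<in> T x" unfolding K_def by blast
    then show "y \<in> T x" using subspace_add[OF subspace_T[OF x] sT] by simp
  qed
  then have "dim {u + v |u v. u \<in> range s \<and> v \<in> K} \<le> dim (T x)" by (rule dim_subset)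
  moreover have "dim (T x) = 5" by (rule tangent_space_submanifold(2)[OF submanifold x])
  ultimately have dK: "dim K \<le> 1" by simp
  have "span {\<xi> x} = K"
  proof (rule subspace_dim_equal[OF subspace_span subK])
    show "span {\<xi> x} \<subseteq> K"
      by (rule span_minimal[OF _ subK]) (simp add: K_def D_\<xi> \<xi>_tangent x)
    show "dim (span {\<xi> x}) \<ge> dim K" using dK \<xi>_nonzero[OF x] by (simp add: dim_singleton)
  qed
  then have "w \<in> span {\<xi> x}" using w unfolding K_def by blast
  then show thesis using that unfolding span_singleton by blast
qed

lemma H_iff: "v \<in> H c x \<longleftrightarrow> v \<in> T x \<and> g x v (\<xi> x) = 0"
proof
  assume "v \<in> H c x"
  then show "v \<in> T x \<and> g x v (\<xi> x) = 0"
    unfolding horizontal_space_def using \<xi>_tangent[OF x] D_\<xi> by blast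
next
  assume v: "v \<in> T x \<and> g x v (\<xi> x) = 0"
  have "g x v w = 0" if w: "w \<in> T x" "D c x w = 0" for w
  proof -
    obtain r where "w = r *\<^sub>R \<xi> x" using kernel_D[OF w] .
    then show ?thesis using v by (simp add: bilinear_rmul[OF g_bilinear[OF x]])
  qed
  then show "v \<in> H c x" unfolding horizontal_space_def using v by blast
qed

lemma lift_unique:
  assumes "v \<in> T x" "g x v (\<xi> x) = 0" "D c x v = a"
  shows "lift c x a = v"
  unfolding lift_def
proof (rule the_equality)
  show "v \<in> H c x \<and> D c x v = a" using assms H_iff by blast
  fix w assume "w \<in> H c x \<and> D c x w = a"
  then have w: "w \<in> T x" "g x w (\<xi> x) = 0" "D c x w = a" using H_iff by blast+
  have "w - v \<in> T x" using subspace_diff[OF subspace_T[OF x]] w assms by blast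
  moreover have "D c x (w - v) = 0" using linear_diff[OF linear_D] w assms by simp
  ultimately obtain r where r: "w - v = r *\<^sub>R \<xi> x" by (rule kernel_D)
  have "g x (w - v) (\<xi> x) = 0" using w assms by (simp add: bilinear_lsub[OF g_bilinear[OF x]])
  then have "r * g x (\<xi> x) (\<xi> x) = 0"
    unfolding r by (simp add: bilinear_lmul[OF g_bilinear[OF x]])
  then have "r = 0" using \<xi>_pos[OF x] by simp
  then show "w = v" using r by simp
qed

text \<open>The horizontal lift is the component orthogonal to \<open>\<xi>\<close> of an arbitrary lift.\<close>

lemma lift_projection:
  assumes "v \<in> T x"
  shows "lift c x (D c x v) = v - (g x v (\<xi> x) / g x (\<xi> x) (\<xi> x)) *\<^sub>R \<xi> x"
proof (rule lift_unique)
  show "v - (g x v (\<xi> x) / g x (\<xi> x) (\<xi> x)) *\<^sub>R \<xi> x \<in> T x"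
    using assms subspace_T[OF x] \<xi>_tangent[OF x] by (intro subspace_diff subspace_scale)
  show "g x (v - (g x v (\<xi> x) / g x (\<xi> x) (\<xi> x)) *\<^sub>R \<xi> x) (\<xi> x) = 0"
    using \<xi>_pos[OF x] by (simp add: bilinear_lsub[OF g_bilinear[OF x]] bilinear_lmul[OF g_bilinear[OF x]])
  show "D c x (v - (g x v (\<xi> x) / g x (\<xi> x) (\<xi> x)) *\<^sub>R \<xi> x) = D c x v"
    using linear_diff[OF linear_D] linear_scale[OF linear_D] D_\<xi> by simp
qed

lemma tangent_preimage: obtains v where "v \<in> T x" "D c x v = a"
proof -
  have "a \<in> D c x ` T x" using atlasD(7)[OF c x xc] by simp
  then show thesis using that by blast
qed

lemma lift: "lift c x a \<in> T x" "g x (lift c x a) (\<xi> x) = 0" "D c x (lift c x a) = a"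
proof -
  obtain v where v: "v \<in> T x" "D c x v = a" by (rule tangent_preimage)
  let ?w = "v - (g x v (\<xi> x) / g x (\<xi> x) (\<xi> x)) *\<^sub>R \<xi> x"
  have w: "lift c x a = ?w" using lift_projection[OF v(1)] v(2) by simp
  show "lift c x a \<in> T x" unfolding w
    using v(1) subspace_T[OF x] \<xi>_tangent[OF x] by (intro subspace_diff subspace_scale)
  show "g x (lift c x a) (\<xi> x) = 0" unfolding w
    using \<xi>_pos[OF x] by (simp add: bilinear_lsub[OF g_bilinear[OF x]] bilinear_lmul[OF g_bilinear[OF x]])
  show "D c x (lift c x a) = a" unfolding w
    using v(2) linear_diff[OF linear_D] linear_scale[OF linear_D] D_\<xi> by simp
qed

lemma linear_lift: "linear (lift c x)"
proof (rule linearI)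
  fix a b :: "real^4" and r :: real
  show "lift c x (a + b) = lift c x a + lift c x b"
    by (rule lift_unique)
      (use lift subspace_add[OF subspace_T[OF x]] linear_add[OF linear_D] bilinear_ladd[OF g_bilinear[OF x]] in auto)
  show "lift c x (r *\<^sub>R a) = r *\<^sub>R lift c x a"
    by (rule lift_unique)
      (use lift subspace_scale[OF subspace_T[OF x]] linear_scale[OF linear_D] bilinear_lmul[OF g_bilinear[OF x]] in auto)
qed

end

text \<open>A linear isometry that covers a map F of the quotient intertwines horizontal lifts. With the
  identity for F this shows both that the quotient metric does not depend on the point chosen in the
  orbit and that it obeys the transformation law.\<close>

lemma lift_covering:
  assumes \<Phi>: "linear \<Phi>" "\<Phi> ` Z \<subseteq> Z" "\<And>z v w. z \<in> Z \<Longrightarrow> g (\<Phi> z) (\<Phi> v) (\<Phi> w) = g z v w"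
    and F: "\<And>z. z \<in> Z \<Longrightarrow> F (pr z) = pr (\<Phi> z)"
    and c: "c \<in> A" "pr x \<in> fst c" and d: "d \<in> A" "F (pr x) \<in> fst d" and x: "x \<in> Z"
  shows "lift d (\<Phi> x) (chart_deriv c d F (pr x) a) = \<Phi> (lift c x a)"
proof -
  have \<Phi>x: "\<Phi> x \<in> Z" "pr (\<Phi> x) \<in> fst d" using \<Phi>(2) x d(2) F by auto
  have "smooth_map X A X A F"
    by (rule smooth_map_induced[OF smooth_quotient_axioms smooth_quotient_axioms
          smooth_on_linear[OF \<Phi>(1)] \<Phi>(2)]) (rule F)
  note E = chart_rep_has_derivative[OF this c(1) d(1) c(2) d(2)]
  have bl\<Phi>: "bounded_linear \<Phi>" using \<Phi>(1) linear_conv_bounded_linear by blast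
  have D\<Phi>: "D d (\<Phi> x) (\<Phi> v) = chart_deriv c d F (pr x) (D c x v)" if v: "v \<in> T x" for v
  proof -
    from v obtain \<gamma> e where \<gamma>: "e > 0" "smooth_on {-e<..<e} \<gamma>" "\<gamma> ` {-e<..<e} \<subseteq> Z" "\<gamma> 0 = x"
      "(\<gamma> has_vector_derivative v) (at 0)" by (rule tangent_spaceE)
    have \<Phi>\<gamma>: "((\<lambda>t. \<Phi> (\<gamma> t)) has_vector_derivative \<Phi> v) (at 0)"
      by (rule bounded_linear.has_vector_derivative[OF bl\<Phi> \<gamma>(5)])
    have 1: "((\<lambda>t. (snd d \<circ> pr) (\<Phi> (\<gamma> t))) has_vector_derivative D d (\<Phi> x) (\<Phi> v)) (at 0)"
      by (rule has_vector_derivative_along_curve[OF atlas_has_derivative[OF d(1) \<Phi>x] \<Phi>\<gamma> _ \<gamma>(1)])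
        (use \<gamma>(3,4) \<Phi>(2) in auto)
    have "((\<lambda>t. (snd c \<circ> pr) (\<gamma> t)) has_vector_derivative D c x v) (at 0)"
      by (rule has_vector_derivative_along_curve[OF atlas_has_derivative[OF c(1) x c(2)] \<gamma>(5,4,1,3)])
    moreover have "(chart_rep c d F has_derivative chart_deriv c d F (pr x)) (at ((snd c \<circ> pr) (\<gamma> 0)))"
      using E \<gamma>(4) by simp
    ultimately have 2: "((\<lambda>t. chart_rep c d F ((snd c \<circ> pr) (\<gamma> t))) has_vector_derivative
        chart_deriv c d F (pr x) (D c x v)) (at 0)"
      using vector_derivative_diff_chain_within[of "\<lambda>t. (snd c \<circ> pr) (\<gamma> t)" _ 0 UNIV]
        has_derivative_at_withinI by (fastforce simp: o_def)
    have eq: "chart_rep c d F ((snd c \<circ> pr) z) = (snd d \<circ> pr) (\<Phi> z)" if "z \<in> Z" "pr z \<in> fst c" for z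
      using inv_into_f_f[OF atlasD(3)[OF c(1)] that(2)] F[OF that(1)] by (simp add: chart_rep_def)
    have "eventually (\<lambda>t. \<gamma> t \<in> {z \<in> Z. pr z \<in> fst c}) (at 0)"
      by (rule curve_eventually_in_openin[OF atlasD(5)[OF c(1)] _ \<gamma>(5,1,3)]) (use \<gamma>(4) x c(2) in simp)
    then have "eventually (\<lambda>t. chart_rep c d F ((snd c \<circ> pr) (\<gamma> t)) = (snd d \<circ> pr) (\<Phi> (\<gamma> t))) (at 0)"
      by eventually_elim (use eq in blast)
    moreover have "chart_rep c d F ((snd c \<circ> pr) (\<gamma> 0)) = (snd d \<circ> pr) (\<Phi> (\<gamma> 0))"
      using eq \<gamma>(4) x c(2) by blast
    ultimately have "((\<lambda>t. (snd d \<circ> pr) (\<Phi> (\<gamma> t))) has_vector_derivative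
        chart_deriv c d F (pr x) (D c x v)) (at 0)"
      using has_derivative_transform_eventually[OF 2[unfolded has_vector_derivative_def]]
      by (simp add: has_vector_derivative_def)
    from vector_derivative_unique_at[OF 1 this] show ?thesis .
  qed
  have linE: "linear (chart_deriv c d F (pr x))" using E by (rule has_derivative_linear)
  have tan\<Phi>: "\<Phi> v \<in> T (\<Phi> x)" if "v \<in> T x" for v
    by (rule tangent_space_linear_image[OF \<Phi>(1,2) that])
  note l = lift[OF c(1) x c(2), of a]
  have "D d (\<Phi> x) (\<Phi> (\<xi> x)) = 0"
    using D\<Phi>[OF \<xi>_tangent[OF x]] D_\<xi>[OF c(1) x c(2)] linear_0[OF linE] by simp
  with tan\<Phi>[OF \<xi>_tangent[OF x]] obtain r where r: "\<Phi> (\<xi> x) = r *\<^sub>R \<xi> (\<Phi> x)"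
    by (rule kernel_D[OF d(1) \<Phi>x])
  \<comment> \<open>So \<open>\<Phi>\<close> maps vertical vectors to vertical ones, and being isometric also horizontal vectors to
    horizontal ones.\<close>
  have "r \<noteq> 0"
  proof
    assume "r = 0"
    then have "g (\<Phi> x) (\<Phi> (\<xi> x)) (\<Phi> (\<xi> x)) = 0"
      using r by (simp add: bilinear_lzero[OF g_bilinear[OF \<Phi>x(1)]])
    then show False using \<Phi>(3)[OF x] \<xi>_pos[OF x] by simp
  qed
  moreover have "r * g (\<Phi> x) (\<Phi> (lift c x a)) (\<xi> (\<Phi> x)) = 0"
    using \<Phi>(3)[OF x, of "lift c x a" "\<xi> x"] l(2) r
    by (simp add: bilinear_rmul[OF g_bilinear[OF \<Phi>x(1)]])
  ultimately have "g (\<Phi> x) (\<Phi> (lift c x a)) (\<xi> (\<Phi> x)) = 0" by simp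
  then show ?thesis
    by (intro lift_unique[OF d(1) \<Phi>x tan\<Phi>[OF l(1)]]) (simp_all add: D\<Phi>[OF l(1)] l(3))
qed

lemma chart_deriv_id:
  assumes "c \<in> A" "q \<in> fst c" shows "chart_deriv c c id q a = a"
proof -
  have "((\<lambda>u. u) has_derivative (\<lambda>a. a)) (at (snd c q))" by (rule has_derivative_ident)
  then have "(chart_rep c c id has_derivative (\<lambda>a. a)) (at (snd c q))"
    by (rule has_derivative_transform_within_open[OF _ atlasD(2)[OF assms(1)]])
      (use assms in \<open>auto simp: chart_rep_def inv_into_f_f[OF atlasD(3)[OF assms(1)]]\<close>)
  then show ?thesis unfolding chart_deriv_def by (metis frechet_derivative_at)
qed

lemma G_at:
  assumes "c \<in> A" "x \<in> Z" "pr x \<in> fst c"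
  shows "G c (pr x) a b = g x (lift c x a) (lift c x b)"
proof -
  have r: "rep (pr x) \<in> Z" "pr (rep (pr x)) = pr x" using rep[of "pr x"] assms(2) by blast+
  obtain \<Phi> where \<Phi>: "linear \<Phi>" "\<Phi> ` Z \<subseteq> Z" "\<forall>z\<in>Z. pr (\<Phi> z) = pr z" "\<Phi> (rep (pr x)) = x"
    "\<forall>z\<in>Z. \<forall>v w. g (\<Phi> z) (\<Phi> v) (\<Phi> w) = g z v w"
    using isometric_translate[OF r(1) assms(2) r(2)] by blast
  have L: "lift c x a = \<Phi> (lift c (rep (pr x)) a)" for a
    using lift_covering[OF \<Phi>(1,2), of id c "rep (pr x)" c a] \<Phi>(3-5) r assms
    by (simp add: chart_deriv_id)
  show ?thesis
    using \<Phi>(5)[rule_format, OF r(1), of "lift c (rep (pr x)) a" "lift c (rep (pr x)) b"]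
    unfolding G_eq L \<Phi>(4) by simp
qed

lemma preserves_metric_covering:
  assumes \<Phi>: "linear \<Phi>" "\<Phi> ` Z \<subseteq> Z" "\<And>z v w. z \<in> Z \<Longrightarrow> g (\<Phi> z) (\<Phi> v) (\<Phi> w) = g z v w"
    and F: "\<And>z. z \<in> Z \<Longrightarrow> F (pr z) = pr (\<Phi> z)"
  shows "preserves_metric A G F"
  unfolding preserves_metric_def
proof (intro ballI impI allI)
  fix c d q a b assume c: "c \<in> A" and d: "d \<in> A" and q: "q \<in> fst c" "F q \<in> fst d"
  obtain x where x: "x \<in> Z" "q = pr x" using q(1) atlasD(4)[OF c] by blast
  have \<Phi>x: "\<Phi> x \<in> Z" "pr (\<Phi> x) \<in> fst d" "F q = pr (\<Phi> x)" using \<Phi>(2) x q(2) F by auto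
  note L = lift_covering[OF \<Phi>(1,2,3) F c _ d _ x(1)]
  show "G d (F q) (chart_deriv c d F q a) (chart_deriv c d F q b) = G c q a b"
    unfolding \<Phi>x(3) G_at[OF d \<Phi>x(1,2)] unfolding x(2)
    using G_at[OF c x(1)] q x L \<Phi>(3)[OF x(1)] by simp
qed

lemma smooth_on_g:
  fixes s v w :: "'b::real_normed_vector \<Rightarrow> 'a"
  assumes "smooth_on N s" "smooth_on N v" "smooth_on N w" "s ` N \<subseteq> Z"
  shows "smooth_on N (\<lambda>u. g (s u) (v u) (w u))"
  using smooth_on_compose[OF smooth_on_Pair[OF assms(1) smooth_on_Pair[OF assms(2,3)]] g_smooth] assms(4)
  by auto

text \<open>The derivative of a section lifts tangent vectors. Its horizontal component is an explicit expression
  in smooth functions, which gives the smoothness of the quotient metric.\<close>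

lemma lift_local_section:
  assumes c: "c \<in> A" and N: "open N" "smooth_on N s" "\<And>u. u \<in> N \<Longrightarrow> s u \<in> Z"
    "\<And>u. u \<in> N \<Longrightarrow> pr (s u) \<in> fst c" "\<And>u. u \<in> N \<Longrightarrow> snd c (pr (s u)) = u" and u: "u \<in> N"
  shows "lift c (s u) a = frechet_derivative s (at u) a -
    (g (s u) (frechet_derivative s (at u) a) (\<xi> (s u)) / g (s u) (\<xi> (s u)) (\<xi> (s u))) *\<^sub>R \<xi> (s u)"
proof -
  let ?v = "frechet_derivative s (at u) a"
  have v: "?v \<in> T (s u)"
    by (rule tangent_space_smooth_image[OF N(1,2) _ u]) (use N(3) in blast)
  obtain e where e: "e > 0" "smooth_on {-e<..<e} (\<lambda>t. s (u + t *\<^sub>R a))"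
    "\<And>t. t \<in> {-e<..<e} \<Longrightarrow> u + t *\<^sub>R a \<in> N"
    "((\<lambda>t. s (u + t *\<^sub>R a)) has_vector_derivative ?v) (at 0)"
    by (rule smooth_along_line[OF N(1,2) u, of a]) blast
  have "((\<lambda>t. (snd c \<circ> pr) (s (u + t *\<^sub>R a))) has_vector_derivative D c (s u) ?v) (at 0)"
    by (rule has_vector_derivative_along_curve[OF atlas_has_derivative[OF c N(3,4)[OF u]] e(4) _ e(1)])
      (use e(3) N(3) in auto)
  moreover have "((\<lambda>t. (snd c \<circ> pr) (s (u + t *\<^sub>R a))) has_vector_derivative a) (at 0)"
  proof (rule has_vector_derivative_transform_within_open)
    show "((\<lambda>t. u + t *\<^sub>R a) has_vector_derivative a) (at 0)"
      unfolding has_vector_derivative_def by (rule derivative_eq_intros refl | simp)+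
    show "u + t *\<^sub>R a = (snd c \<circ> pr) (s (u + t *\<^sub>R a))" if "t \<in> {-e<..<e}" for t
      using N(5)[OF e(3)[OF that]] by simp
  qed (use e(1) in auto)
  ultimately have "D c (s u) ?v = a" by (rule vector_derivative_unique_at)
  then show ?thesis using lift_projection[OF c N(3,4)[OF u] v] by simp
qed

lemma riemannian_metric_quotient: "riemannian_metric A G"
  unfolding riemannian_metric_def
proof (intro conjI ballI allI impI)
  fix c q assume c: "c \<in> A" and q: "q \<in> fst c"
  obtain x where x: "x \<in> Z" "q = pr x" using q atlasD(4)[OF c] by blast
  with q have xc: "pr x \<in> fst c" by simp
  note G = G_at[OF c x(1) xc] and l = linear_lift[OF c x(1) xc] and gb = g_bilinear[OF x(1)]
  show "bilinear (G c q)"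
    unfolding bilinear_def x(2) G
    by (intro conjI allI linearI)
      (simp_all add: linear_add[OF l] linear_scale[OF l] bilinear_ladd[OF gb] bilinear_radd[OF gb]
        bilinear_lmul[OF gb] bilinear_rmul[OF gb])
  show "G c q a b = G c q b a" for a b unfolding x(2) G by (rule g_sym[OF x(1)])
  show "0 < G c q a a" if "a \<noteq> 0" for a
  proof -
    have "lift c x a \<noteq> 0" using lift(3)[OF c x(1) xc, of a] linear_0[OF linear_D[OF c x(1) xc]] that by metis
    then show ?thesis unfolding x(2) G by (rule g_pos[OF x(1)])
  qed
next
  fix c a b assume c: "c \<in> A"
  show "smooth_on (snd c ` fst c) (\<lambda>u. G c (inv_into (fst c) (snd c) u) a b)"
  proof (rule smooth_on_local)
    fix u assume "u \<in> snd c ` fst c"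
    then obtain q where q: "q \<in> fst c" "u = snd c q" by blast
    obtain x where x: "x \<in> Z" "q = pr x" using q(1) atlasD(4)[OF c] by blast
    with q have xc: "pr x \<in> fst c" by simp
    obtain N s where N: "open N" "snd c (pr x) \<in> N" "N \<subseteq> snd c ` fst c" "smooth_on N s"
      "s (snd c (pr x)) = x" "\<And>u. u \<in> N \<Longrightarrow> s u \<in> Z" "\<And>u. u \<in> N \<Longrightarrow> pr (s u) \<in> fst c"
      "\<And>u. u \<in> N \<Longrightarrow> snd c (pr (s u)) = u"
      by (rule local_section[OF c x(1) xc]) blast
    have inv: "inv_into (fst c) (snd c) w = pr (s w)" if "w \<in> N" for w
      by (metis inv_into_f_f[OF atlasD(3)[OF c] N(7)[OF that]] N(8)[OF that])
    have sN: "s ` N \<subseteq> Z" using N(6) by blast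
    have \<xi>s: "smooth_on N (\<lambda>u. \<xi> (s u))" by (rule smooth_on_compose[OF N(4) \<xi>_smooth sN])
    let ?l = "\<lambda>a w. frechet_derivative s (at w) a -
      (g (s w) (frechet_derivative s (at w) a) (\<xi> (s w)) / g (s w) (\<xi> (s w)) (\<xi> (s w))) *\<^sub>R \<xi> (s w)"
    have ls: "smooth_on N (?l a)" for a
      by (intro smooth_on_diff smooth_on_scaleR smooth_on_divide smooth_on_g N(4) sN \<xi>s
          smooth_on_frechet_derivative N(1)) (metis N(6) \<xi>_pos less_irrefl)
    have "smooth_on N (\<lambda>w. g (s w) (?l a w) (?l b w))"
      by (rule smooth_on_g[OF N(4) ls ls sN])
    then have "smooth_on N (\<lambda>u. G c (inv_into (fst c) (snd c) u) a b)"
    proof (rule smooth_on_cong)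
      fix w assume w: "w \<in> N"
      have "lift c (s w) a' = ?l a' w" for a'
        by (rule lift_local_section[OF c N(1,4) _ _ _ w]) (rule N(6-8), assumption)+
      then show "g (s w) (?l a w) (?l b w) = G c (inv_into (fst c) (snd c) w) a b"
        unfolding inv[OF w] G_at[OF c N(6,7)[OF w]] by simp
    qed
    then have "smooth_on (snd c ` fst c \<inter> N) (\<lambda>u. G c (inv_into (fst c) (snd c) u) a b)"
      by (rule smooth_on_subset) simp
    moreover have "u \<in> N" using N(2) q(2) x(2) by simp
    ultimately show "\<exists>U. open U \<and> u \<in> U \<and> smooth_on (snd c ` fst c \<inter> U)
        (\<lambda>u. G c (inv_into (fst c) (snd c) u) a b)"
      using N(1) by (intro exI[of _ N]) simp
  qed
next
  show "preserves_metric A G id"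
    by (rule preserves_metric_covering[of "\<lambda>x. x"]) (auto simp: linear_iff)
qed

lemma riemannian_submersion_quotient: "riemannian_submersion Z g A G pr"
  unfolding riemannian_submersion_def Let_def
proof (intro ballI conjI impI)
  fix c assume c: "c \<in> A"
  show "smooth_submersion_on Z {x \<in> Z. pr x \<in> fst c} (snd c \<circ> pr)"
    using c unfolding quotient_atlas_def by simp
  fix x v w assume x: "x \<in> Z" "pr x \<in> fst c" and v: "v \<in> H c x" and w: "w \<in> H c x"
  have "lift c x (D c x v) = v" if "v \<in> H c x" for v
    using that H_iff[OF c x] lift_unique[OF c x] by blast
  with v w show "G c (pr x) (D c x v) (D c x w) = g x v w" using G_at[OF c x] by simp
qed

text \<open>A function on Z that is constant on orbits has the same derivative on a tangent vector and on
  its horizontal part; so a bound for its derivative by the norm of g is inherited by the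
  induced function on the quotient.\<close>

lemma lipschitz_function_descends:
  fixes h :: "'a \<Rightarrow> 'b::real_normed_vector"
  assumes h: "\<And>x. x \<in> Z \<Longrightarrow> (h has_derivative h' x) (at x within Z)"
    and bound: "\<And>x v. x \<in> Z \<Longrightarrow> norm (h' x v) \<le> C * sqrt (g x v v)"
    and orbit: "\<And>x y. x \<in> Z \<Longrightarrow> y \<in> Z \<Longrightarrow> pr x = pr y \<Longrightarrow> h x = h y"
    and c: "c \<in> A" and q: "q \<in> fst c"
  shows "\<exists>E. ((\<lambda>u. h (rep (inv_into (fst c) (snd c) u))) has_derivative E) (at (snd c q)) \<and>
    (\<forall>a. norm (E a) \<le> C * sqrt (G c q a a))"
proof -
  obtain x where x: "x \<in> Z" "q = pr x" using q atlasD(4)[OF c] by blast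
  with q have xc: "pr x \<in> fst c" by simp
  obtain N s where N: "open N" "snd c (pr x) \<in> N" "N \<subseteq> snd c ` fst c" "smooth_on N s"
    "s (snd c (pr x)) = x" "\<And>u. u \<in> N \<Longrightarrow> s u \<in> Z" "\<And>u. u \<in> N \<Longrightarrow> pr (s u) \<in> fst c"
    "\<And>u. u \<in> N \<Longrightarrow> snd c (pr (s u)) = u"
    by (rule local_section[OF c x(1) xc]) blast
  let ?u = "snd c (pr x)" and ?s' = "frechet_derivative s (at (snd c (pr x)))"
  have inv: "inv_into (fst c) (snd c) w = pr (s w)" if "w \<in> N" for w
    by (metis inv_into_f_f[OF atlasD(3)[OF c] N(7)[OF that]] N(8)[OF that])
  have eq: "h (rep (inv_into (fst c) (snd c) w)) = h (s w)" if "w \<in> N" for w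
    unfolding inv[OF that] using rep[of "pr (s w)"] N(6)[OF that] by (intro orbit) auto
  have "(s has_derivative ?s') (at ?u within N)"
    by (rule has_derivative_at_withinI[OF smooth_on_open_has_derivative[OF N(4,2,1)]])
  moreover have "(h has_derivative h' x) (at (s ?u) within s ` N)"
    unfolding N(5) by (rule has_derivative_subset[OF h[OF x(1)]]) (use N(6) in blast)
  ultimately have "(h \<circ> s has_derivative h' x \<circ> ?s') (at ?u within N)"
    by (rule diff_chain_within)
  then have "((\<lambda>w. h (s w)) has_derivative (\<lambda>a. h' x (?s' a))) (at ?u)"
    using N(1,2) by (simp add: at_within_open[of ?u N] o_def)
  then have E: "((\<lambda>u. h (rep (inv_into (fst c) (snd c) u))) has_derivative (\<lambda>a. h' x (?s' a))) (at ?u)"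
    by (rule has_derivative_transform_within_open[OF _ N(1,2)]) (simp add: eq)
  have "norm (h' x (?s' a)) \<le> C * sqrt (G c q a a)" for a
  proof -
    interpret h': linear "h' x" using h[OF x(1)] by (rule has_derivative_linear)
    have "h' x (\<xi> x) = 0"
      by (rule vertical_derivative_zero[OF h[OF x(1)] x(1)]) (use orbit x(1) in blast)
    then have "h' x (lift c x a) = h' x (?s' a)"
      using lift_local_section[OF c N(1,4,6,7,8,2), of a] unfolding N(5)
      by (simp add: h'.diff h'.scale)
    then show ?thesis using bound[OF x(1), of "lift c x a"] G_at[OF c x(1) xc] x(2) by simp
  qed
  with E show ?thesis unfolding x(2) by blast
qed

end

section \<open>Riemannian distance and completeness\<close>

definition C1_near :: "(real \<Rightarrow> 'b::real_normed_vector) \<Rightarrow> real \<Rightarrow> bool" where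
  "C1_near f t \<longleftrightarrow> (\<exists>N. open N \<and> t \<in> N \<and> f C1_differentiable_on N)"

lemma C1_on_vector_derivative:
  assumes "f C1_differentiable_on N" "t \<in> N"
  shows "(f has_vector_derivative vector_derivative f (at t)) (at t)"
  using assms unfolding C1_differentiable_on_def by (metis vector_derivative_at)

lemma C1_on_continuous_derivative:
  assumes "f C1_differentiable_on N"
  shows "continuous_on N (\<lambda>t. vector_derivative f (at t))"
proof -
  obtain D where D: "\<And>x. x \<in> N \<Longrightarrow> (f has_vector_derivative D x) (at x)" "continuous_on N D"
    using assms unfolding C1_differentiable_on_def by blast
  show ?thesis
    by (rule continuous_on_eq[OF D(2)]) (simp add: vector_derivative_at[OF D(1)])
qed

lemma C1_differentiable_on_local:
  assumes "\<And>t. t \<in> T \<Longrightarrow> C1_near f t"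
  shows "f C1_differentiable_on T"
  unfolding C1_differentiable_on_def
proof (intro exI[of _ "\<lambda>t. vector_derivative f (at t)"] conjI ballI)
  fix t assume "t \<in> T"
  from assms[OF this] obtain N where N: "open N" "t \<in> N" "f C1_differentiable_on N"
    unfolding C1_near_def by blast
  from C1_on_vector_derivative[OF N(3,2)]
  show "(f has_vector_derivative vector_derivative f (at t)) (at t)" .
next
  show "continuous_on T (\<lambda>t. vector_derivative f (at t))"
  proof (rule continuous_at_imp_continuous_on, rule ballI)
    fix t assume "t \<in> T"
    from assms[OF this] obtain N where N: "open N" "t \<in> N" "f C1_differentiable_on N"
      unfolding C1_near_def by blast
    show "isCont (\<lambda>t. vector_derivative f (at t)) t"
      using C1_on_continuous_derivative[OF N(3)] N(1,2) by (simp add: continuous_on_eq_continuous_at)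
  qed
qed

lemma C1_near_cong:
  assumes "C1_near f t" "open N" "t \<in> N" "\<And>s. s \<in> N \<Longrightarrow> f s = g s"
  shows "C1_near g t"
proof -
  obtain N' D where N': "open N'" "t \<in> N'" "\<And>x. x \<in> N' \<Longrightarrow> (f has_vector_derivative D x) (at x)"
    "continuous_on N' D"
    using assms(1) unfolding C1_near_def C1_differentiable_on_def by blast
  have "(g has_vector_derivative D x) (at x)" if "x \<in> N \<inter> N'" for x
    by (rule has_vector_derivative_transform_within_open[OF N'(3) assms(2)]) (use that assms(4) in auto)
  moreover have "continuous_on (N \<inter> N') D" by (rule continuous_on_subset[OF N'(4)]) simp
  ultimately show ?thesis
    unfolding C1_near_def C1_differentiable_on_def using N'(1,2) assms(2,3)
    by (intro exI[of _ "N \<inter> N'"]) auto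
qed

lemma has_vector_derivative_affine:
  assumes "(f has_vector_derivative D) (at (m * t + b))"
  shows "((\<lambda>s. f (m * s + b)) has_vector_derivative m *\<^sub>R D) (at (t::real))"
proof -
  have "((\<lambda>s. m * s + b) has_vector_derivative m) (at t)"
    unfolding has_vector_derivative_def by (rule derivative_eq_intros refl | simp add: fun_eq_iff)+
  moreover have "(f has_vector_derivative D) (at ((\<lambda>s. m * s + b) t))" using assms by simp
  ultimately have "(f \<circ> (\<lambda>s. m * s + b) has_vector_derivative m *\<^sub>R D) (at t)"
    by (rule vector_diff_chain_at)
  then show ?thesis by (simp add: o_def)
qed

lemma C1_near_affine:
  assumes "C1_near f (m * t + b)"
  shows "C1_near (\<lambda>s. f (m * s + b)) t"
proof -
  obtain N D where N: "open N" "m * t + b \<in> N" "\<And>x. x \<in> N \<Longrightarrow> (f has_vector_derivative D x) (at x)"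
    "continuous_on N D"
    using assms unfolding C1_near_def C1_differentiable_on_def by blast
  let ?N = "(\<lambda>s. m * s + b) -` N"
  have "open ?N" by (rule open_vimage[OF N(1)]) (intro continuous_intros)
  moreover have "continuous_on ?N (\<lambda>s. m *\<^sub>R D (m * s + b))"
    by (intro continuous_intros continuous_on_compose2[OF N(4)]) auto
  moreover have "((\<lambda>s. f (m * s + b)) has_vector_derivative m *\<^sub>R D (m * s + b)) (at s)" if "s \<in> ?N" for s
    by (rule has_vector_derivative_affine[OF N(3)]) (use that in simp)
  ultimately show ?thesis
    unfolding C1_near_def C1_differentiable_on_def using N(2)
    by (intro exI[of _ ?N] conjI exI[of _ "\<lambda>s. m *\<^sub>R D (m * s + b)"] ballI) auto
qed

lemma smooth_on_C1:
  fixes f :: "real \<Rightarrow> 'b::real_normed_vector"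
  assumes "smooth_on N f" "open N"
  shows "f C1_differentiable_on N"
  unfolding C1_differentiable_on_def
proof (intro exI[of _ "\<lambda>t. frechet_derivative f (at t) 1"] conjI ballI)
  fix t assume "t \<in> N"
  then have d: "(f has_derivative frechet_derivative f (at t)) (at t)"
    by (rule smooth_on_open_has_derivative[OF assms(1) _ assms(2)])
  have lin: "frechet_derivative f (at t) h = h *\<^sub>R frechet_derivative f (at t) 1" for h
    using linear_scale[OF has_derivative_linear[OF d], of h 1] by simp
  show "(f has_vector_derivative frechet_derivative f (at t) 1) (at t)"
    unfolding has_vector_derivative_def by (rule has_derivative_eq_rhs[OF d]) (rule ext, rule lin)
next
  show "continuous_on N (\<lambda>t. frechet_derivative f (at t) 1)"
    by (rule smooth_on_imp_continuous_on[OF smooth_on_frechet_derivative[OF assms]])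
qed

lemma AE_lborel_notin_finite: "finite E \<Longrightarrow> AE t in lborel. t \<notin> (E :: real set)"
  by (rule AE_not_in) (rule finite_imp_null_set_lborel)

text \<open>On a Riemannian quotient such functions come from invariant functions; in general they bound the
  Riemannian distance from below.\<close>

definition gradient_bounded ::
    "'p topology \<Rightarrow> ('p, 'e::euclidean_space) chart set \<Rightarrow> ('p, 'e) chart_metric \<Rightarrow> real \<Rightarrow>
     ('p \<Rightarrow> 'b::real_normed_vector) \<Rightarrow> bool" where
  "gradient_bounded X A G C h \<longleftrightarrow> C > 0 \<and> continuous_map X euclidean h \<and>
     (\<forall>q\<in>topspace X. \<exists>c\<in>A. q \<in> fst c \<and>
        (\<exists>E. ((\<lambda>u. h (inv_into (fst c) (snd c) u)) has_derivative E) (at (snd c q)) \<and>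
           (\<forall>a. norm (E a) \<le> C * sqrt (G c q a a))))"

locale riemannian_manifold =
  fixes X :: "'p topology" and A :: "('p, 'e::euclidean_space) chart set" and G :: "('p, 'e) chart_metric"
  assumes manifold: "smooth_manifold X A" and metric: "riemannian_metric A G"
begin

lemma chart:
  assumes "c \<in> A"
  shows "topological_chart X c" "openin X (fst c)" "open (snd c ` fst c)" "inj_on (snd c) (fst c)"
    "fst c \<subseteq> topspace X" "continuous_map (subtopology X (fst c)) (top_of_set (snd c ` fst c)) (snd c)"
    "continuous_map (top_of_set (snd c ` fst c)) (subtopology X (fst c)) (inv_into (fst c) (snd c))"
proof -
  show tc: "topological_chart X c" using manifold assms unfolding smooth_manifold_def by blast
  then have c: "openin X (fst c)" "open (snd c ` fst c)"
    "homeomorphic_map (subtopology X (fst c)) (top_of_set (snd c ` fst c)) (snd c)"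
    unfolding topological_chart_def by (auto simp: case_prod_beta)
  show "openin X (fst c)" "open (snd c ` fst c)" by (rule c)+
  show sub: "fst c \<subseteq> topspace X" using c(1) by (rule openin_subset)
  then have ts: "topspace (subtopology X (fst c)) = fst c" by auto
  show inj: "inj_on (snd c) (fst c)"
    using homeomorphic_imp_injective_map[OF c(3)] unfolding ts .
  show "continuous_map (subtopology X (fst c)) (top_of_set (snd c ` fst c)) (snd c)"
    by (rule homeomorphic_imp_continuous_map[OF c(3)])
  obtain f where f: "homeomorphic_maps (subtopology X (fst c)) (top_of_set (snd c ` fst c)) (snd c) f"
    using c(3) homeomorphic_map_maps by blast
  then have fc: "continuous_map (top_of_set (snd c ` fst c)) (subtopology X (fst c)) f"
    and fi: "\<forall>q\<in>fst c. f (snd c q) = q"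
    unfolding homeomorphic_maps_def ts by blast+
  show "continuous_map (top_of_set (snd c ` fst c)) (subtopology X (fst c)) (inv_into (fst c) (snd c))"
  proof (rule continuous_map_eq[OF fc])
    fix u assume "u \<in> topspace (top_of_set (snd c ` fst c))"
    then obtain q where "q \<in> fst c" "u = snd c q" by auto
    then show "f u = inv_into (fst c) (snd c) u" using fi inv_into_f_f[OF inj] by simp
  qed
qed

lemma chart_exists: assumes "q \<in> topspace X" obtains c where "c \<in> A" "q \<in> fst c"
  using manifold assms unfolding smooth_manifold_def by blast

lemma inv_chart: "c \<in> A \<Longrightarrow> q \<in> fst c \<Longrightarrow> inv_into (fst c) (snd c) (snd c q) = q"
  by (rule inv_into_f_f[OF chart(4)])

lemma transition:
  assumes "c \<in> A" "d \<in> A"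
  shows "open (chart_rep_dom c d id)" "smooth_on (chart_rep_dom c d id) (chart_rep c d id)"
proof -
  show "open (chart_rep_dom c d id)"
    by (rule open_chart_rep_dom[OF chart(1)[OF assms(1)] _ chart(2)[OF assms(2)] chart(5)[OF assms(1)]])
      (simp add: continuous_map_id[unfolded id_def] id_def)
  show "smooth_on (chart_rep_dom c d id) (chart_rep c d id)"
    using manifold assms unfolding smooth_manifold_def by blast
qed

lemma transition_has_derivative:
  assumes "c \<in> A" "d \<in> A" "q \<in> fst c" "q \<in> fst d"
  shows "(chart_rep c d id has_derivative chart_deriv c d id q) (at (snd c q))"
  unfolding chart_deriv_def
  by (rule smooth_on_open_has_derivative[OF transition(2)[OF assms(1,2)] _ transition(1)[OF assms(1,2)]])
    (use assms(3,4) in \<open>auto simp: chart_rep_dom_def\<close>)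

lemma transition_apply: "c \<in> A \<Longrightarrow> q \<in> fst c \<Longrightarrow> chart_rep c d id (snd c q) = snd d q"
  by (simp add: chart_rep_def inv_chart)

lemma G_bilinear: "c \<in> A \<Longrightarrow> q \<in> fst c \<Longrightarrow> bilinear (G c q)"
  using metric unfolding riemannian_metric_def by blast

lemma G_nonneg: "c \<in> A \<Longrightarrow> q \<in> fst c \<Longrightarrow> 0 \<le> G c q a a"
proof (cases "a = 0")
  case True
  assume "c \<in> A" "q \<in> fst c"
  then show ?thesis using True bilinear_lzero[OF G_bilinear] by simp
next
  case False
  assume "c \<in> A" "q \<in> fst c"
  then show ?thesis using False metric unfolding riemannian_metric_def by (simp add: less_imp_le)
qed

lemma G_transition:
  assumes "c \<in> A" "d \<in> A" "q \<in> fst c" "q \<in> fst d"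
  shows "G d q (chart_deriv c d id q a) (chart_deriv c d id q b) = G c q a b"
proof -
  have "preserves_metric A G id" using metric unfolding riemannian_metric_def by blast
  then show ?thesis using assms unfolding preserves_metric_def by simp
qed

lemma G_component_continuous:
  "c \<in> A \<Longrightarrow> continuous_on (snd c ` fst c) (\<lambda>u. G c (inv_into (fst c) (snd c) u) a b)"
  using metric unfolding riemannian_metric_def by (simp add: smooth_on_imp_continuous_on)

lemma G_expand:
  assumes "c \<in> A" "q \<in> fst c"
  shows "G c q a a = (\<Sum>i\<in>Basis. \<Sum>j\<in>Basis. (a \<bullet> i) * (a \<bullet> j) * G c q i j)"
proof -
  note b = G_bilinear[OF assms]
  have l1: "linear (\<lambda>x. G c q x y)" and l2: "linear (G c q x)" for x y
    using b unfolding bilinear_def by blast+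
  have "G c q a a = G c q (\<Sum>i\<in>Basis. (a \<bullet> i) *\<^sub>R i) (\<Sum>j\<in>Basis. (a \<bullet> j) *\<^sub>R j)"
    by (simp only: euclidean_representation)
  also have "\<dots> = (\<Sum>i\<in>Basis. (a \<bullet> i) *\<^sub>R G c q i (\<Sum>j\<in>Basis. (a \<bullet> j) *\<^sub>R j))"
    by (simp only: linear_sum[OF l1] linear_scale[OF l1])
  also have "\<dots> = (\<Sum>i\<in>Basis. (a \<bullet> i) *\<^sub>R (\<Sum>j\<in>Basis. (a \<bullet> j) *\<^sub>R G c q i j))"
    by (simp only: linear_sum[OF l2] linear_scale[OF l2])
  also have "\<dots> = (\<Sum>i\<in>Basis. \<Sum>j\<in>Basis. (a \<bullet> i) * (a \<bullet> j) * G c q i j)"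
    by (simp add: sum_distrib_left mult.assoc)
  finally show ?thesis .
qed

definition continuous_near :: "(real \<Rightarrow> 'p) \<Rightarrow> real \<Rightarrow> bool" where
  "continuous_near \<gamma> t \<longleftrightarrow> (\<forall>U. openin X U \<longrightarrow> \<gamma> t \<in> U \<longrightarrow> (\<exists>N. open N \<and> t \<in> N \<and> \<gamma> ` N \<subseteq> U))"

text \<open>This pointwise condition replaces the finite exceptional set of piecewise differentiable curves, so
  that curves can be reparametrized and joined by an argument at a single parameter.\<close>

definition regular :: "(real \<Rightarrow> 'p) \<Rightarrow> real \<Rightarrow> bool" where
  "regular \<gamma> t \<longleftrightarrow> \<gamma> t \<in> topspace X \<and> continuous_near \<gamma> t \<and>
     (\<forall>c\<in>A. \<gamma> t \<in> fst c \<longrightarrow> C1_near (snd c \<circ> \<gamma>) t)"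

lemma pathin_open:
  assumes "pathin X \<gamma>" "openin X U" shows "open {t \<in> {0<..<1}. \<gamma> t \<in> U}"
proof -
  have "openin (top_of_set {0..1}) {t \<in> {0..1}. \<gamma> t \<in> U}"
    using assms unfolding pathin_def continuous_map_def by simp
  then obtain T where T: "open T" "{t \<in> {0..1}. \<gamma> t \<in> U} = {0..1} \<inter> T" unfolding openin_open by blast
  have "\<gamma> t \<in> U \<longleftrightarrow> t \<in> T" if "t \<in> {0..1}" for t using T(2) that by blast
  then have "{t \<in> {0<..<1}. \<gamma> t \<in> U} = {0<..<1} \<inter> T" by fastforce
  then show ?thesis using T(1) by (simp add: open_Int)
qed

lemma pathin_topspace: "pathin X \<gamma> \<Longrightarrow> t \<in> {0..1} \<Longrightarrow> \<gamma> t \<in> topspace X"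
  unfolding pathin_def continuous_map_def by auto

lemma pathin_continuous_near:
  assumes "pathin X \<gamma>" "t \<in> {0<..<1}" shows "continuous_near \<gamma> t"
  unfolding continuous_near_def
proof (intro allI impI)
  fix U assume "openin X U" "\<gamma> t \<in> U"
  then show "\<exists>N. open N \<and> t \<in> N \<and> \<gamma> ` N \<subseteq> U"
    using pathin_open[OF assms(1)] assms(2) by (intro exI[of _ "{t \<in> {0<..<1}. \<gamma> t \<in> U}"]) auto
qed

lemma piecewise_C1_regular:
  "piecewise_C1_curve X A \<gamma> \<longleftrightarrow> pathin X \<gamma> \<and> (\<exists>S. finite S \<and> (\<forall>t\<in>{0<..<1} - S. regular \<gamma> t))"
proof
  assume \<gamma>: "piecewise_C1_curve X A \<gamma>"
  then have p: "pathin X \<gamma>" unfolding piecewise_C1_curve_def by blast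
  obtain S where S: "finite S"
    "\<forall>c\<in>A. (snd c \<circ> \<gamma>) C1_differentiable_on {t \<in> {0<..<1} - S. \<gamma> t \<in> fst c}"
    using \<gamma> unfolding piecewise_C1_curve_def by blast
  have "regular \<gamma> t" if t: "t \<in> {0<..<1} - S" for t
    unfolding regular_def
  proof (intro conjI ballI impI)
    show "\<gamma> t \<in> topspace X" using pathin_topspace[OF p] t by simp
    show "continuous_near \<gamma> t" using pathin_continuous_near[OF p] t by simp
    fix c assume c: "c \<in> A" "\<gamma> t \<in> fst c"
    have "{t \<in> {0<..<1} - S. \<gamma> t \<in> fst c} = {t \<in> {0<..<1}. \<gamma> t \<in> fst c} - S" by blast
    then have "open {t \<in> {0<..<1} - S. \<gamma> t \<in> fst c}"
      using pathin_open[OF p chart(2)[OF c(1)]] S(1) by (simp add: open_Diff finite_imp_closed)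
    then show "C1_near (snd c \<circ> \<gamma>) t"
      unfolding C1_near_def using S(2) c t
      by (intro exI[of _ "{t \<in> {0<..<1} - S. \<gamma> t \<in> fst c}"]) simp
  qed
  with p S(1) show "pathin X \<gamma> \<and> (\<exists>S. finite S \<and> (\<forall>t\<in>{0<..<1} - S. regular \<gamma> t))" by blast
next
  assume "pathin X \<gamma> \<and> (\<exists>S. finite S \<and> (\<forall>t\<in>{0<..<1} - S. regular \<gamma> t))"
  then obtain S where S: "pathin X \<gamma>" "finite S" "\<forall>t\<in>{0<..<1} - S. regular \<gamma> t" by blast
  have "(snd c \<circ> \<gamma>) C1_differentiable_on {t \<in> {0<..<1} - S. \<gamma> t \<in> fst c}" if "c \<in> A" for c
    by (rule C1_differentiable_on_local) (use S(3) that in \<open>auto simp: regular_def\<close>)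
  with S(1,2) show "piecewise_C1_curve X A \<gamma>" unfolding piecewise_C1_curve_def by blast
qed

abbreviation speed :: "(real \<Rightarrow> 'p) \<Rightarrow> real \<Rightarrow> real" where "speed \<equiv> curve_speed A G"

text \<open>By the transformation law, the chart that is selected in the definition of the speed does not
  matter.\<close>

lemma speed_eq:
  assumes c: "c \<in> A" "\<gamma> t \<in> fst c" and \<gamma>: "continuous_near \<gamma> t"
    and a: "((snd c \<circ> \<gamma>) has_vector_derivative a) (at t)"
  shows "speed \<gamma> t = sqrt (G c (\<gamma> t) a a)"
proof -
  define d where "d = (SOME d. d \<in> A \<and> \<gamma> t \<in> fst d)"
  have d: "d \<in> A" "\<gamma> t \<in> fst d"
    using someI_ex[of "\<lambda>d. d \<in> A \<and> \<gamma> t \<in> fst d"] c unfolding d_def by blast+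
  obtain N where N: "open N" "t \<in> N" "\<gamma> ` N \<subseteq> fst c"
    using \<gamma> chart(2)[OF c(1)] c(2) unfolding continuous_near_def by blast
  have "(chart_rep c d id has_derivative chart_deriv c d id (\<gamma> t)) (at ((snd c \<circ> \<gamma>) t))"
    using transition_has_derivative[OF c(1) d(1) c(2) d(2)] by simp
  then have "(chart_rep c d id \<circ> (snd c \<circ> \<gamma>) has_vector_derivative chart_deriv c d id (\<gamma> t) a) (at t)"
    by (intro vector_derivative_diff_chain_within[OF a has_derivative_at_withinI])
  then have "(snd d \<circ> \<gamma> has_vector_derivative chart_deriv c d id (\<gamma> t) a) (at t)"
  proof (rule has_vector_derivative_transform_within_open[OF _ N(1,2)])
    fix s assume "s \<in> N"
    then have "\<gamma> s \<in> fst c" using N(3) by blast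
    then show "(chart_rep c d id \<circ> (snd c \<circ> \<gamma>)) s = (snd d \<circ> \<gamma>) s"
      using transition_apply[OF c(1)] by simp
  qed
  then have "vector_derivative (snd d \<circ> \<gamma>) (at t) = chart_deriv c d id (\<gamma> t) a"
    by (rule vector_derivative_at)
  then show ?thesis
    unfolding curve_speed_def Let_def d_def[symmetric] using G_transition[OF c(1) d(1) c(2) d(2)] by simp
qed

lemma speed_regular:
  assumes "regular \<gamma> t" "c \<in> A" "\<gamma> t \<in> fst c"
  shows "speed \<gamma> t = sqrt (G c (\<gamma> t) (vector_derivative (snd c \<circ> \<gamma>) (at t)) (vector_derivative (snd c \<circ> \<gamma>) (at t)))"
    "((snd c \<circ> \<gamma>) has_vector_derivative vector_derivative (snd c \<circ> \<gamma>) (at t)) (at t)"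
proof -
  obtain N where "t \<in> N" "(snd c \<circ> \<gamma>) C1_differentiable_on N"
    using assms unfolding regular_def C1_near_def by blast
  then show d: "((snd c \<circ> \<gamma>) has_vector_derivative vector_derivative (snd c \<circ> \<gamma>) (at t)) (at t)"
    using C1_on_vector_derivative by blast
  show "speed \<gamma> t = sqrt (G c (\<gamma> t) (vector_derivative (snd c \<circ> \<gamma>) (at t)) (vector_derivative (snd c \<circ> \<gamma>) (at t)))"
    by (rule speed_eq[OF assms(2,3) _ d]) (use assms(1) in \<open>simp add: regular_def\<close>)
qed

lemma speed_nonneg: assumes "regular \<gamma> t" shows "0 \<le> speed \<gamma> t"
proof -
  have "\<gamma> t \<in> topspace X" using assms unfolding regular_def by blast
  then obtain c where c: "c \<in> A" "\<gamma> t \<in> fst c" by (rule chart_exists)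
  show ?thesis unfolding speed_regular(1)[OF assms c] using G_nonneg[OF c] by simp
qed

lemma regular_affine:
  assumes \<gamma>: "regular \<gamma> (m * t + b)"
    and N: "open N" "t \<in> N" "\<And>s. s \<in> N \<Longrightarrow> \<delta> s = \<gamma> (m * s + b)"
  shows "regular \<delta> t" "speed \<delta> t = \<bar>m\<bar> * speed \<gamma> (m * t + b)"
proof -
  have \<delta>t: "\<delta> t = \<gamma> (m * t + b)" using N by blast
  have cn: "continuous_near \<delta> t"
    unfolding continuous_near_def
  proof (intro allI impI)
    fix U assume "openin X U" "\<delta> t \<in> U"
    then obtain N' where N': "open N'" "m * t + b \<in> N'" "\<gamma> ` N' \<subseteq> U"
      using \<gamma> \<delta>t unfolding regular_def continuous_near_def by metis
    have "open ((\<lambda>s. m * s + b) -` N')" by (rule open_vimage[OF N'(1)]) (intro continuous_intros)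
    then have "open (N \<inter> (\<lambda>s. m * s + b) -` N')" using N(1) by blast
    moreover have "\<delta> ` (N \<inter> (\<lambda>s. m * s + b) -` N') \<subseteq> U" using N(3) N'(3) by auto
    ultimately show "\<exists>N. open N \<and> t \<in> N \<and> \<delta> ` N \<subseteq> U"
      using N(2) N'(2) by (intro exI[of _ "N \<inter> (\<lambda>s. m * s + b) -` N'"]) auto
  qed
  show reg: "regular \<delta> t"
    unfolding regular_def
  proof (intro conjI ballI impI cn)
    show "\<delta> t \<in> topspace X" using \<gamma> \<delta>t unfolding regular_def by simp
    fix c assume "c \<in> A" "\<delta> t \<in> fst c"
    then have "C1_near (snd c \<circ> \<gamma>) (m * t + b)" using \<gamma> \<delta>t unfolding regular_def by simp
    then have "C1_near (\<lambda>s. (snd c \<circ> \<gamma>) (m * s + b)) t" by (rule C1_near_affine)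
    then show "C1_near (snd c \<circ> \<delta>) t" by (rule C1_near_cong[OF _ N(1,2)]) (simp add: N(3))
  qed
  obtain c where c: "c \<in> A" "\<gamma> (m * t + b) \<in> fst c"
    using chart_exists \<gamma> unfolding regular_def by metis
  let ?D = "vector_derivative (snd c \<circ> \<gamma>) (at (m * t + b))"
  note sp = speed_regular[OF \<gamma> c]
  have "((\<lambda>s. (snd c \<circ> \<gamma>) (m * s + b)) has_vector_derivative m *\<^sub>R ?D) (at t)"
    by (rule has_vector_derivative_affine[OF sp(2)])
  then have "((snd c \<circ> \<delta>) has_vector_derivative m *\<^sub>R ?D) (at t)"
    by (rule has_vector_derivative_transform_within_open[OF _ N(1,2)]) (simp add: N(3))
  then have "speed \<delta> t = sqrt (G c (\<delta> t) (m *\<^sub>R ?D) (m *\<^sub>R ?D))"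
    by (intro speed_eq cn) (use c \<delta>t in auto)
  also have "\<dots> = sqrt (m\<^sup>2 * G c (\<gamma> (m * t + b)) ?D ?D)"
    by (simp add: \<delta>t bilinear_lmul[OF G_bilinear[OF c]] bilinear_rmul[OF G_bilinear[OF c]] power2_eq_square)
  also have "\<dots> = \<bar>m\<bar> * speed \<gamma> (m * t + b)" unfolding sp(1) by (simp add: real_sqrt_mult)
  finally show "speed \<delta> t = \<bar>m\<bar> * speed \<gamma> (m * t + b)" .
qed

lemma speed_continuous:
  assumes "regular \<gamma> t" shows "isCont (speed \<gamma>) t"
proof -
  obtain c where c: "c \<in> A" "\<gamma> t \<in> fst c" using chart_exists assms unfolding regular_def by metis
  obtain N1 where N1: "open N1" "t \<in> N1" "\<gamma> ` N1 \<subseteq> fst c"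
    using assms chart(2)[OF c(1)] c(2) unfolding regular_def continuous_near_def by metis
  obtain N2 where N2: "open N2" "t \<in> N2" "(snd c \<circ> \<gamma>) C1_differentiable_on N2"
    using assms c unfolding regular_def C1_near_def by metis
  let ?N = "N1 \<inter> N2" and ?D = "\<lambda>s. vector_derivative (snd c \<circ> \<gamma>) (at s)"
  have d: "((snd c \<circ> \<gamma>) has_vector_derivative ?D s) (at s)" if "s \<in> N2" for s
    by (rule C1_on_vector_derivative[OF N2(3) that])
  have cc: "continuous_on ?N (snd c \<circ> \<gamma>)"
    by (rule continuous_at_imp_continuous_on, rule ballI, rule has_vector_derivative_continuous, rule d) simp
  have cn: "continuous_near \<gamma> s" if s: "s \<in> ?N" for s
    unfolding continuous_near_def
  proof (intro allI impI)
    fix U assume U: "openin X U" "\<gamma> s \<in> U"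
    have op: "open (snd c ` (fst c \<inter> U))" by (rule open_chart_image[OF chart(1)[OF c(1)] U(1)])
    have "open (?N \<inter> (snd c \<circ> \<gamma>) -` (snd c ` (fst c \<inter> U)))"
      by (rule continuous_open_preimage[OF cc _ op]) (use N1 N2 in blast)
    moreover have "s \<in> ?N \<inter> (snd c \<circ> \<gamma>) -` (snd c ` (fst c \<inter> U))" using s U(2) N1(3) by auto
    moreover have "\<gamma> r \<in> U" if r: "r \<in> ?N \<inter> (snd c \<circ> \<gamma>) -` (snd c ` (fst c \<inter> U))" for r
    proof -
      from r obtain q where q: "q \<in> fst c" "q \<in> U" "snd c (\<gamma> r) = snd c q" by auto
      have "\<gamma> r \<in> fst c" using r N1(3) by blast
      then have "\<gamma> r = q" using inj_onD[OF chart(4)[OF c(1)] q(3)] q(1) by blast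
      then show ?thesis using q(2) by simp
    qed
    ultimately show "\<exists>N. open N \<and> s \<in> N \<and> \<gamma> ` N \<subseteq> U" by blast
  qed
  have eq: "speed \<gamma> s = sqrt (\<Sum>i\<in>Basis. \<Sum>j\<in>Basis. (?D s \<bullet> i) * (?D s \<bullet> j) *
      G c (inv_into (fst c) (snd c) ((snd c \<circ> \<gamma>) s)) i j)" if s: "s \<in> ?N" for s
  proof -
    have sc: "\<gamma> s \<in> fst c" using s N1(3) by blast
    have "speed \<gamma> s = sqrt (G c (\<gamma> s) (?D s) (?D s))"
      by (rule speed_eq[OF c(1) sc cn[OF s] d]) (use s in simp)
    then show ?thesis using G_expand[OF c(1) sc] inv_chart[OF c(1) sc] by simp
  qed
  have img: "(snd c \<circ> \<gamma>) ` ?N \<subseteq> snd c ` fst c" using N1(3) by auto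
  have "continuous_on ?N (\<lambda>s. sqrt (\<Sum>i\<in>Basis. \<Sum>j\<in>Basis. (?D s \<bullet> i) * (?D s \<bullet> j) *
      G c (inv_into (fst c) (snd c) ((snd c \<circ> \<gamma>) s)) i j))"
    by (intro continuous_intros continuous_on_subset[OF C1_on_continuous_derivative[OF N2(3)]]
        continuous_on_compose2[OF G_component_continuous[OF c(1)] cc img]) auto
  then have "continuous_on ?N (speed \<gamma>)" by (rule continuous_on_eq) (simp add: eq)
  then show ?thesis using N1(1,2) N2(1,2) by (simp add: continuous_on_eq_continuous_at open_Int)
qed

lemma curve_length_regular:
  assumes "finite S" "\<forall>t\<in>{0<..<1} - S. regular \<gamma> t"
  defines "F \<equiv> \<lambda>t. indicat_real ({0<..<1} - S) t * speed \<gamma> t"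
  shows "F \<in> borel_measurable borel" "\<And>t. 0 \<le> F t" "curve_length A G \<gamma> = (\<integral>\<^sup>+t. ennreal (F t) \<partial>lborel)"
proof -
  have "open ({0<..<1} - S)" using assms(1) by (simp add: open_Diff finite_imp_closed)
  then have "(\<lambda>t. indicat_real ({0<..<1} - S) t *\<^sub>R speed \<gamma> t) \<in> borel_measurable borel"
    by (intro borel_measurable_continuous_on_indicator continuous_at_imp_continuous_on ballI
        speed_continuous assms(2)[rule_format]) auto
  then show "F \<in> borel_measurable borel" unfolding F_def by simp
  show "0 \<le> F t" for t unfolding F_def using speed_nonneg assms(2) by (simp add: indicator_def)
  have "AE t in lborel. t \<notin> insert 0 (insert 1 S)"
    using assms(1) by (intro AE_lborel_notin_finite) simp
  then show "curve_length A G \<gamma> = (\<integral>\<^sup>+t. ennreal (F t) \<partial>lborel)"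
    unfolding curve_length_def
  proof (intro nn_integral_cong_AE, eventually_elim)
    case (elim t)
    then show ?case unfolding F_def by (auto simp: indicator_def)
  qed
qed

text \<open>Reversing a curve and joining two curves are affine changes of the parameter. The following
  change of variables shows that they do not change the contribution of a piece to the length.\<close>

lemma nn_integral_affine_speed:
  assumes "F \<in> borel_measurable borel" "m \<noteq> 0"
  shows "(\<integral>\<^sup>+t. ennreal \<bar>m\<bar> * ennreal (F (m * t + b)) \<partial>lborel) = (\<integral>\<^sup>+t. ennreal (F t) \<partial>lborel)"
proof -
  have "(\<lambda>t. ennreal (F t)) \<in> borel_measurable borel" using assms(1) by measurable
  from nn_integral_real_affine[OF this assms(2), of b]
  have "(\<integral>\<^sup>+t. ennreal (F t) \<partial>lborel) = ennreal \<bar>m\<bar> * (\<integral>\<^sup>+t. ennreal (F (b + m * t)) \<partial>lborel)" .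
  moreover have "(\<lambda>t. ennreal (F (b + m * t))) \<in> borel_measurable lborel" using assms(1) by measurable
  ultimately show ?thesis by (simp add: nn_integral_cmult add.commute)
qed

text \<open>The triangle inequality is proved for the infimum with values in the extended half-line, because the
  conversion to a real number is only harmless when a curve of finite length is known to exist.\<close>

definition len_inf :: "'p \<Rightarrow> 'p \<Rightarrow> ennreal" where
  "len_inf q r = (INF \<gamma>\<in>{\<gamma>. piecewise_C1_curve X A \<gamma> \<and> \<gamma> 0 = q \<and> \<gamma> 1 = r}. curve_length A G \<gamma>)"

abbreviation rdist :: "'p \<Rightarrow> 'p \<Rightarrow> real" where "rdist \<equiv> riemannian_dist X A G"

lemma rdist_eq: "rdist q r = enn2real (len_inf q r)"
  unfolding riemannian_dist_def len_inf_def ..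

lemma len_inf_le: "piecewise_C1_curve X A \<gamma> \<Longrightarrow> \<gamma> 0 = q \<Longrightarrow> \<gamma> 1 = r \<Longrightarrow> len_inf q r \<le> curve_length A G \<gamma>"
  unfolding len_inf_def by (rule INF_lower) simp

lemma len_inf_refl:
  assumes "q \<in> topspace X" shows "len_inf q q = 0"
proof -
  let ?\<gamma> = "\<lambda>t::real. q"
  have cn: "continuous_near ?\<gamma> t" for t unfolding continuous_near_def by (auto intro: exI[of _ UNIV])
  have C1: "C1_near (snd c \<circ> ?\<gamma>) t" for c t
    unfolding C1_near_def C1_differentiable_on_def
    by (rule exI[of _ UNIV]) (auto intro!: exI[of _ "\<lambda>_. 0"] simp: o_def)
  have reg: "regular ?\<gamma> t" for t unfolding regular_def using assms cn C1 by blast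
  have pw: "piecewise_C1_curve X A ?\<gamma>"
    unfolding piecewise_C1_regular using reg assms
    by (intro conjI exI[of _ "{}"]) (auto simp: pathin_def)
  obtain c where c: "c \<in> A" "q \<in> fst c" using chart_exists[OF assms] .
  have "speed ?\<gamma> t = sqrt (G c q 0 0)" for t
    by (rule speed_eq[OF c cn]) (simp add: o_def)
  then have "speed ?\<gamma> t = 0" for t using bilinear_lzero[OF G_bilinear[OF c]] by simp
  then have "curve_length A G ?\<gamma> = 0" unfolding curve_length_def by simp
  then show ?thesis using len_inf_le[OF pw] by simp
qed

lemma len_inf_sym_le: "len_inf r q \<le> len_inf q r"
  unfolding len_inf_def[of q r]
proof (rule INF_greatest, clarify)
  fix \<gamma> assume \<gamma>: "piecewise_C1_curve X A \<gamma>" "q = \<gamma> 0" "r = \<gamma> 1"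
  then obtain S where S: "finite S" "\<And>t. t \<in> {0<..<1} - S \<Longrightarrow> regular \<gamma> t" and p: "pathin X \<gamma>"
    unfolding piecewise_C1_regular by blast
  let ?\<delta> = "\<lambda>t. \<gamma> (1 - t)" and ?S = "(\<lambda>t. 1 - t) ` S"
  have aff: "regular ?\<delta> t" "speed ?\<delta> t = speed \<gamma> (1 - t)" if "t \<in> {0<..<1} - ?S" for t
  proof -
    have "1 - t \<in> {0<..<1} - S" using that by (auto simp: image_iff)
    then have "regular \<gamma> (- 1 * t + 1)" using S(2) by (simp add: add.commute)
    from regular_affine[OF this open_UNIV, of ?\<delta>]
    show "regular ?\<delta> t" "speed ?\<delta> t = speed \<gamma> (1 - t)" by simp_all
  qed
  have "continuous_map (top_of_set {0..1}) (top_of_set {0..1}) (\<lambda>t::real. 1 - t)"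
    by (auto intro!: continuous_intros)
  from continuous_map_compose[OF this] p have "pathin X ?\<delta>" unfolding pathin_def by (simp add: o_def)
  then have pw: "piecewise_C1_curve X A ?\<delta>"
    unfolding piecewise_C1_regular using aff(1) S(1) by blast
  let ?F = "\<lambda>t. indicat_real ({0<..<1} - S) t * speed \<gamma> t"
  have "\<forall>t\<in>{0<..<1} - S. regular \<gamma> t" using S(2) by blast
  note F = curve_length_regular[OF S(1) this]
  have "AE t in lborel. t \<notin> insert 0 (insert 1 ?S)" using S(1) by (intro AE_lborel_notin_finite) simp
  then have "curve_length A G ?\<delta> \<le> (\<integral>\<^sup>+t. ennreal \<bar>- 1\<bar> * ennreal (?F (- 1 * t + 1)) \<partial>lborel)"
    unfolding curve_length_def
  proof (intro nn_integral_mono_AE, eventually_elim)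
    case (elim t)
    show ?case
    proof (cases "t \<in> {0..1}")
      case True
      then have t: "t \<in> {0<..<1} - ?S" using elim by auto
      then have "1 - t \<in> {0<..<1} - S" by (auto simp: image_iff)
      then show ?thesis using aff(2)[OF t] t by (simp add: indicator_def)
    qed simp
  qed
  also have "\<dots> = curve_length A G \<gamma>"
    unfolding F(3) by (rule nn_integral_affine_speed[OF F(1)]) simp
  finally show "len_inf (\<gamma> 1) (\<gamma> 0) \<le> curve_length A G \<gamma>"
    using len_inf_le[OF pw, of "\<gamma> 1" "\<gamma> 0"] by simp
qed

lemma len_inf_join:
  assumes "piecewise_C1_curve X A \<gamma>1" "piecewise_C1_curve X A \<gamma>2" "\<gamma>1 1 = \<gamma>2 0"
  shows "len_inf (\<gamma>1 0) (\<gamma>2 1) \<le> curve_length A G \<gamma>1 + curve_length A G \<gamma>2"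
proof -
  obtain S1 where S1: "finite S1" "\<And>t. t \<in> {0<..<1} - S1 \<Longrightarrow> regular \<gamma>1 t" and p1: "pathin X \<gamma>1"
    using assms(1) unfolding piecewise_C1_regular by blast
  obtain S2 where S2: "finite S2" "\<And>t. t \<in> {0<..<1} - S2 \<Longrightarrow> regular \<gamma>2 t" and p2: "pathin X \<gamma>2"
    using assms(2) unfolding piecewise_C1_regular by blast
  define \<delta> where "\<delta> t = (if t \<le> 1/2 then \<gamma>1 (2 * t) else \<gamma>2 (2 * t - 1))" for t :: real
  define E where "E = insert (1/2) ((\<lambda>t. t / 2) ` S1 \<union> (\<lambda>t. (t + 1) / 2) ` S2)"
  have E: "finite E" unfolding E_def using S1(1) S2(1) by simp
  have first: "2 * t + 0 \<in> {0<..<1} - S1" if "t \<in> {0<..<1/2} - E" for t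
  proof -
    have "2 * t \<notin> S1"
    proof
      assume "2 * t \<in> S1"
      then have "2 * t / 2 \<in> E" unfolding E_def by blast
      then show False using that by simp
    qed
    then show ?thesis using that by auto
  qed
  have second: "2 * t + - 1 \<in> {0<..<1} - S2" if "t \<in> {1/2<..<1} - E" for t
  proof -
    have "2 * t - 1 \<notin> S2"
    proof
      assume "2 * t - 1 \<in> S2"
      then have "(2 * t - 1 + 1) / 2 \<in> E" unfolding E_def by blast
      then show False using that by simp
    qed
    then show ?thesis using that by auto
  qed
  have aff1: "regular \<delta> t" "speed \<delta> t = 2 * speed \<gamma>1 (2 * t + 0)" if "t \<in> {0<..<1/2} - E" for t
    using regular_affine[OF S1(2)[OF first[OF that]], of "{0<..<1/2}" \<delta>] that by (auto simp: \<delta>_def)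
  have aff2: "regular \<delta> t" "speed \<delta> t = 2 * speed \<gamma>2 (2 * t + - 1)" if "t \<in> {1/2<..<1} - E" for t
    using regular_affine[OF S2(2)[OF second[OF that]], of "{1/2<..<1}" \<delta>] that by (auto simp: \<delta>_def)
  have split: "t \<in> {0<..<1/2} - E \<or> t \<in> {1/2<..<1} - E" if "t \<in> {0<..<1} - E" for t
    using that unfolding E_def by (auto simp: less_le)
  have "pathin X \<delta>"
    unfolding pathin_def \<delta>_def
  proof (rule continuous_map_cases_le)
    have eq1: "subtopology (top_of_set {0..1}) {x \<in> topspace (top_of_set {0..1}). x \<le> 1/2} =
        top_of_set {t \<in> {0..1}. t \<le> (1/2 :: real)}"
      and eq2: "subtopology (top_of_set {0..1}) {x \<in> topspace (top_of_set {0..1}). 1/2 \<le> x} =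
        top_of_set {t \<in> {0..1}. (1/2 :: real) \<le> t}"
      unfolding subtopology_subtopology topspace_euclidean_subtopology
      by (rule arg_cong[of _ _ "subtopology euclidean"], auto)+
    have h1: "continuous_map (top_of_set {t \<in> {0..1}. t \<le> 1/2}) (top_of_set {0..1}) (\<lambda>t::real. 2 * t)"
      by (auto intro!: continuous_intros)
    have h2: "continuous_map (top_of_set {t \<in> {0..1}. 1/2 \<le> t}) (top_of_set {0..1}) (\<lambda>t::real. 2 * t - 1)"
      by (auto intro!: continuous_intros)
    show "continuous_map (subtopology (top_of_set {0..1}) {x \<in> topspace (top_of_set {0..1}). x \<le> 1/2}) X (\<lambda>t. \<gamma>1 (2 * t))"
      unfolding eq1 using continuous_map_compose[OF h1 p1[unfolded pathin_def]]
      by (simp add: o_def)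
    show "continuous_map (subtopology (top_of_set {0..1}) {x \<in> topspace (top_of_set {0..1}). 1/2 \<le> x}) X (\<lambda>t. \<gamma>2 (2 * t - 1))"
      unfolding eq2 using continuous_map_compose[OF h2 p2[unfolded pathin_def]]
      by (simp add: o_def)
    fix x :: real assume "x = 1/2"
    then have "2 * x = 1" "2 * x - 1 = 0" by simp_all
    then show "\<gamma>1 (2 * x) = \<gamma>2 (2 * x - 1)" using assms(3) by (simp only:)
  qed (auto intro!: continuous_intros)
  then have pw: "piecewise_C1_curve X A \<delta>"
    unfolding piecewise_C1_regular using E aff1(1) aff2(1) split by blast
  let ?F1 = "\<lambda>t. indicat_real ({0<..<1} - S1) t * speed \<gamma>1 t"
  let ?F2 = "\<lambda>t. indicat_real ({0<..<1} - S2) t * speed \<gamma>2 t"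
  have "\<forall>t\<in>{0<..<1} - S1. regular \<gamma>1 t" using S1(2) by blast
  note F1 = curve_length_regular[OF S1(1) this]
  have "\<forall>t\<in>{0<..<1} - S2. regular \<gamma>2 t" using S2(2) by blast
  note F2 = curve_length_regular[OF S2(1) this]
  let ?g1 = "\<lambda>t. ennreal \<bar>2\<bar> * ennreal (?F1 (2 * t + 0))"
  let ?g2 = "\<lambda>t. ennreal \<bar>2\<bar> * ennreal (?F2 (2 * t + - 1))"
  have "AE t in lborel. t \<notin> insert 0 (insert 1 E)" using E by (intro AE_lborel_notin_finite) simp
  then have "curve_length A G \<delta> \<le> (\<integral>\<^sup>+t. ?g1 t + ?g2 t \<partial>lborel)"
    unfolding curve_length_def
  proof (intro nn_integral_mono_AE, eventually_elim)
    case (elim t)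
    show ?case
    proof (cases "t \<in> {0..1}")
      case True
      then have "t \<in> {0<..<1} - E" using elim by auto
      then show ?thesis
      proof (rule split[THEN disjE])
        assume t: "t \<in> {0<..<1/2} - E"
        have "ennreal (speed \<delta> t) = ?g1 t"
          using aff1(2)[OF t] first[OF t] by (simp add: ennreal_mult' indicator_def)
        then show ?thesis using True by (simp add: indicator_def)
      next
        assume t: "t \<in> {1/2<..<1} - E"
        have "ennreal (speed \<delta> t) = ?g2 t"
          using aff2(2)[OF t] second[OF t] by (simp add: ennreal_mult' indicator_def)
        then show ?thesis using True by (simp add: indicator_def)
      qed
    qed simp
  qed
  also have "\<dots> = (\<integral>\<^sup>+t. ?g1 t \<partial>lborel) + (\<integral>\<^sup>+t. ?g2 t \<partial>lborel)"
  proof (rule nn_integral_add)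
    have "(\<lambda>t. ?F1 (2 * t + 0)) \<in> borel_measurable borel"
      by (rule measurable_compose[OF _ F1(1)]) simp
    then show "?g1 \<in> borel_measurable lborel" by simp
    have "(\<lambda>t. ?F2 (2 * t + - 1)) \<in> borel_measurable borel"
      by (rule measurable_compose[OF _ F2(1)]) simp
    then show "?g2 \<in> borel_measurable lborel" by simp
  qed
  also have "(\<integral>\<^sup>+t. ?g1 t \<partial>lborel) = curve_length A G \<gamma>1"
    unfolding F1(3) by (rule nn_integral_affine_speed[OF F1(1)]) simp
  also have "(\<integral>\<^sup>+t. ?g2 t \<partial>lborel) = curve_length A G \<gamma>2"
    unfolding F2(3) by (rule nn_integral_affine_speed[OF F2(1)]) simp
  finally have "curve_length A G \<delta> \<le> curve_length A G \<gamma>1 + curve_length A G \<gamma>2" .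
  moreover have "len_inf (\<gamma>1 0) (\<gamma>2 1) \<le> curve_length A G \<delta>"
    by (rule len_inf_le[OF pw]) (simp_all add: \<delta>_def)
  ultimately show ?thesis by (rule order.trans[rotated])
qed

lemma len_inf_triangle: "len_inf q s \<le> len_inf q r + len_inf r s"
proof (rule ennreal_le_epsilon)
  fix e :: real assume fin: "len_inf q r + len_inf r s < top" and e: "0 < e"
  have "len_inf q r < len_inf q r + ennreal (e/2)" "len_inf r s < len_inf r s + ennreal (e/2)"
    using fin e ennreal_add_left_cancel_less[of "len_inf q r" 0 "ennreal (e/2)"]
      ennreal_add_left_cancel_less[of "len_inf r s" 0 "ennreal (e/2)"] by (auto simp: less_top)
  then obtain \<gamma>1 \<gamma>2 where \<gamma>1: "piecewise_C1_curve X A \<gamma>1" "\<gamma>1 0 = q" "\<gamma>1 1 = r"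
      "curve_length A G \<gamma>1 < len_inf q r + ennreal (e/2)"
    and \<gamma>2: "piecewise_C1_curve X A \<gamma>2" "\<gamma>2 0 = r" "\<gamma>2 1 = s"
      "curve_length A G \<gamma>2 < len_inf r s + ennreal (e/2)"
    unfolding len_inf_def INF_less_iff by auto
  have "len_inf q s \<le> curve_length A G \<gamma>1 + curve_length A G \<gamma>2"
    using len_inf_join[OF \<gamma>1(1) \<gamma>2(1)] \<gamma>1 \<gamma>2 by simp
  also have "\<dots> \<le> (len_inf q r + ennreal (e/2)) + (len_inf r s + ennreal (e/2))"
    using \<gamma>1(4) \<gamma>2(4) by (intro add_mono) auto
  also have "\<dots> = len_inf q r + len_inf r s + (ennreal (e/2) + ennreal (e/2))"
    by (simp add: ac_simps)
  also have "ennreal (e/2) + ennreal (e/2) = ennreal e"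
    using e by (simp flip: ennreal_plus)
  finally show "len_inf q s \<le> len_inf q r + len_inf r s + ennreal e" .
qed

lemma len_inf_sym: "len_inf q r = len_inf r q"
  by (rule antisym) (rule len_inf_sym_le)+

lemma gradient_bounded_along_curve:
  fixes h :: "'p \<Rightarrow> 'b::euclidean_space"
  assumes h: "gradient_bounded X A G C h" and t: "regular \<gamma> t"
  obtains k where "((\<lambda>t. h (\<gamma> t)) has_vector_derivative k) (at t)" "norm k \<le> C * speed \<gamma> t"
proof -
  have "\<gamma> t \<in> topspace X" using t unfolding regular_def by blast
  then obtain c E where c: "c \<in> A" "\<gamma> t \<in> fst c"
    and E: "((\<lambda>u. h (inv_into (fst c) (snd c) u)) has_derivative E) (at (snd c (\<gamma> t)))"
      "\<And>a. norm (E a) \<le> C * sqrt (G c (\<gamma> t) a a)"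
    using h unfolding gradient_bounded_def by blast
  note sp = speed_regular[OF t c]
  let ?D = "vector_derivative (snd c \<circ> \<gamma>) (at t)"
  obtain N where N: "open N" "t \<in> N" "\<gamma> ` N \<subseteq> fst c"
    using t chart(2)[OF c(1)] c(2) unfolding regular_def continuous_near_def by metis
  have E': "((\<lambda>u. h (inv_into (fst c) (snd c) u)) has_derivative E) (at ((snd c \<circ> \<gamma>) t))"
    using E(1) by simp
  have "((\<lambda>u. h (inv_into (fst c) (snd c) u)) \<circ> (snd c \<circ> \<gamma>) has_vector_derivative E ?D) (at t)"
    by (rule vector_derivative_diff_chain_within[OF sp(2) has_derivative_at_withinI[OF E']])
  then have "((\<lambda>t. h (\<gamma> t)) has_vector_derivative E ?D) (at t)"
  proof (rule has_vector_derivative_transform_within_open[OF _ N(1,2)])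
    fix s assume "s \<in> N"
    then have "\<gamma> s \<in> fst c" using N(3) by blast
    then show "((\<lambda>u. h (inv_into (fst c) (snd c) u)) \<circ> (snd c \<circ> \<gamma>)) s = h (\<gamma> s)"
      using inv_chart[OF c(1)] by simp
  qed
  moreover have "norm (E ?D) \<le> C * speed \<gamma> t" unfolding sp(1) by (rule E(2))
  ultimately show thesis by (rule that)
qed

text \<open>The increment of h along the curve is the integral of the derivative, which is at most C times
  the speed.\<close>

lemma gradient_bounded_curve_length:
  fixes h :: "'p \<Rightarrow> 'b::euclidean_space"
  assumes h: "gradient_bounded X A G C h" and \<gamma>: "piecewise_C1_curve X A \<gamma>"
  shows "ennreal (norm (h (\<gamma> 1) - h (\<gamma> 0)) / C) \<le> curve_length A G \<gamma>"
proof (cases "curve_length A G \<gamma> = top")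
  case False
  have C: "C > 0" and hc: "continuous_map X euclidean h" using h unfolding gradient_bounded_def by blast+
  obtain S where S: "finite S" "\<And>t. t \<in> {0<..<1} - S \<Longrightarrow> regular \<gamma> t" and p: "pathin X \<gamma>"
    using \<gamma> unfolding piecewise_C1_regular by blast
  define F where "F t = indicat_real ({0<..<1} - S) t * speed \<gamma> t" for t
  have F: "F \<in> borel_measurable borel" "\<And>t. 0 \<le> F t"
    "curve_length A G \<gamma> = (\<integral>\<^sup>+t. ennreal (F t) \<partial>lborel)"
    unfolding F_def[abs_def] by (rule curve_length_regular[OF S(1)], use S(2) in blast)+
  have int: "integrable lborel F"
    by (rule integrableI_nonneg) (use F False in \<open>auto simp: less_top\<close>)
  define I where "I = integral\<^sup>L lborel F"
  have LI: "curve_length A G \<gamma> = ennreal I"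
    unfolding F(3) I_def by (rule nn_integral_eq_integral[OF int]) (simp add: F(2))
  have "(F has_integral I) UNIV" unfolding I_def by (rule has_integral_integral_lborel[OF int])
  moreover have "F t = (if t \<in> {0..1} then F t else 0)" for t
    by (auto simp: F_def indicator_def)
  ultimately have "((\<lambda>t. if t \<in> {0..1} then F t else 0) has_integral I) UNIV"
    by (rule has_integral_eq[rotated])
  then have FI: "(F has_integral I) {0..1}" unfolding has_integral_restrict_UNIV .
  define k where "k t = (if t \<in> {0<..<1} - S then vector_derivative (\<lambda>t. h (\<gamma> t)) (at t) else 0)" for t
  have k: "((\<lambda>t. h (\<gamma> t)) has_vector_derivative k t) (at t)" "norm (k t) \<le> C * F t"
    if t: "t \<in> {0<..<1} - S" for t
  proof -
    obtain k' where k': "((\<lambda>t. h (\<gamma> t)) has_vector_derivative k') (at t)" "norm k' \<le> C * speed \<gamma> t"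
      using gradient_bounded_along_curve[OF h S(2)[OF t]] .
    have "k t = k'" unfolding k_def using t vector_derivative_at[OF k'(1)] by simp
    then show "((\<lambda>t. h (\<gamma> t)) has_vector_derivative k t) (at t)" "norm (k t) \<le> C * F t"
      using k' t by (simp_all add: F_def)
  qed
  have "continuous_on {0..1} (\<lambda>t. h (\<gamma> t))"
    using continuous_map_compose[OF p[unfolded pathin_def] hc] by (simp add: o_def)
  then have kI: "(k has_integral (h (\<gamma> 1) - h (\<gamma> 0))) {0..1}"
    by (intro fundamental_theorem_of_calculus_interior_strong[OF S(1)] k(1)) auto
  have CF: "((\<lambda>t. C * F t) has_integral (C * I)) {0..1}" by (rule has_integral_mult_right[OF FI])
  have "norm (integral {0..1} k) \<le> integral {0..1} (\<lambda>t. C * F t)"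
  proof (rule integral_norm_bound_integral)
    show "k integrable_on {0..1}" "(\<lambda>t. C * F t) integrable_on {0..1}"
      using kI CF by (auto simp: integrable_on_def)
    show "norm (k t) \<le> C * F t" for t
      using k(2)[of t] C F(2)[of t] by (cases "t \<in> {0<..<1} - S") (auto simp: k_def)
  qed
  then have "norm (h (\<gamma> 1) - h (\<gamma> 0)) \<le> C * I"
    unfolding integral_unique[OF kI] integral_unique[OF CF] .
  then have "norm (h (\<gamma> 1) - h (\<gamma> 0)) / C \<le> I" using C by (simp add: field_simps)
  then show ?thesis unfolding LI by (rule ennreal_leI)
qed simp

lemma gradient_bounded_len_inf:
  fixes h :: "'p \<Rightarrow> 'b::euclidean_space"
  assumes h: "gradient_bounded X A G C h"
  shows "ennreal (norm (h r - h q) / C) \<le> len_inf q r"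
  unfolding len_inf_def
proof (rule INF_greatest, clarify)
  fix \<gamma> assume "piecewise_C1_curve X A \<gamma>"
  then show "ennreal (norm (h (\<gamma> 1) - h (\<gamma> 0)) / C) \<le> curve_length A G \<gamma>"
    by (rule gradient_bounded_curve_length[OF h])
qed

text \<open>Upper bounds for the distance come from straight segments in charts.\<close>

lemma G_locally_bounded:
  assumes c: "c \<in> A" and K: "compact K" "K \<subseteq> snd c ` fst c"
  obtains B where "B \<ge> 0" "\<And>u a. u \<in> K \<Longrightarrow> sqrt (G c (inv_into (fst c) (snd c) u) a a) \<le> B * norm a"
proof -
  define m where "m u = (\<Sum>i\<in>Basis. \<Sum>j\<in>Basis. \<bar>G c (inv_into (fst c) (snd c) u) i j\<bar>)" for u
  have "continuous_on K m" unfolding m_def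
    by (intro continuous_intros continuous_on_subset[OF G_component_continuous[OF c] K(2)])
  then have "compact (m ` K)" by (rule compact_continuous_image[OF _ K(1)])
  then have "bounded (m ` K)" by (rule compact_imp_bounded)
  then obtain B where B: "\<And>u. u \<in> K \<Longrightarrow> \<bar>m u\<bar> \<le> B" unfolding bounded_iff by auto
  have "sqrt (G c (inv_into (fst c) (snd c) u) a a) \<le> sqrt \<bar>B\<bar> * norm a" if u: "u \<in> K" for u a
  proof -
    have q: "inv_into (fst c) (snd c) u \<in> fst c" using u K(2) by (blast intro: inv_into_into)
    have "G c (inv_into (fst c) (snd c) u) a a
        \<le> (\<Sum>i\<in>Basis. \<Sum>j\<in>Basis. (norm a)\<^sup>2 * \<bar>G c (inv_into (fst c) (snd c) u) i j\<bar>)"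
      unfolding G_expand[OF c q]
    proof (intro sum_mono)
      fix i j :: 'e assume ij: "i \<in> Basis" "j \<in> Basis"
      have "(a \<bullet> i) * (a \<bullet> j) * G c (inv_into (fst c) (snd c) u) i j
          \<le> \<bar>a \<bullet> i\<bar> * \<bar>a \<bullet> j\<bar> * \<bar>G c (inv_into (fst c) (snd c) u) i j\<bar>"
        by (metis abs_ge_self abs_mult)
      also have "\<dots> \<le> norm a * norm a * \<bar>G c (inv_into (fst c) (snd c) u) i j\<bar>"
        using Basis_le_norm[OF ij(1), of a] Basis_le_norm[OF ij(2), of a]
        by (intro mult_right_mono mult_mono) auto
      finally show "(a \<bullet> i) * (a \<bullet> j) * G c (inv_into (fst c) (snd c) u) i j
          \<le> (norm a)\<^sup>2 * \<bar>G c (inv_into (fst c) (snd c) u) i j\<bar>"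
        by (simp add: power2_eq_square)
    qed
    also have "\<dots> = (norm a)\<^sup>2 * m u" unfolding m_def by (simp add: sum_distrib_left)
    also have "\<dots> \<le> (norm a)\<^sup>2 * \<bar>B\<bar>" using B[OF u] by (intro mult_left_mono) auto
    finally have "sqrt (G c (inv_into (fst c) (snd c) u) a a) \<le> sqrt ((norm a)\<^sup>2 * \<bar>B\<bar>)"
      by (rule real_sqrt_le_mono)
    then show ?thesis by (simp add: real_sqrt_mult mult.commute)
  qed
  then show thesis by (intro that[of "sqrt \<bar>B\<bar>"]) auto
qed

lemma len_inf_segment:
  assumes c: "c \<in> A" "q \<in> fst c" and r: "ball (snd c q) r \<subseteq> snd c ` fst c"
    and B: "\<And>u a. u \<in> ball (snd c q) r \<Longrightarrow> sqrt (G c (inv_into (fst c) (snd c) u) a a) \<le> B * norm a"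
    and u: "u \<in> ball (snd c q) r"
  shows "len_inf q (inv_into (fst c) (snd c) u) \<le> ennreal (B * norm (u - snd c q))"
proof -
  let ?l = "\<lambda>t. snd c q + t *\<^sub>R (u - snd c q)" and ?i = "inv_into (fst c) (snd c)"
  let ?\<gamma> = "\<lambda>t. ?i (?l t)"
  have l: "?l t \<in> ball (snd c q) r" if "t \<in> {0..1}" for t
  proof -
    have "norm (t *\<^sub>R (u - snd c q)) \<le> norm (u - snd c q)"
      using that by (simp add: mult_left_le_one_le)
    moreover have "norm (u - snd c q) < r" using u by (simp add: dist_norm norm_minus_commute)
    ultimately show ?thesis by (simp add: dist_norm)
  qed
  have lO: "?l t \<in> snd c ` fst c" if "t \<in> {0..1}" for t using l[OF that] r by blast
  have ic: "?\<gamma> t \<in> fst c" "snd c (?\<gamma> t) = ?l t" if "t \<in> {0..1}" for t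
    using lO[OF that] by (rule inv_into_into, rule f_inv_into_f)
  have "continuous_map (top_of_set {0..1}) (top_of_set (snd c ` fst c)) ?l"
    using lO by (auto intro!: continuous_intros)
  from continuous_map_compose[OF this chart(7)[OF c(1)]]
  have p: "pathin X ?\<gamma>" unfolding pathin_def continuous_map_in_subtopology by (simp add: o_def)
  have cn: "continuous_near ?\<gamma> t" if "t \<in> {0<..<1}" for t by (rule pathin_continuous_near[OF p that])
  have "regular ?\<gamma> t" if t: "t \<in> {0<..<1}" for t
    unfolding regular_def
  proof (intro conjI ballI impI cn t)
    show "?\<gamma> t \<in> topspace X" using pathin_topspace[OF p, of t] t by simp
    fix d assume d: "d \<in> A" "?\<gamma> t \<in> fst d"
    let ?N = "?l -` chart_rep_dom c d id"
    have "open ?N" by (rule open_vimage[OF transition(1)[OF c(1) d(1)]]) (intro continuous_intros)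
    moreover have "t \<in> ?N"
      using ic[of t] t d(2) by (auto simp: chart_rep_dom_def image_iff intro!: bexI[of _ "?\<gamma> t"])
    moreover have "smooth_on ?N (\<lambda>s. chart_rep c d id (?l s))"
    proof (rule smooth_on_compose[OF _ transition(2)[OF c(1) d(1)]])
      show "smooth_on ?N ?l" by (intro smooth_on_add smooth_on_const smooth_on_scaleR smooth_on_ident)
    qed auto
    then have "(\<lambda>s. chart_rep c d id (?l s)) C1_differentiable_on ?N"
      using \<open>open ?N\<close> by (rule smooth_on_C1)
    then have "(snd d \<circ> ?\<gamma>) C1_differentiable_on ?N" by (simp add: chart_rep_def o_def)
    ultimately show "C1_near (snd d \<circ> ?\<gamma>) t" unfolding C1_near_def by blast
  qed
  then have pw: "piecewise_C1_curve X A ?\<gamma>" unfolding piecewise_C1_regular using p by blast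
  have sp: "speed ?\<gamma> t \<le> B * norm (u - snd c q)" if t: "t \<in> {0<..<1}" for t
  proof -
    have t': "t \<in> {0..1}" using t by simp
    have "(?l has_vector_derivative (u - snd c q)) (at t)"
      unfolding has_vector_derivative_def by (rule derivative_eq_intros refl | simp)+
    then have "((snd c \<circ> ?\<gamma>) has_vector_derivative (u - snd c q)) (at t)"
      by (rule has_vector_derivative_transform_within_open[OF _ open_greaterThanLessThan t])
        (use ic(2) in auto)
    then have "speed ?\<gamma> t = sqrt (G c (?\<gamma> t) (u - snd c q) (u - snd c q))"
      by (rule speed_eq[OF c(1) ic(1)[OF t'] cn[OF t]])
    then show ?thesis using B[OF l[OF t']] by simp
  qed
  have "AE t in lborel. t \<notin> {0, 1::real}" by (rule AE_lborel_notin_finite) simp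
  then have "curve_length A G ?\<gamma> \<le> (\<integral>\<^sup>+t\<in>{0..1::real}. ennreal (B * norm (u - snd c q)) \<partial>lborel)"
    unfolding curve_length_def
  proof (intro nn_integral_mono_AE, eventually_elim)
    case (elim t)
    then show ?case using sp[of t] by (auto simp: indicator_def intro: ennreal_leI)
  qed
  also have "\<dots> = ennreal (B * norm (u - snd c q))" by (simp add: nn_integral_cmult_indicator)
  finally have "curve_length A G ?\<gamma> \<le> ennreal (B * norm (u - snd c q))" .
  moreover have "len_inf q (?i u) \<le> curve_length A G ?\<gamma>"
    by (rule len_inf_le[OF pw]) (simp_all add: inv_chart[OF c])
  ultimately show ?thesis by (rule order.trans[rotated])
qed

lemma len_inf_small:
  assumes "q \<in> topspace X" "e > 0"
  obtains U where "openin X U" "q \<in> U" "\<And>r. r \<in> U \<Longrightarrow> len_inf q r < ennreal e"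
proof -
  obtain c where c: "c \<in> A" "q \<in> fst c" using chart_exists[OF assms(1)] .
  obtain r where r: "r > 0" "cball (snd c q) r \<subseteq> snd c ` fst c"
    using chart(3)[OF c(1)] c(2) unfolding open_contains_cball by blast
  obtain B where B: "B \<ge> 0"
    "\<And>u a. u \<in> cball (snd c q) r \<Longrightarrow> sqrt (G c (inv_into (fst c) (snd c) u) a a) \<le> B * norm a"
    using G_locally_bounded[OF c(1) compact_cball r(2)] by blast
  define \<delta> where "\<delta> = min r (e / (B + 1))"
  have \<delta>: "\<delta> > 0" unfolding \<delta>_def using r(1) assms(2) B(1) by simp
  define U where "U = {p \<in> fst c. snd c p \<in> ball (snd c q) \<delta>}"
  have sub: "ball (snd c q) \<delta> \<subseteq> snd c ` fst c" "ball (snd c q) \<delta> \<subseteq> cball (snd c q) r"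
    using r(2) unfolding \<delta>_def by auto
  have ts: "topspace (subtopology X (fst c)) = fst c" using chart(5)[OF c(1)] by auto
  have "openin (top_of_set (snd c ` fst c)) (ball (snd c q) \<delta>)"
    using sub(1) by (intro openin_open_eq[THEN iffD2] chart(3)[OF c(1)] conjI) auto
  then have "openin (subtopology X (fst c)) U"
    using chart(6)[OF c(1)] unfolding continuous_map_def ts U_def by blast
  then have "openin X U" using openin_trans_full[OF _ chart(2)[OF c(1)]] by blast
  moreover have "q \<in> U" unfolding U_def using c(2) \<delta> by simp
  moreover have "len_inf q p < ennreal e" if p: "p \<in> U" for p
  proof -
    have pc: "p \<in> fst c" "snd c p \<in> ball (snd c q) \<delta>" using p unfolding U_def by blast+
    have "len_inf q (inv_into (fst c) (snd c) (snd c p)) \<le> ennreal (B * norm (snd c p - snd c q))"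
      by (rule len_inf_segment[OF c sub(1) _ pc(2)]) (use B(2) sub(2) in blast)
    then have "len_inf q p \<le> ennreal (B * norm (snd c p - snd c q))"
      using inv_chart[OF c(1) pc(1)] by simp
    also have "B * norm (snd c p - snd c q) < e"
    proof -
      have "norm (snd c p - snd c q) < e / (B + 1)"
        using pc(2) unfolding \<delta>_def by (simp add: dist_norm norm_minus_commute)
      then have "(B + 1) * norm (snd c p - snd c q) < e" using B(1) by (simp add: field_simps)
      moreover have "B * norm (snd c p - snd c q) \<le> (B + 1) * norm (snd c p - snd c q)"
        by (intro mult_right_mono) auto
      ultimately show ?thesis by linarith
    qed
    then have "ennreal (B * norm (snd c p - snd c q)) < ennreal e"
      using assms(2) by (simp add: ennreal_less_iff B(1))
    finally show ?thesis .
  qed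
  ultimately show thesis by (rule that)
qed

text \<open>The points at finite distance from q form a set that is open and closed.\<close>

lemma len_inf_finite:
  assumes conn: "connected_space X" and q: "q \<in> topspace X" and r: "r \<in> topspace X"
  shows "len_inf q r < top"
proof -
  let ?T = "{r \<in> topspace X. len_inf q r < top}"
  have "openin X ?T"
  proof (subst openin_subopen, rule ballI)
    fix r assume r: "r \<in> ?T"
    then obtain U where U: "openin X U" "r \<in> U" "\<And>s. s \<in> U \<Longrightarrow> len_inf r s < ennreal 1"
      using len_inf_small[of r 1] by auto
    have "s \<in> ?T" if "s \<in> U" for s
    proof -
      have "len_inf q r + len_inf r s < top"
        using r U(3)[OF that] by (auto simp: less_top[symmetric] intro: order.strict_trans)
      then show ?thesis using len_inf_triangle[of q s r] openin_subset[OF U(1)] that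
        by (auto intro: order.strict_trans1)
    qed
    then show "\<exists>T. openin X T \<and> r \<in> T \<and> T \<subseteq> ?T" using U(1,2) by blast
  qed
  moreover have "openin X (topspace X - ?T)"
  proof (subst openin_subopen, rule ballI)
    fix r assume r: "r \<in> topspace X - ?T"
    then obtain U where U: "openin X U" "r \<in> U" "\<And>s. s \<in> U \<Longrightarrow> len_inf r s < ennreal 1"
      using len_inf_small[of r 1] by auto
    have "s \<in> topspace X - ?T" if "s \<in> U" for s
    proof -
      have "\<not> len_inf q s < top"
      proof
        assume "len_inf q s < top"
        moreover have "len_inf s r < top"
          using U(3)[OF that] len_inf_sym[of s r] by (auto intro: order.strict_trans)
        ultimately have "len_inf q s + len_inf s r < top" by (simp add: less_top[symmetric] ennreal_add_eq_top)
        then have "len_inf q r < top" using len_inf_triangle[of q r s] by (rule order.strict_trans1[rotated])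
        then show False using r by simp
      qed
      then show ?thesis using openin_subset[OF U(1)] that by auto
    qed
    then show "\<exists>T. openin X T \<and> r \<in> T \<and> T \<subseteq> topspace X - ?T" using U(1,2) by blast
  qed
  then have "closedin X ?T" unfolding closedin_def by blast
  ultimately have "?T = {} \<or> ?T = topspace X" using conn unfolding connected_space_clopen_in by blast
  moreover have "q \<in> ?T" using q len_inf_refl[OF q] by simp
  ultimately have "r \<in> ?T" using r by blast
  then show ?thesis by simp
qed

text \<open>A Cauchy sequence stays in a sublevel set of the function f with bounded gradient, hence in a
  compact set, and a cluster point in the manifold topology is a limit for the distance.\<close>

theorem complete_if_proper_function:
  fixes f :: "'p \<Rightarrow> real"
  assumes conn: "connected_space X"
    and sep: "\<And>q r. q \<in> topspace X \<Longrightarrow> r \<in> topspace X \<Longrightarrow> q \<noteq> r \<Longrightarrow>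
      \<exists>C (h :: 'p \<Rightarrow> complex). gradient_bounded X A G C h \<and> h q \<noteq> h r"
    and f: "gradient_bounded X A G C f" and proper: "\<And>b. compactin X {q \<in> topspace X. f q \<le> b}"
  shows "riemannian_complete X A G"
proof -
  note fin = len_inf_finite[OF conn]
  have pos: "0 < rdist q r" if qr: "q \<in> topspace X" "r \<in> topspace X" "q \<noteq> r" for q r
  proof -
    obtain C and h :: "'p \<Rightarrow> complex" where h: "gradient_bounded X A G C h" "h q \<noteq> h r"
      using sep[OF qr] by blast
    have "C > 0" using h(1) unfolding gradient_bounded_def by blast
    then have "0 < norm (h r - h q) / C" using h(2) by simp
    then have "0 < ennreal (norm (h r - h q) / C)" by simp
    also have "\<dots> \<le> len_inf q r" by (rule gradient_bounded_len_inf[OF h(1)])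
    finally show ?thesis unfolding rdist_eq using fin[OF that(1,2)] by (simp add: enn2real_positive_iff)
  qed
  interpret M: Metric_space "topspace X" rdist
  proof
    show "0 \<le> rdist q r" for q r unfolding rdist_eq by simp
    show "rdist q r = rdist r q" for q r unfolding rdist_eq using len_inf_sym by metis
    show "rdist q r = 0 \<longleftrightarrow> q = r" if "q \<in> topspace X" "r \<in> topspace X" for q r
      using pos[OF that] len_inf_refl[OF that(1)] by (cases "q = r") (auto simp: rdist_eq)
    show "rdist q s \<le> rdist q r + rdist r s"
      if "q \<in> topspace X" "r \<in> topspace X" "s \<in> topspace X" for q r s
    proof -
      have "enn2real (len_inf q s) \<le> enn2real (len_inf q r + len_inf r s)"
        using fin[OF that(1,2)] fin[OF that(2,3)] len_inf_triangle[of q s r]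
        by (intro enn2real_mono) auto
      also have "\<dots> = enn2real (len_inf q r) + enn2real (len_inf r s)"
        using fin[OF that(1,2)] fin[OF that(2,3)] by (rule enn2real_plus)
      finally show ?thesis unfolding rdist_eq .
    qed
  qed
  have C: "C > 0" using f unfolding gradient_bounded_def by blast
  have lip: "\<bar>f r - f q\<bar> \<le> C * rdist q r" if "q \<in> topspace X" "r \<in> topspace X" for q r
  proof -
    have "enn2real (ennreal (norm (f r - f q) / C)) \<le> rdist q r"
      unfolding rdist_eq by (rule enn2real_mono[OF gradient_bounded_len_inf[OF f] fin[OF that]])
    then show ?thesis using C by (simp add: field_simps)
  qed
  have "\<exists>q. limitin M.mtopology \<sigma> q sequentially" if \<sigma>: "M.MCauchy \<sigma>" for \<sigma>
  proof -
    have \<sigma>M: "\<sigma> n \<in> topspace X" for n using \<sigma> unfolding M.MCauchy_def by blast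
    have cauchy: "\<exists>N. \<forall>n n'. N \<le> n \<longrightarrow> N \<le> n' \<longrightarrow> rdist (\<sigma> n) (\<sigma> n') < e" if "e > 0" for e
      using \<sigma> that unfolding M.MCauchy_def by blast
    obtain N where N: "\<And>n n'. N \<le> n \<Longrightarrow> N \<le> n' \<Longrightarrow> rdist (\<sigma> n) (\<sigma> n') < 1"
      using cauchy[of 1] by auto
    let ?K = "{q \<in> topspace X. f q \<le> f (\<sigma> N) + C}"
    have inK: "\<sigma> n \<in> ?K" if "n \<ge> N" for n
    proof -
      have "f (\<sigma> n) - f (\<sigma> N) \<le> C * rdist (\<sigma> N) (\<sigma> n)" using lip[OF \<sigma>M \<sigma>M, of n N] by linarith
      also have "\<dots> \<le> C" using N[of N n] that C by simp
      finally show ?thesis using \<sigma>M by simp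
    qed
    have "\<exists>q\<in>?K. \<forall>U m. openin X U \<and> q \<in> U \<longrightarrow> (\<exists>n\<ge>m. \<sigma> n \<in> U)"
    proof (rule ccontr)
      assume neg: "\<not> (\<exists>q\<in>?K. \<forall>U m. openin X U \<and> q \<in> U \<longrightarrow> (\<exists>n\<ge>m. \<sigma> n \<in> U))"
      have ex: "\<exists>U m. openin X U \<and> q \<in> U \<and> (\<forall>n\<ge>m. \<sigma> n \<notin> U)" if q: "q \<in> ?K" for q
      proof (rule ccontr)
        assume "\<not> (\<exists>U m. openin X U \<and> q \<in> U \<and> (\<forall>n\<ge>m. \<sigma> n \<notin> U))"
        then have "\<forall>U m. openin X U \<and> q \<in> U \<longrightarrow> (\<exists>n\<ge>m. \<sigma> n \<in> U)" by blast
        then have "\<exists>q\<in>?K. \<forall>U m. openin X U \<and> q \<in> U \<longrightarrow> (\<exists>n\<ge>m. \<sigma> n \<in> U)" by (rule bexI[OF _ q])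
        with neg show False by (rule notE)
      qed
      define U where "U q = (SOME U. \<exists>m. openin X U \<and> q \<in> U \<and> (\<forall>n\<ge>m. \<sigma> n \<notin> U))" for q
      have "\<exists>m. openin X (U q) \<and> q \<in> U q \<and> (\<forall>n\<ge>m. \<sigma> n \<notin> U q)" if "q \<in> ?K" for q
        unfolding U_def by (rule someI_ex[OF ex[OF that]])
      then have U: "openin X (U q)" "q \<in> U q" "\<exists>m. \<forall>n\<ge>m. \<sigma> n \<notin> U q" if "q \<in> ?K" for q
        using that by blast+
      define m where "m q = (SOME m. \<forall>n\<ge>m. \<sigma> n \<notin> U q)" for q
      have m: "\<forall>n\<ge>m q. \<sigma> n \<notin> U q" if "q \<in> ?K" for q
        unfolding m_def by (rule someI_ex[OF U(3)[OF that]])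
      have "\<forall>V\<in>U ` ?K. openin X V" using U(1) by blast
      moreover have "?K \<subseteq> \<Union>(U ` ?K)" using U(2) by blast
      ultimately have "\<exists>\<F>. finite \<F> \<and> \<F> \<subseteq> U ` ?K \<and> ?K \<subseteq> \<Union>\<F>"
        using proper[of "f (\<sigma> N) + C"] unfolding compactin_def by simp
      then obtain \<F> where \<F>: "finite \<F>" "\<F> \<subseteq> U ` ?K" "?K \<subseteq> \<Union>\<F>" by (elim exE conjE)
      obtain Q where Q: "Q \<subseteq> ?K" "finite Q" "\<F> = U ` Q"
        using finite_subset_image[OF \<F>(1,2)] by (elim exE conjE)
      define n where "n = Max (insert N (m ` Q))"
      have n: "N \<le> n" "\<And>q. q \<in> Q \<Longrightarrow> m q \<le> n" unfolding n_def using Q(2) by auto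
      have "\<sigma> n \<in> \<Union>\<F>" using inK[OF n(1)] \<F>(3) by (rule subsetD[rotated])
      then obtain q where q: "q \<in> Q" "\<sigma> n \<in> U q" unfolding Q(3) by (elim UN_E)
      have "q \<in> ?K" using Q(1) q(1) by (rule subsetD)
      from m[OF this, rule_format, OF n(2)[OF q(1)]] q(2) show False by (rule notE)
    qed
    then obtain q where qK: "q \<in> ?K"
      and qU: "\<forall>U m. openin X U \<and> q \<in> U \<longrightarrow> (\<exists>n\<ge>m. \<sigma> n \<in> U)" by (rule bexE)
    then have q: "q \<in> topspace X" by simp
    have "limitin M.mtopology \<sigma> q sequentially"
      unfolding M.limit_metric_sequentially
    proof (intro conjI q allI impI)
      fix e :: real assume e: "e > 0"
      obtain m where m: "\<And>n n'. m \<le> n \<Longrightarrow> m \<le> n' \<Longrightarrow> rdist (\<sigma> n) (\<sigma> n') < e/2"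
        using cauchy[of "e/2"] e by auto
      obtain U where U: "openin X U" "q \<in> U" "\<And>r. r \<in> U \<Longrightarrow> len_inf q r < ennreal (e/2)"
        using len_inf_small[OF q, of "e/2"] e by auto
      obtain n0 where n0: "n0 \<ge> m" "\<sigma> n0 \<in> U" using qU U(1,2) by metis
      have "enn2real (len_inf q (\<sigma> n0)) < e/2"
        proof -
        have "ennreal (enn2real (len_inf q (\<sigma> n0))) < ennreal (e/2)"
          using U(3)[OF n0(2)] fin[OF q \<sigma>M] by simp
        then show ?thesis by (simp add: ennreal_less_iff)
      qed
      then have "rdist (\<sigma> n0) q < e/2" unfolding rdist_eq using len_inf_sym by metis
      then have "rdist (\<sigma> n) q < e" if "n \<ge> m" for n
        using M.triangle[OF \<sigma>M[of n] \<sigma>M[of n0] q] m[OF that n0(1)] by linarith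
      then show "\<exists>N. \<forall>n\<ge>N. \<sigma> n \<in> topspace X \<and> rdist (\<sigma> n) q < e" using \<sigma>M by blast
    qed
    then show ?thesis ..
  qed
  then show ?thesis
    unfolding riemannian_complete_def M.mcomplete_def using M.Metric_space_axioms by blast
qed

end

lemma (in riemannian_quotient) gradient_bounded_quotient:
  fixes h :: "'a \<Rightarrow> 'b::real_normed_vector"
  assumes "C > 0" and h: "\<And>x. x \<in> Z \<Longrightarrow> (h has_derivative h' x) (at x within Z)"
    and bound: "\<And>x v. x \<in> Z \<Longrightarrow> norm (h' x v) \<le> C * sqrt (g x v v)"
    and orbit: "\<And>x y. x \<in> Z \<Longrightarrow> y \<in> Z \<Longrightarrow> pr x = pr y \<Longrightarrow> h x = h y"
  shows "gradient_bounded X A G C (\<lambda>q. h (rep q))"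
  unfolding gradient_bounded_def
proof (intro conjI ballI assms(1))
  have r: "h (rep (pr x)) = h x" if "x \<in> Z" for x
    using rep[of "pr x"] that by (intro orbit) auto
  have "continuous_on Z h" unfolding continuous_on_eq_continuous_within
    using has_derivative_continuous[OF h] by blast
  then have "continuous_map (top_of_set Z) euclidean (\<lambda>x. h (rep (pr x)))"
    using r by (simp cong: continuous_on_cong)
  then show "continuous_map X euclidean (\<lambda>q. h (rep q))" by (rule continuous_map_from_quotient)
  fix q assume "q \<in> topspace X"
  then have "q \<in> pr ` Z" unfolding topspace_X .
  then obtain c where c: "c \<in> A" "q \<in> fst c" by (rule chart_at)
  with lipschitz_function_descends[OF h bound orbit c]
  show "\<exists>c\<in>A. q \<in> fst c \<and> (\<exists>E. ((\<lambda>u. h (rep (inv_into (fst c) (snd c) u))) has_derivative E) (at (snd c q)) \<and>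
      (\<forall>a. norm (E a) \<le> C * sqrt (G c q a a)))" by blast
qed

section \<open>The moment map in complex coordinates\<close>

lemma smooth_on_fst:
  fixes f :: "'a::real_normed_vector \<Rightarrow> 'b::euclidean_space \<times> 'c::euclidean_space"
  shows "smooth_on S f \<Longrightarrow> smooth_on S (\<lambda>x. fst (f x))"
  by (rule smooth_on_linear_compose) (auto simp: linear_iff)

lemma smooth_on_snd:
  fixes f :: "'a::real_normed_vector \<Rightarrow> 'b::euclidean_space \<times> 'c::euclidean_space"
  shows "smooth_on S f \<Longrightarrow> smooth_on S (\<lambda>x. snd (f x))"
  by (rule smooth_on_linear_compose) (auto simp: linear_iff)

lemma smooth_on_cnj: "smooth_on S f \<Longrightarrow> smooth_on S (\<lambda>x. cnj (f x))"
  by (rule smooth_on_linear_compose) (auto simp: linear_iff)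

lemma smooth_on_Re: "smooth_on S f \<Longrightarrow> smooth_on S (\<lambda>x. Re (f x))"
  by (rule smooth_on_linear_compose) (auto simp: linear_iff)

lemma smooth_on_Im: "smooth_on S f \<Longrightarrow> smooth_on S (\<lambda>x. Im (f x))"
  by (rule smooth_on_linear_compose) (auto simp: linear_iff)

lemma smooth_on_complex_of_real: "smooth_on S f \<Longrightarrow> smooth_on S (\<lambda>x. complex_of_real (f x))"
  by (rule smooth_on_linear_compose) (auto simp: linear_iff scaleR_conv_of_real)

lemma smooth_on_Complex: "smooth_on S f \<Longrightarrow> smooth_on S g \<Longrightarrow> smooth_on S (\<lambda>x. Complex (f x) (g x))"
  unfolding Complex_eq by (intro smooth_on_add smooth_on_mult smooth_on_const smooth_on_complex_of_real)

lemma smooth_on_nth: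
  fixes f :: "'a::real_normed_vector \<Rightarrow> 'b::euclidean_space ^ 'n"
  shows "smooth_on S f \<Longrightarrow> smooth_on S (\<lambda>x. f x $ i)"
  by (rule smooth_on_linear_compose) (auto simp: linear_iff)

lemmas smooth_intros = smooth_on_const smooth_on_ident smooth_on_add smooth_on_diff smooth_on_uminus
  smooth_on_mult smooth_on_power smooth_on_Pair smooth_on_fst smooth_on_snd smooth_on_cnj smooth_on_Re
  smooth_on_Im smooth_on_complex_of_real smooth_on_Complex smooth_on_nth smooth_on_norm_power2

abbreviation z1 :: "quat \<times> quat \<Rightarrow> complex" where "z1 x \<equiv> fst (fst x)"
abbreviation w1 :: "quat \<times> quat \<Rightarrow> complex" where "w1 x \<equiv> snd (fst x)"
abbreviation z2 :: "quat \<times> quat \<Rightarrow> complex" where "z2 x \<equiv> fst (snd x)"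
abbreviation w2 :: "quat \<times> quat \<Rightarrow> complex" where "w2 x \<equiv> snd (snd x)"

lemma norm_quat_pair: "(norm x)\<^sup>2 = (norm (z1 x))\<^sup>2 + (norm (w1 x))\<^sup>2 + (norm (z2 x))\<^sup>2 + (norm (w2 x))\<^sup>2"
  for x :: "quat \<times> quat"
  by (simp add: norm_prod_def)

lemma quat_pairing_eq:
  "quat_pairing v x = (cnj (z1 v) * z1 x + w1 v * cnj (w1 x) + cnj (z2 v) * z2 x + w2 v * cnj (w2 x),
     cnj (z1 v) * w1 x - w1 v * cnj (z1 x) + cnj (z2 v) * w2 x - w2 v * cnj (z2 x))"
  by (simp add: quat_pairing_def quat_mult_def quat_cnj_def)

lemma inner_complex_Re: "a \<bullet> b = Re (cnj a * b)" for a b :: complex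
  by (simp add: inner_complex_def)

text \<open>Thus the norm and the inner product are preserved by all maps that preserve the first component of
  the pairing.\<close>

lemma inner_eq_Re_pairing: "v \<bullet> x = Re (fst (quat_pairing v x))" for v x :: "quat \<times> quat"
  by (simp add: quat_pairing_eq inner_prod_def inner_complex_def)

lemma inner_mult_unit: "norm c = 1 \<Longrightarrow> (c * a) \<bullet> (c * b) = a \<bullet> b" for a b c :: complex
proof -
  assume "norm c = 1"
  then have "cnj c * c = 1" by (metis complex_norm_square mult.commute of_real_1 power_one)
  moreover have "cnj (c * a) * (c * b) = (cnj c * c) * (cnj a * b)" by (simp add: mult_ac)
  ultimately show ?thesis by (simp only: inner_complex_Re mult_1)
qed

lemma hyperbolic_metric_invariant:
  assumes "\<And>v x. fst (quat_pairing (\<Phi> v) (\<Phi> x)) = fst (quat_pairing v x)"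
    and "\<And>v x. snd (quat_pairing (\<Phi> v) (\<Phi> x)) = c * snd (quat_pairing v x)" and "norm c = 1"
  shows "hyperbolic_metric (\<Phi> x) (\<Phi> v) (\<Phi> w) = hyperbolic_metric x v w"
proof -
  have inner: "\<Phi> v \<bullet> \<Phi> w = v \<bullet> w" for v w unfolding inner_eq_Re_pairing assms(1) ..
  have "(norm (\<Phi> x))\<^sup>2 = (norm x)\<^sup>2" unfolding power2_norm_eq_inner inner ..
  moreover have "quat_pairing (\<Phi> v) (\<Phi> x) \<bullet> quat_pairing (\<Phi> w) (\<Phi> x) = quat_pairing v x \<bullet> quat_pairing w x"
    unfolding inner_prod_def assms(1,2) inner_mult_unit[OF assms(3)] ..
  ultimately show ?thesis unfolding hyperbolic_metric_def inner by simp
qed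

lemma linear_quat_pairing: "linear (\<lambda>v. quat_pairing v x)"
  by (rule linearI) (simp_all add: quat_pairing_eq algebra_simps scaleR_conv_of_real)

lemma bilinear_hyperbolic_metric: "bilinear (hyperbolic_metric x)"
proof -
  note l = linear_quat_pairing[of x]
  show ?thesis
    unfolding bilinear_def hyperbolic_metric_def
    by (intro conjI allI linearI)
      (simp_all add: linear_add[OF l] linear_scale[OF l] inner_add_left inner_add_right algebra_simps add_divide_distrib)
qed

text \<open>Both estimates drop one of the two nonnegative terms of the line element. The first one serves to
  bound polynomial functions, the second one to bound the height function below.\<close>

lemma hyperbolic_metric_ge:
  assumes "norm x < 1"
  shows "(norm v)\<^sup>2 \<le> hyperbolic_metric x v v"
    and "((v \<bullet> x) / (1 - (norm x)\<^sup>2))\<^sup>2 \<le> hyperbolic_metric x v v"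
proof -
  define k where "k = 1 / (1 - (norm x)\<^sup>2)"
  have n: "(norm x)\<^sup>2 < 1" using assms by (simp add: power_less_one_iff)
  then have k: "1 \<le> k" unfolding k_def by simp
  let ?P = "(norm (quat_pairing v x))\<^sup>2"
  have eq: "hyperbolic_metric x v v = k * (norm v)\<^sup>2 + k\<^sup>2 * ?P"
    unfolding hyperbolic_metric_line_element k_def by (simp add: power2_eq_square algebra_simps)
  have "(norm v)\<^sup>2 \<le> k * (norm v)\<^sup>2" using mult_right_mono[OF k, of "(norm v)\<^sup>2"] by simp
  then show "(norm v)\<^sup>2 \<le> hyperbolic_metric x v v" unfolding eq by (rule order.trans) simp
  have "\<bar>v \<bullet> x\<bar> \<le> norm (fst (quat_pairing v x))" unfolding inner_eq_Re_pairing by (rule abs_Re_le_cmod)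
  also have "\<dots> \<le> norm (quat_pairing v x)" by (metis norm_fst_le prod.collapse)
  finally have "(v \<bullet> x)\<^sup>2 \<le> ?P" by (metis abs_ge_zero power2_abs power_mono)
  then have "k\<^sup>2 * (v \<bullet> x)\<^sup>2 \<le> k\<^sup>2 * ?P" by (intro mult_left_mono) auto
  also have "\<dots> \<le> hyperbolic_metric x v v" unfolding eq using k by simp
  finally show "((v \<bullet> x) / (1 - (norm x)\<^sup>2))\<^sup>2 \<le> hyperbolic_metric x v v"
    unfolding k_def by (simp add: power_divide)
qed

lemma smooth_on_quat_pairing:
  fixes v x :: "'a::real_normed_vector \<Rightarrow> quat \<times> quat"
  assumes "smooth_on S v" "smooth_on S x"
  shows "smooth_on S (\<lambda>y. quat_pairing (v y) (x y))"
  unfolding quat_pairing_eq by (intro smooth_intros assms)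

lemma smooth_on_hyperbolic_metric:
  assumes "\<And>x. x \<in> Z \<Longrightarrow> norm x < 1"
  shows "smooth_on (Z \<times> UNIV \<times> UNIV) (\<lambda>(x, v, w). hyperbolic_metric x v w)"
proof -
  have "smooth_on (Z \<times> UNIV \<times> UNIV) (\<lambda>y. hyperbolic_metric (fst y) (fst (snd y)) (snd (snd y)))"
    unfolding hyperbolic_metric_def
  proof (intro smooth_on_mult smooth_on_add smooth_on_divide smooth_on_inner smooth_on_quat_pairing
      smooth_on_const smooth_on_diff smooth_on_norm_power2 smooth_on_fst smooth_on_snd smooth_on_ident)
    fix y assume "y \<in> Z \<times> (UNIV :: (quat \<times> quat) set) \<times> (UNIV :: (quat \<times> quat) set)"
    then have "norm (fst y) < 1" using assms by auto
    then have "(norm (fst y))\<^sup>2 < 1" by (simp add: power_less_one_iff)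
    then show "1 - (norm (fst y))\<^sup>2 \<noteq> 0" "1 - (norm (fst y))\<^sup>2 \<noteq> 0" by simp_all
  qed
  then show ?thesis unfolding case_prod_unfold .
qed

lemma norm_less_one_iff_power2: "norm x < 1 \<longleftrightarrow> (norm x)\<^sup>2 < 1" for x :: "'a::real_normed_vector"
  by (simp add: power_less_one_iff)

lemma lagrange_identity:
  "(norm (cnj a * c + cnj b * d))\<^sup>2 + (norm (a * d - b * c))\<^sup>2 =
     ((norm a)\<^sup>2 + (norm b)\<^sup>2) * ((norm c)\<^sup>2 + (norm d)\<^sup>2)" for a b c d :: complex
proof -
  have "complex_of_real ((norm (cnj a * c + cnj b * d))\<^sup>2 + (norm (a * d - b * c))\<^sup>2) =
      complex_of_real (((norm a)\<^sup>2 + (norm b)\<^sup>2) * ((norm c)\<^sup>2 + (norm d)\<^sup>2))"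
    unfolding of_real_add of_real_mult complex_norm_square by (simp add: algebra_simps)
  then show ?thesis by (simp only: of_real_eq_iff)
qed

text \<open>The weights are \<open>(n - 2, n, n)\<close>. A pair of quaternions is written as \<open>z + w j\<close> with z and w in
  the complex plane \<open>\<complex>\<^sup>2\<close>.\<close>

locale odd_weight =
  fixes n :: nat
  assumes odd: "odd n" and gt: "2 < n"
begin

abbreviation weights :: weights where "weights \<equiv> (int n - 2, int n, int n)"
abbreviation Z :: "(quat \<times> quat) set" where "Z \<equiv> moment_zero weights"
abbreviation pr :: "quat \<times> quat \<Rightarrow> (quat \<times> quat) set" where "pr \<equiv> circle_orbit weights"
abbreviation Z' :: "((complex^2) \<times> complex) set" where "Z' \<equiv> disk_bundle_cover"
abbreviation pr' :: "(complex^2) \<times> complex \<Rightarrow> ((complex^2) \<times> complex) set" where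
  "pr' \<equiv> disk_bundle_orbit (int n)"

definition level :: real where "level = (real n - 2) / real n"

lemma level_pos: "0 < level" using gt by (simp add: level_def)

text \<open>The product \<open>cnj x i x\<close> for the quaternion \<open>x = z + w j\<close> is \<open>(|z|\<^sup>2 - |w|\<^sup>2) i + 2 i (cnj z) w j\<close>. So
  the moment map vanishes when z and w are orthogonal and \<open>|z|\<^sup>2 - |w|\<^sup>2\<close> is \<open>(n - 2) / n\<close>. As this
  number is positive, z does not vanish.\<close>

lemma mem_Z:
  "x \<in> Z \<longleftrightarrow> (norm x)\<^sup>2 < 1 \<and>
     (norm (z1 x))\<^sup>2 + (norm (z2 x))\<^sup>2 - (norm (w1 x))\<^sup>2 - (norm (w2 x))\<^sup>2 = level \<and>
     cnj (z1 x) * w1 x + cnj (z2 x) * w2 x = 0"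
proof -
  have q: "quat_cnj y *\<^sub>H quat_i *\<^sub>H y =
      (\<i> * of_real ((norm (fst y))\<^sup>2 - (norm (snd y))\<^sup>2), 2 * \<i> * (cnj (fst y) * snd y))" for y
    unfolding of_real_diff complex_norm_square
    by (simp add: quat_mult_def quat_cnj_def quat_i_def algebra_simps)
  let ?m = "- (real_of_int (int n - 2) *\<^sub>R quat_i)
     + real_of_int (int n) *\<^sub>R (quat_cnj (fst x) *\<^sub>H quat_i *\<^sub>H fst x)
     + real_of_int (int n) *\<^sub>R (quat_cnj (snd x) *\<^sub>H quat_i *\<^sub>H snd x)"
  let ?d = "(norm (z1 x))\<^sup>2 + (norm (z2 x))\<^sup>2 - (norm (w1 x))\<^sup>2 - (norm (w2 x))\<^sup>2"
  have "fst ?m = \<i> * of_real (real n * ?d - (real n - 2))"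
    unfolding q by (simp add: quat_i_def scaleR_conv_of_real algebra_simps)
  moreover have "snd ?m = 2 * \<i> * of_nat n * (cnj (z1 x) * w1 x + cnj (z2 x) * w2 x)"
    unfolding q by (simp add: quat_i_def scaleR_conv_of_real algebra_simps)
  ultimately have "?m = 0 \<longleftrightarrow> real n * ?d - (real n - 2) = 0 \<and> cnj (z1 x) * w1 x + cnj (z2 x) * w2 x = 0"
    using gt by (simp only: prod_eq_iff fst_zero snd_zero mult_eq_0_iff of_real_eq_0_iff) simp
  also have "real n * ?d - (real n - 2) = 0 \<longleftrightarrow> ?d = level"
    using gt by (simp add: level_def field_simps)
  finally have "?m = 0 \<longleftrightarrow> ?d = level \<and> cnj (z1 x) * w1 x + cnj (z2 x) * w2 x = 0" .
  moreover have "x \<in> Z \<longleftrightarrow> x \<in> hyperbolic_plane \<and> ?m = 0"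
    by (cases x) (auto simp: moment_zero_def)
  moreover have "x \<in> hyperbolic_plane \<longleftrightarrow> (norm x)\<^sup>2 < 1"
    by (simp add: hyperbolic_plane_def norm_prod_def)
  ultimately show ?thesis by blast
qed

lemma norm_less_one: "x \<in> Z \<Longrightarrow> norm x < 1"
  unfolding mem_Z norm_less_one_iff_power2 by blast

lemma z_norm_pos: "x \<in> Z \<Longrightarrow> 0 < (norm (z1 x))\<^sup>2 + (norm (z2 x))\<^sup>2"
  using level_pos unfolding mem_Z by (smt (verit) zero_le_power2)

definition act :: "complex \<Rightarrow> quat \<times> quat \<Rightarrow> quat \<times> quat" where
  "act \<tau> x = ((\<tau> * z1 x, \<tau> ^ (n - 1) * w1 x), (\<tau> * z2 x, \<tau> ^ (n - 1) * w2 x))"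

lemma act_act: "act \<sigma> (act \<tau> x) = act (\<sigma> * \<tau>) x"
  by (simp add: act_def power_mult_distrib mult.assoc)

lemma act_one: "act 1 x = x" by (simp add: act_def)

lemma linear_act: "linear (act \<tau>)"
  by (rule linearI) (simp_all add: act_def algebra_simps scaleR_conv_of_real)

lemma act_pairing:
  assumes "norm \<tau> = 1"
  shows "fst (quat_pairing (act \<tau> v) (act \<tau> x)) = fst (quat_pairing v x)"
    "snd (quat_pairing (act \<tau> v) (act \<tau> x)) = (\<tau> ^ (n - 1) * cnj \<tau>) * snd (quat_pairing v x)"
proof -
  have 1: "cnj \<tau> * \<tau> = 1" using assms by (metis complex_norm_square mult.commute of_real_1 power_one)
  have "\<tau> ^ (n - 1) * cnj (\<tau> ^ (n - 1)) = (\<tau> * cnj \<tau>) ^ (n - 1)" by (simp add: power_mult_distrib)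
  then have 2: "\<tau> ^ (n - 1) * cnj (\<tau> ^ (n - 1)) = 1" using 1 by (simp add: mult.commute)
  define s where "s = \<tau> ^ (n - 1)"
  have act: "act \<tau> y = ((\<tau> * z1 y, s * w1 y), (\<tau> * z2 y, s * w2 y))" for y by (simp add: act_def s_def)
  have 2: "s * cnj s = 1" using 2 unfolding s_def .
  show "fst (quat_pairing (act \<tau> v) (act \<tau> x)) = fst (quat_pairing v x)"
    unfolding quat_pairing_eq act fst_conv snd_conv complex_cnj_mult using 1 2 by algebra
  show "snd (quat_pairing (act \<tau> v) (act \<tau> x)) = (\<tau> ^ (n - 1) * cnj \<tau>) * snd (quat_pairing v x)"
    unfolding quat_pairing_eq act fst_conv snd_conv complex_cnj_mult s_def[symmetric] by algebra
qed

lemma norm_act: assumes "norm \<tau> = 1" shows "norm (act \<tau> x) = norm x"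
proof -
  have "act \<tau> x \<bullet> act \<tau> x = x \<bullet> x" unfolding inner_eq_Re_pairing act_pairing(1)[OF assms] ..
  then show ?thesis by (simp add: norm_eq_sqrt_inner)
qed

lemma act_Z: "norm \<tau> = 1 \<Longrightarrow> x \<in> Z \<Longrightarrow> act \<tau> x \<in> Z"
proof -
  assume \<tau>: "norm \<tau> = 1" and x: "x \<in> Z"
  have "cnj \<tau> * \<tau> ^ (n - 1) * (cnj (z1 x) * w1 x + cnj (z2 x) * w2 x) = 0" using x unfolding mem_Z by simp
  then have "cnj (z1 (act \<tau> x)) * w1 (act \<tau> x) + cnj (z2 (act \<tau> x)) * w2 (act \<tau> x) = 0"
    by (simp add: act_def algebra_simps)
  then show "act \<tau> x \<in> Z" using x norm_act[OF \<tau>, of x] \<tau> unfolding mem_Z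
    by (simp add: act_def norm_mult norm_power)
qed

lemma hyperbolic_metric_act:
  assumes "norm \<tau> = 1"
  shows "hyperbolic_metric (act \<tau> x) (act \<tau> v) (act \<tau> w) = hyperbolic_metric x v w"
  by (rule hyperbolic_metric_invariant[OF act_pairing[OF assms]]) (simp add: assms norm_mult norm_power)

text \<open>Right multiplication by \<open>exp (- i s)\<close> multiplies z by this number, but w by its conjugate, because
  w stands to the left of j. So z has the weight \<open>n - (n - 2) = 2\<close> and w has the weight
  \<open>n + (n - 2) = 2 (n - 1)\<close>; the parameter of the effective circle is \<open>exp (4 \<pi> i t)\<close>.\<close>

lemma circle_action_eq: "circle_action weights t x = act (cis (4 * pi * t)) x"
proof -
  have e: "exp (2 * of_real pi * \<i> * of_int m * of_real t) = cis (2 * pi * of_int m * t)" for m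
    unfolding cis_conv_exp by (simp add: mult_ac)
  have "circle_action weights t x =
      ((cis (2 * pi * real n * t) * z1 x * cis (- (2 * pi * (real n - 2) * t)),
        cis (2 * pi * real n * t) * w1 x * cnj (cis (- (2 * pi * (real n - 2) * t)))),
       (cis (2 * pi * real n * t) * z2 x * cis (- (2 * pi * (real n - 2) * t)),
        cis (2 * pi * real n * t) * w2 x * cnj (cis (- (2 * pi * (real n - 2) * t)))))"
    by (cases x) (simp only: circle_action_def prod.case Let_def e,
        simp add: quat_mult_def quat_of_complex_def algebra_simps)
  moreover have "cis (2 * pi * real n * t) * a * cis (- (2 * pi * (real n - 2) * t)) = cis (4 * pi * t) * a" for a
  proof -
    have "cis (2 * pi * real n * t) * cis (- (2 * pi * (real n - 2) * t)) = cis (4 * pi * t)"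
      using gt by (simp add: cis_mult of_nat_diff algebra_simps)
    then show ?thesis by (metis mult.assoc mult.commute)
  qed
  moreover have "cis (2 * pi * real n * t) * a * cnj (cis (- (2 * pi * (real n - 2) * t))) = cis (4 * pi * t) ^ (n - 1) * a" for a
  proof -
    have "cis (2 * pi * real n * t) * cnj (cis (- (2 * pi * (real n - 2) * t))) = cis (4 * pi * t) ^ (n - 1)"
    proof -
      have "real (n - 1) * (4 * pi * t) = 2 * pi * real n * t + 2 * pi * (real n - 2) * t"
        using gt by (simp add: of_nat_diff algebra_simps)
      then show ?thesis by (simp only: Complex.DeMoivre cis_cnj cis_mult minus_minus)
    qed
    then show ?thesis by (metis mult.assoc mult.commute)
  qed
  ultimately show ?thesis by (simp add: act_def)
qed

lemma pr_eq: "pr x = {act \<tau> x | \<tau>. norm \<tau> = 1}"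
proof -
  have par: "circle_params weights = {0..<1/2}"
    using odd gt by (simp add: circle_params_def)
  have "(\<lambda>t. cis (4 * pi * t)) ` {0..<1/2} = {\<tau>. norm \<tau> = 1}"
  proof (intro equalityI subsetI)
    fix \<tau> :: complex assume "\<tau> \<in> {\<tau>. norm \<tau> = 1}"
    then have \<tau>: "norm \<tau> = 1" by simp
    have "0 \<le> Arg2pi \<tau>" "Arg2pi \<tau> < 2 * pi" by (rule Arg2pi_ge_0, rule Arg2pi_lt_2pi)
    moreover have "\<tau> = cis (Arg2pi \<tau>)" using Arg2pi_eq[of \<tau>] \<tau> by (simp add: cis_conv_exp)
    ultimately show "\<tau> \<in> (\<lambda>t. cis (4 * pi * t)) ` {0..<1/2}"
      by (intro image_eqI[of _ _ "Arg2pi \<tau> / (4 * pi)"]) (auto simp: field_simps)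
  qed auto
  then have "pr x = (\<lambda>\<tau>. act \<tau> x) ` {\<tau>. norm \<tau> = 1}"
    unfolding circle_orbit_def par circle_action_eq by (simp add: image_image flip: \<open>_ = {\<tau>. norm \<tau> = 1}\<close>)
  then show ?thesis by blast
qed

lemma pr_eq_iff: "pr x = pr y \<longleftrightarrow> (\<exists>\<tau>. norm \<tau> = 1 \<and> y = act \<tau> x)"
proof
  assume "pr x = pr y"
  moreover have "y \<in> pr y" unfolding pr_eq by (auto intro!: exI[of _ 1] simp: act_one)
  ultimately have "y \<in> pr x" by simp
  then show "\<exists>\<tau>. norm \<tau> = 1 \<and> y = act \<tau> x" unfolding pr_eq by blast
next
  assume "\<exists>\<tau>. norm \<tau> = 1 \<and> y = act \<tau> x"
  then obtain \<sigma> where \<sigma>: "norm \<sigma> = 1" "y = act \<sigma> x" by blast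
  have "act \<tau> x = act (\<tau> / \<sigma>) y" "norm (\<tau> / \<sigma>) = 1" if "norm \<tau> = 1" for \<tau>
    using \<sigma> that by (auto simp: act_act norm_divide)
  moreover have "act \<tau> y = act (\<tau> * \<sigma>) x" "norm (\<tau> * \<sigma>) = 1" if "norm \<tau> = 1" for \<tau>
    using \<sigma> that by (auto simp: act_act norm_mult)
  ultimately show "pr x = pr y" unfolding pr_eq by (intro equalityI subsetI) blast+
qed

lemma pr_act: "norm \<tau> = 1 \<Longrightarrow> pr (act \<tau> x) = pr x"
  using pr_eq_iff by metis

definition \<xi> :: "quat \<times> quat \<Rightarrow> quat \<times> quat" where
  "\<xi> x = ((\<i> * z1 x, of_nat (n - 1) * \<i> * w1 x), (\<i> * z2 x, of_nat (n - 1) * \<i> * w2 x))"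

lemma vertical_curve:
  "smooth_on S (\<lambda>t. act (cis t) x)" "((\<lambda>t. act (cis t) x) has_vector_derivative \<xi> x) (at 0)"
proof -
  show "smooth_on S (\<lambda>t. act (cis t) x)"
    unfolding act_def by (intro smooth_intros smooth_on_cis)
  have c: "((\<lambda>t. cis t * a) has_derivative (\<lambda>h. of_real h * (\<i> * a))) (at 0)" for a
  proof -
    have "((\<lambda>t. exp (\<i> * of_real t) * a) has_derivative (\<lambda>h. (exp (\<i> * of_real 0) * (\<i> * of_real h)) * a)) (at 0)"
      by (rule has_derivative_mult_left, rule has_derivative_compose[OF _ DERIV_exp[unfolded has_field_derivative_def]])
        (rule bounded_linear_imp_has_derivative[OF bounded_linear_compose[OF bounded_linear_mult_right bounded_linear_of_real]])
    then show ?thesis by (simp add: cis_conv_exp mult_ac)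
  qed
  have cm: "((\<lambda>t. cis t ^ m * a) has_derivative (\<lambda>h. of_real h * (of_nat m * \<i> * a))) (at 0)" for m a
  proof -
    have "((\<lambda>t. real m * t) has_derivative (\<lambda>h. real m * h)) (at 0)"
      by (rule derivative_eq_intros refl | simp)+
    moreover have "((\<lambda>t. cis t * a) has_derivative (\<lambda>h. of_real h * (\<i> * a))) (at (real m * 0))"
      using c by simp
    ultimately have "((\<lambda>t. cis (real m * t) * a) has_derivative (\<lambda>h. of_real (real m * h) * (\<i> * a))) (at 0)"
      by (rule has_derivative_compose)
    then have "((\<lambda>t. cis t ^ m * a) has_derivative (\<lambda>h. of_real (real m * h) * (\<i> * a))) (at 0)"
      by (simp only: Complex.DeMoivre)
    then show ?thesis by (simp add: mult_ac)
  qed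
  have "((\<lambda>t. act (cis t) x) has_derivative (\<lambda>h. ((of_real h * (\<i> * z1 x), of_real h * (of_nat (n - 1) * \<i> * w1 x)),
      (of_real h * (\<i> * z2 x), of_real h * (of_nat (n - 1) * \<i> * w2 x))))) (at 0)"
    unfolding act_def by (intro has_derivative_Pair c cm)
  then show "((\<lambda>t. act (cis t) x) has_vector_derivative \<xi> x) (at 0)"
    unfolding has_vector_derivative_def \<xi>_def by (simp add: scaleR_conv_of_real)
qed


section \<open>The disk bundle\<close>

definition dact :: "complex \<Rightarrow> (complex^2) \<times> complex \<Rightarrow> (complex^2) \<times> complex" where
  "dact \<tau> y = (\<tau> *s fst y, \<tau> ^ n * snd y)"

lemma mem_Z': "y \<in> Z' \<longleftrightarrow> (norm (fst y $ 1))\<^sup>2 + (norm (fst y $ 2))\<^sup>2 = 1 \<and> norm (snd y) < 1"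
proof -
  have "norm (fst y) = 1 \<longleftrightarrow> (norm (fst y))\<^sup>2 = 1"
    unfolding abs_square_eq_1 by simp
  also have "(norm (fst y))\<^sup>2 = (norm (fst y $ 1))\<^sup>2 + (norm (fst y $ 2))\<^sup>2"
    by (simp add: norm_vec_def L2_set_def UNIV_2)
  finally show ?thesis by (cases y) (simp add: disk_bundle_cover_def)
qed

lemma dact_dact: "dact \<sigma> (dact \<tau> y) = dact (\<sigma> * \<tau>) y"
  by (simp add: dact_def power_mult_distrib mult.assoc vector_smult_assoc)

lemma dact_one: "dact 1 y = y" by (simp add: dact_def)

lemma dact_Z': "norm \<tau> = 1 \<Longrightarrow> y \<in> Z' \<Longrightarrow> dact \<tau> y \<in> Z'"
  unfolding mem_Z' by (simp add: dact_def norm_mult norm_power)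

lemma pr'_eq: "pr' y = {dact \<tau> y | \<tau>. norm \<tau> = 1}"
  by (cases y) (simp add: disk_bundle_orbit_def dact_def)

lemma pr'_eq_iff: "pr' x = pr' y \<longleftrightarrow> (\<exists>\<tau>. norm \<tau> = 1 \<and> y = dact \<tau> x)"
proof
  assume "pr' x = pr' y"
  moreover have "y \<in> pr' y" unfolding pr'_eq by (auto intro!: exI[of _ 1] simp: dact_one)
  ultimately have "y \<in> pr' x" by simp
  then show "\<exists>\<tau>. norm \<tau> = 1 \<and> y = dact \<tau> x" unfolding pr'_eq by blast
next
  assume "\<exists>\<tau>. norm \<tau> = 1 \<and> y = dact \<tau> x"
  then obtain \<sigma> where \<sigma>: "norm \<sigma> = 1" "y = dact \<sigma> x" by blast
  have "dact \<tau> x = dact (\<tau> / \<sigma>) y" "norm (\<tau> / \<sigma>) = 1" if "norm \<tau> = 1" for \<tau>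
    using \<sigma> that by (auto simp: dact_dact norm_divide)
  moreover have "dact \<tau> y = dact (\<tau> * \<sigma>) x" "norm (\<tau> * \<sigma>) = 1" if "norm \<tau> = 1" for \<tau>
    using \<sigma> that by (auto simp: dact_dact norm_mult)
  ultimately show "pr' x = pr' y" unfolding pr'_eq by (intro equalityI subsetI) blast+
qed

text \<open>The coordinates \<open>y1\<close>, \<open>y2\<close> of the vector \<open>(c, d)\<close> in the unitary basis \<open>(a, b)\<close>, \<open>(- cnj b, cnj a)\<close>.\<close>

lemma unitary_coordinates:
  assumes "(norm a)\<^sup>2 + (norm b)\<^sup>2 = 1" and "y1 = cnj a * c + cnj b * d" "y2 = a * d - b * c"
  shows "c = a * y1 - cnj b * y2" "d = b * y1 + cnj a * y2"
    "(norm c)\<^sup>2 + (norm d)\<^sup>2 = (norm y1)\<^sup>2 + (norm y2)\<^sup>2"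
proof -
  have "complex_of_real ((norm a)\<^sup>2 + (norm b)\<^sup>2) = 1" using assms(1) by simp
  then have 1: "a * cnj a + b * cnj b = 1" by (simp only: of_real_add complex_norm_square)
  have "c = (a * cnj a + b * cnj b) * c" "d = (a * cnj a + b * cnj b) * d" unfolding 1 by simp_all
  then show "c = a * y1 - cnj b * y2" "d = b * y1 + cnj a * y2"
    unfolding assms(2,3) by (simp_all add: algebra_simps)
  show "(norm c)\<^sup>2 + (norm d)\<^sup>2 = (norm y1)\<^sup>2 + (norm y2)\<^sup>2"
    using lagrange_identity[of a c b d] assms by simp
qed

lemma unitary_coordinates_inverse:
  assumes "(norm a)\<^sup>2 + (norm b)\<^sup>2 = 1" and "c = a * y1 - cnj b * y2" "d = b * y1 + cnj a * y2"
  shows "cnj a * c + cnj b * d = y1" "a * d - b * c = y2"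
proof -
  have "complex_of_real ((norm a)\<^sup>2 + (norm b)\<^sup>2) = 1" using assms(1) by simp
  then have 1: "a * cnj a + b * cnj b = 1" by (simp only: of_real_add complex_norm_square)
  have "cnj a * c + cnj b * d = (a * cnj a + b * cnj b) * y1" "a * d - b * c = (a * cnj a + b * cnj b) * y2"
    unfolding assms(2,3) by (simp_all add: algebra_simps)
  then show "cnj a * c + cnj b * d = y1" "a * d - b * c = y2" unfolding 1 by simp_all
qed

definition to_real4 :: "complex \<times> complex \<Rightarrow> real^4" where
  "to_real4 y = (\<chi> i. if i = 1 then Re (fst y) else if i = 2 then Im (fst y)
     else if i = 3 then Re (snd y) else Im (snd y))"

definition of_real4 :: "real^4 \<Rightarrow> complex \<times> complex" where
  "of_real4 u = (Complex (u $ 1) (u $ 2), Complex (u $ 3) (u $ 4))"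

lemma of_to_real4: "of_real4 (to_real4 y) = y"
  by (simp add: of_real4_def to_real4_def)

lemma to_of_real4: "to_real4 (of_real4 u) = u"
  by (simp add: of_real4_def to_real4_def vec_eq_iff forall_4)

lemma linear_to_real4: "linear to_real4"
  by (rule linearI) (simp_all add: to_real4_def vec_eq_iff)

definition vec2 :: "complex \<Rightarrow> complex \<Rightarrow> complex^2" where
  "vec2 a b = (\<chi> i. if i = 1 then a else b)"

lemma vec2_nth: "vec2 a b $ 1 = a" "vec2 a b $ 2 = b"
  by (simp_all add: vec2_def)

lemma vec2_eq_iff: "v = v' \<longleftrightarrow> v $ 1 = v' $ 1 \<and> v $ 2 = v' $ 2" for v v' :: "complex^2"
  by (simp add: vec_eq_iff forall_2)

lemma smooth_on_vec2: "smooth_on S f \<Longrightarrow> smooth_on S g \<Longrightarrow> smooth_on S (\<lambda>x. vec2 (f x) (g x))"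
proof -
  assume "smooth_on S f" "smooth_on S g"
  then have "smooth_on S (\<lambda>x. (f x, g x))" by (rule smooth_on_Pair)
  moreover have "linear (\<lambda>y. vec2 (fst y) (snd y))"
    by (rule linearI) (simp_all add: vec2_eq_iff vec2_nth)
  ultimately show ?thesis using smooth_on_linear_compose by fastforce
qed

text \<open>Near a point over the line spanned by the unit vector \<open>(a, b)\<close> the phase is normalized so that the
  coordinate of v along \<open>(a, b)\<close> is positive; the remaining coordinates are the affine coordinate of
  the line spanned by v and the fibre coordinate in this phase.\<close>

lemma disk_bundle_slice:
  assumes y0: "y0 \<in> Z'"
  shows "\<exists>V \<sigma> \<psi>. slice Z' pr' V \<sigma> \<psi> \<and> y0 \<in> \<sigma> ` V"
proof -
  define a where "a = fst y0 $ 1"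
  define b where "b = fst y0 $ 2"
  have ab: "(norm a)\<^sup>2 + (norm b)\<^sup>2 = 1" using y0 unfolding mem_Z' a_def b_def by simp
  define y1 where "y1 y = cnj a * (fst y $ 1) + cnj b * (fst y $ 2)" for y :: "(complex^2) \<times> complex"
  define y2 where "y2 y = a * (fst y $ 2) - b * (fst y $ 1)" for y :: "(complex^2) \<times> complex"
  define V where "V = {u. norm (snd (of_real4 u)) < 1}"
  define \<psi> where "\<psi> y = to_real4 (y2 y / y1 y, snd y * (cnj (y1 y) / of_real (norm (y1 y))) ^ n)" for y
  \<comment> \<open>The sum of \<open>(a, b)\<close> and \<open>s (- cnj b, cnj a)\<close> has the norm \<open>sqrt (1 + |s|\<^sup>2)\<close>.\<close>
  define \<rho> where "\<rho> s = complex_of_real (1 / sqrt (1 + (norm s)\<^sup>2))" for s :: complex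
  define \<sigma> where "\<sigma> u = (let s = fst (of_real4 u); \<beta> = snd (of_real4 u) in
      (vec2 (a * \<rho> s - cnj b * (s * \<rho> s)) (b * \<rho> s + cnj a * (s * \<rho> s)), \<beta>))" for u
  have norms: "(norm (y1 y))\<^sup>2 + (norm (y2 y))\<^sup>2 = 1" if "y \<in> Z'" for y
    using unitary_coordinates(3)[OF ab y1_def y2_def, of y] that unfolding mem_Z' by simp
  have y\<sigma>: "y1 (\<sigma> u) = \<rho> (fst (of_real4 u))" "y2 (\<sigma> u) = fst (of_real4 u) * \<rho> (fst (of_real4 u))"
    "snd (\<sigma> u) = snd (of_real4 u)" for u
    using unitary_coordinates_inverse[OF ab refl refl] by (simp_all add: y1_def y2_def \<sigma>_def Let_def vec2_nth)
  have sq: "0 < sqrt (1 + (norm s)\<^sup>2)" for s :: complex by (simp add: add_pos_nonneg)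
  have \<rho>: "\<rho> s \<noteq> 0" "norm (\<rho> s) = 1 / sqrt (1 + (norm s)\<^sup>2)" "cnj (\<rho> s) = of_real (norm (\<rho> s))" for s
    using sq[of s] unfolding \<rho>_def by (simp_all only: norm_of_real complex_cnj_complex_of_real of_real_eq_0_iff) auto
  have \<rho>1: "(norm (\<rho> s))\<^sup>2 + (norm (s * \<rho> s))\<^sup>2 = 1" for s
  proof -
    have "0 < 1 + (norm s)\<^sup>2" by (simp add: add_pos_nonneg)
    then show ?thesis unfolding norm_mult \<rho>(2) by (simp add: power_mult_distrib power_divide field_simps)
  qed
  have \<sigma>Z: "\<sigma> u \<in> Z'" if "u \<in> V" for u
  proof -
    have "(norm (fst (\<sigma> u) $ 1))\<^sup>2 + (norm (fst (\<sigma> u) $ 2))\<^sup>2 = (norm (y1 (\<sigma> u)))\<^sup>2 + (norm (y2 (\<sigma> u)))\<^sup>2"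
      by (rule unitary_coordinates(3)[OF ab y1_def y2_def])
    also have "\<dots> = 1" unfolding y\<sigma> by (rule \<rho>1)
    finally show ?thesis using that unfolding mem_Z' V_def y\<sigma> by simp
  qed
  have \<psi>\<sigma>: "\<psi> (\<sigma> u) = u" for u
    unfolding \<psi>_def y\<sigma> \<rho>(3) using \<rho>(1) by (simp add: to_of_real4)
  have yd: "y1 (dact \<tau> y) = \<tau> * y1 y" "y2 (dact \<tau> y) = \<tau> * y2 y" "snd (dact \<tau> y) = \<tau> ^ n * snd y" for \<tau> y
    by (simp_all add: y1_def y2_def dact_def algebra_simps)
  have \<psi>d: "\<psi> (dact \<tau> y) = \<psi> y" if \<tau>: "norm \<tau> = 1" for \<tau> y
  proof -
    have t: "\<tau> * cnj \<tau> = 1" using \<tau> by (metis complex_norm_square of_real_1 power_one)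
    have "\<tau> ^ n * snd y * (cnj (\<tau> * y1 y) / of_real (norm (\<tau> * y1 y))) ^ n =
        (\<tau> * cnj \<tau>) ^ n * (snd y * (cnj (y1 y) / of_real (norm (y1 y))) ^ n)"
      using \<tau> by (simp add: norm_mult power_mult_distrib power_divide mult_ac)
    also have "\<dots> = snd y * (cnj (y1 y) / of_real (norm (y1 y))) ^ n" unfolding t by simp
    finally have e: "\<tau> ^ n * snd y * (cnj (\<tau> * y1 y) / of_real (norm (\<tau> * y1 y))) ^ n =
        snd y * (cnj (y1 y) / of_real (norm (y1 y))) ^ n" .
    have "\<tau> \<noteq> 0" using \<tau> by auto
    then show ?thesis unfolding \<psi>_def yd e by simp
  qed
  have \<sigma>\<psi>: "\<psi> y \<in> V \<and> pr' (\<sigma> (\<psi> y)) = pr' y" if y: "y \<in> Z'" "y1 y \<noteq> 0" for y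
  proof -
    \<comment> \<open>The phase that makes the coordinate along \<open>(a, b)\<close> positive.\<close>
    define \<tau> where "\<tau> = cnj (y1 y) / of_real (norm (y1 y))"
    have \<tau>: "norm \<tau> = 1" using y(2) by (simp add: \<tau>_def norm_divide)
    have pos: "norm (y1 y) > 0" using y(2) by simp
    have s: "of_real4 (\<psi> y) = (y2 y / y1 y, snd y * \<tau> ^ n)" by (simp add: \<psi>_def of_to_real4 \<tau>_def)
    have "1 + (norm (y2 y / y1 y))\<^sup>2 = (1 / norm (y1 y))\<^sup>2"
      using norms[OF y(1)] pos by (simp add: norm_divide power_divide field_simps)
    then have r: "\<rho> (y2 y / y1 y) = of_real (norm (y1 y))"
      unfolding \<rho>_def using pos by (simp add: real_sqrt_divide)
    have \<tau>1: "\<tau> * y1 y = of_real (norm (y1 y))"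
    proof -
      have "cnj (y1 y) * y1 y = of_real (norm (y1 y)) * of_real (norm (y1 y))"
        by (metis complex_norm_square mult.commute of_real_mult power2_eq_square)
      then show ?thesis using pos by (simp add: \<tau>_def field_simps)
    qed
    have e: "y1 (\<sigma> (\<psi> y)) = y1 (dact \<tau> y)" "y2 (\<sigma> (\<psi> y)) = y2 (dact \<tau> y)"
      unfolding y\<sigma> s yd fst_conv r \<tau>1[symmetric] using y(2) by simp_all
    have "\<sigma> (\<psi> y) = dact \<tau> y"
    proof (rule prod_eqI)
      show "fst (\<sigma> (\<psi> y)) = fst (dact \<tau> y)"
        unfolding vec2_eq_iff unitary_coordinates(1,2)[OF ab y1_def y2_def] e by blast
      show "snd (\<sigma> (\<psi> y)) = snd (dact \<tau> y)" unfolding y\<sigma> s by (simp add: dact_def)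
    qed
    moreover have "norm (snd (of_real4 (\<psi> y))) < 1"
      using y(1) \<tau> unfolding s mem_Z' by (simp add: norm_mult norm_power)
    then have "\<psi> y \<in> V" unfolding V_def by simp
    ultimately show ?thesis using \<tau> pr'_eq_iff by metis
  qed
  have W: "{y \<in> Z'. pr' y \<in> pr' ` \<sigma> ` V} = {y \<in> Z'. y1 y \<noteq> 0}"
  proof (intro equalityI subsetI)
    fix y assume "y \<in> {y \<in> Z'. pr' y \<in> pr' ` \<sigma> ` V}"
    then obtain u where u: "y \<in> Z'" "pr' (\<sigma> u) = pr' y" by auto
    then obtain \<tau> where "norm \<tau> = 1" "y = dact \<tau> (\<sigma> u)" using pr'_eq_iff by blast
    then have "y1 y \<noteq> 0" using \<rho>(1) by (auto simp: yd y\<sigma>)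
    with u show "y \<in> {y \<in> Z'. y1 y \<noteq> 0}" by simp
  next
    fix y assume "y \<in> {y \<in> Z'. y1 y \<noteq> 0}"
    then have "y \<in> Z'" "\<psi> y \<in> V" "pr' y = pr' (\<sigma> (\<psi> y))" using \<sigma>\<psi> by auto
    then show "y \<in> {y \<in> Z'. pr' y \<in> pr' ` \<sigma> ` V}" by blast
  qed
  have "slice Z' pr' V \<sigma> \<psi>"
    unfolding slice_def W
  proof (intro conjI ballI impI)
    have "continuous_on UNIV (\<lambda>u. norm (snd (of_real4 u)))"
      unfolding of_real4_def snd_conv Complex_eq by (intro continuous_intros)
    then show "open V" unfolding V_def by (intro open_Collect_less) auto
    show "smooth_on V \<sigma>"
      unfolding \<sigma>_def Let_def of_real4_def fst_conv snd_conv \<rho>_def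
      by (intro smooth_intros smooth_on_vec2 smooth_on_divide smooth_on_sqrt)
        (auto simp: add_pos_nonneg add_nonneg_eq_0_iff)
    show "\<sigma> ` V \<subseteq> Z'" using \<sigma>Z by blast
    show "\<psi> (\<sigma> u) = u" for u by (rule \<psi>\<sigma>)
    have cy1: "continuous_on Z' y1" unfolding y1_def by (intro continuous_intros)
    have "openin (top_of_set Z') (Z' \<inter> y1 -` (- {0}))"
      by (rule continuous_openin_preimage_gen[OF cy1]) (simp add: open_Compl)
    moreover have "Z' \<inter> y1 -` (- {0}) = {y \<in> Z'. y1 y \<noteq> 0}" by blast
    ultimately show "openin (top_of_set Z') {y \<in> Z'. y1 y \<noteq> 0}" by simp
    have sy: "smooth_on S y1" "smooth_on S y2" for S unfolding y1_def y2_def by (intro smooth_intros)+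
    show "smooth_on {y \<in> Z'. y1 y \<noteq> 0} \<psi>"
      unfolding \<psi>_def
      by (intro smooth_on_linear_compose[OF linear_to_real4] smooth_intros smooth_on_divide sy smooth_on_norm) auto
    show "\<psi> x = \<psi> y" if "pr' x = pr' y" for x y
      using that \<psi>d unfolding pr'_eq_iff by metis
  qed
  moreover have "y0 \<in> \<sigma> ` V"
  proof (rule image_eqI)
    have "a * cnj a + b * cnj b = 1"
      using ab by (metis complex_norm_square of_real_1 of_real_add)
    then have y10: "y1 y0 = 1" "y2 y0 = 0" by (simp_all add: y1_def y2_def a_def[symmetric] b_def[symmetric] mult_ac)
    then have o: "of_real4 (\<psi> y0) = (0, snd y0)" by (simp add: \<psi>_def of_to_real4)
    have "y1 (\<sigma> (\<psi> y0)) = y1 y0" "y2 (\<sigma> (\<psi> y0)) = y2 y0" unfolding y\<sigma> o y10 by (simp_all add: \<rho>_def)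
    then have "fst (\<sigma> (\<psi> y0)) = fst y0"
      unfolding vec2_eq_iff unitary_coordinates(1,2)[OF ab y1_def y2_def] by simp
    then show "y0 = \<sigma> (\<psi> y0)" using y\<sigma>(3) o by (simp add: prod_eq_iff)
    show "\<psi> y0 \<in> V" using \<sigma>\<psi>[OF y0] y10 by simp
  qed
  ultimately show ?thesis by blast
qed

end

context odd_weight begin

section \<open>The equivariant diffeomorphism\<close>

text \<open>On the level set the vector \<open>w\<close> is orthogonal to \<open>z\<close>, so it is the multiple \<open>\<beta>\<close> of the unit
  vector \<open>(- cnj z2, cnj z1) / norm z\<close>, and the norm of \<open>z\<close> is determined by \<open>\<beta>\<close>. Since that unit vector is
  antiholomorphic in \<open>z\<close>, the coefficient \<open>\<beta>\<close> has the weight \<open>(n - 1) + 1 = n\<close>.\<close>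

definition znorm :: "quat \<times> quat \<Rightarrow> real" where
  "znorm x = sqrt ((norm (z1 x))\<^sup>2 + (norm (z2 x))\<^sup>2)"

definition \<Theta> :: "quat \<times> quat \<Rightarrow> (complex^2) \<times> complex" where
  "\<Theta> x = (vec2 (z1 x / of_real (znorm x)) (z2 x / of_real (znorm x)),
     of_real (sqrt n) * ((z1 x * w2 x - z2 x * w1 x) / of_real (znorm x)))"

definition \<Theta>' :: "(complex^2) \<times> complex \<Rightarrow> quat \<times> quat" where
  "\<Theta>' y = (let \<beta> = snd y / of_real (sqrt n); R = of_real (sqrt (level + (norm \<beta>)\<^sup>2)) in
     ((R * fst y $ 1, - \<beta> * cnj (fst y $ 2)), (R * fst y $ 2, \<beta> * cnj (fst y $ 1))))"

lemma znorm_pos: "x \<in> Z \<Longrightarrow> 0 < znorm x"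
  unfolding znorm_def using z_norm_pos by simp

lemma znorm_power2: "(znorm x)\<^sup>2 = (norm (z1 x))\<^sup>2 + (norm (z2 x))\<^sup>2"
  unfolding znorm_def by simp

lemma smooth_\<Theta>: "smooth_on Z \<Theta>"
proof -
  have zn: "smooth_on Z znorm"
    unfolding znorm_def[abs_def]
    by (intro smooth_on_sqrt smooth_on_add smooth_on_norm_power2 smooth_on_fst smooth_on_snd
        smooth_on_ident) (rule z_norm_pos)
  have nz: "complex_of_real (znorm x) \<noteq> 0" if "x \<in> Z" for x using znorm_pos[OF that] by simp
  show ?thesis
    unfolding \<Theta>_def[abs_def]
    by (intro smooth_on_Pair smooth_on_vec2 smooth_on_divide smooth_on_complex_of_real zn smooth_on_fst
        smooth_on_snd smooth_on_ident smooth_on_mult smooth_on_const smooth_on_diff) (erule nz)+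
qed

lemma smooth_\<Theta>': "smooth_on S \<Theta>'"
proof -
  have s: "smooth_on S (\<lambda>y :: (complex^2) \<times> complex. snd y / complex_of_real (sqrt n))"
    using gt by (intro smooth_on_divide smooth_on_snd smooth_on_ident smooth_on_const) simp
  have "0 < level + (norm z)\<^sup>2" for z :: complex using level_pos by (simp add: add_pos_nonneg)
  then have R: "smooth_on S (\<lambda>y. complex_of_real (sqrt (level + (norm (snd y / complex_of_real (sqrt n)))\<^sup>2)))"
    by (intro smooth_on_complex_of_real smooth_on_sqrt smooth_on_add smooth_on_const smooth_on_norm_power2 s)
  show ?thesis
    unfolding \<Theta>'_def[abs_def] Let_def
    by (intro smooth_on_Pair smooth_on_mult smooth_on_uminus smooth_on_cnj smooth_on_nth s R
        smooth_on_fst smooth_on_ident)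
qed

text \<open>By the Lagrange identity, since the first component of w in the basis given by z is zero.\<close>

lemma fibre_norm:
  assumes "x \<in> Z"
  shows "(norm (z1 x * w2 x - z2 x * w1 x))\<^sup>2 = (znorm x)\<^sup>2 * ((znorm x)\<^sup>2 - level)"
proof -
  have x: "(norm (w1 x))\<^sup>2 + (norm (w2 x))\<^sup>2 = (znorm x)\<^sup>2 - level"
    "cnj (z1 x) * w1 x + cnj (z2 x) * w2 x = 0"
    using assms unfolding mem_Z znorm_power2 by auto
  show ?thesis
    using lagrange_identity[of "z1 x" "w1 x" "z2 x" "w2 x"] unfolding x znorm_power2[symmetric] by simp
qed

lemma \<Theta>_Z': assumes x: "x \<in> Z" shows "\<Theta> x \<in> Z'"
proof -
  define r where "r = znorm x"
  have r: "0 < r" using znorm_pos[OF x] by (simp add: r_def)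
  have r2: "r\<^sup>2 = (norm (z1 x))\<^sup>2 + (norm (z2 x))\<^sup>2" by (simp add: r_def znorm_power2)
  have "(norm x)\<^sup>2 < 1" "(norm (w1 x))\<^sup>2 + (norm (w2 x))\<^sup>2 = r\<^sup>2 - level"
    using x unfolding mem_Z r2 by auto
  then have "2 * r\<^sup>2 < 1 + level" unfolding norm_quat_pair using r2 by simp
  then have "real n * (2 * r\<^sup>2) < real n * (1 + level)" using gt by (intro mult_strict_left_mono) auto
  moreover have "real n * level = real n - 2" using gt by (simp add: level_def)
  ultimately have lt: "real n * (r\<^sup>2 - level) < 1" by (simp add: algebra_simps)
  have "(norm (of_real (sqrt n) * ((z1 x * w2 x - z2 x * w1 x) / of_real r)))\<^sup>2 = real n * (r\<^sup>2 - level)"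
    unfolding norm_mult norm_divide power_mult_distrib power_divide using fibre_norm[OF x] r
    by (simp add: r_def)
  also note lt
  finally have "norm (snd (\<Theta> x)) < 1" unfolding norm_less_one_iff_power2 by (simp add: \<Theta>_def r_def)
  moreover have "(norm (z1 x / of_real r))\<^sup>2 + (norm (z2 x / of_real r))\<^sup>2 = 1"
    unfolding norm_divide power_divide add_divide_distrib[symmetric] using r by (simp add: r2[symmetric])
  ultimately show ?thesis unfolding mem_Z' by (simp add: \<Theta>_def vec2_nth r_def)
qed

lemma \<Theta>'_components:
  assumes y: "y \<in> Z'"
  defines "\<beta> \<equiv> snd y / of_real (sqrt n)" and "a \<equiv> fst y $ 1" and "b \<equiv> fst y $ 2"
  defines "R \<equiv> sqrt (level + (norm (snd y / of_real (sqrt n)))\<^sup>2)"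
  shows "\<Theta>' y = ((of_real R * a, - \<beta> * cnj b), (of_real R * b, \<beta> * cnj a))"
    "(norm a)\<^sup>2 + (norm b)\<^sup>2 = 1" "0 < R" "R\<^sup>2 = level + (norm \<beta>)\<^sup>2" "(norm \<beta>)\<^sup>2 < 1 / real n"
proof -
  show "\<Theta>' y = ((of_real R * a, - \<beta> * cnj b), (of_real R * b, \<beta> * cnj a))"
    by (simp add: \<Theta>'_def Let_def \<beta>_def a_def b_def R_def)
  show "(norm a)\<^sup>2 + (norm b)\<^sup>2 = 1" using y unfolding mem_Z' a_def b_def by simp
  have "0 < level + (norm \<beta>)\<^sup>2" using level_pos by (simp add: add_pos_nonneg)
  then show "0 < R" "R\<^sup>2 = level + (norm \<beta>)\<^sup>2" unfolding R_def \<beta>_def[symmetric] by simp_all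
  have "(norm (snd y))\<^sup>2 < 1" using y unfolding mem_Z' norm_less_one_iff_power2 by simp
  then show "(norm \<beta>)\<^sup>2 < 1 / real n"
    using gt unfolding \<beta>_def norm_divide power_divide by (simp add: divide_strict_right_mono)
qed

lemma \<Theta>'_Z: assumes y: "y \<in> Z'" shows "\<Theta>' y \<in> Z"
proof -
  define \<beta> where "\<beta> = snd y / of_real (sqrt n)"
  define a where "a = fst y $ 1"
  define b where "b = fst y $ 2"
  define R where "R = sqrt (level + (norm (snd y / of_real (sqrt n)))\<^sup>2)"
  note c = \<Theta>'_components[OF y, folded \<beta>_def a_def b_def R_def]
  have z: "(norm (of_real R * a))\<^sup>2 + (norm (of_real R * b))\<^sup>2 = R\<^sup>2"
  proof -
    have "(norm (of_real R * a))\<^sup>2 + (norm (of_real R * b))\<^sup>2 = R\<^sup>2 * ((norm a)\<^sup>2 + (norm b)\<^sup>2)"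
      by (simp add: norm_mult power_mult_distrib algebra_simps)
    then show ?thesis unfolding c(2) by simp
  qed
  have w: "(norm (- \<beta> * cnj b))\<^sup>2 + (norm (\<beta> * cnj a))\<^sup>2 = (norm \<beta>)\<^sup>2"
  proof -
    have "(norm (- \<beta> * cnj b))\<^sup>2 + (norm (\<beta> * cnj a))\<^sup>2 = (norm \<beta>)\<^sup>2 * ((norm a)\<^sup>2 + (norm b)\<^sup>2)"
      by (simp add: norm_mult power_mult_distrib algebra_simps)
    then show ?thesis unfolding c(2) by simp
  qed
  have "level + 2 * (1 / real n) = 1" using gt by (simp add: level_def field_simps)
  then have lt: "level + 2 * (norm \<beta>)\<^sup>2 < 1" using c(5) by linarith
  have "cnj (of_real R * a) * (- \<beta> * cnj b) + cnj (of_real R * b) * (\<beta> * cnj a) = 0"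
    by simp
  then show ?thesis
    unfolding mem_Z norm_quat_pair c(1) fst_conv snd_conv using z w c(4) lt by auto
qed

lemma \<Theta>'_\<Theta>: assumes x: "x \<in> Z" shows "\<Theta>' (\<Theta> x) = x"
proof -
  define r where "r = znorm x"
  have r: "0 < r" using znorm_pos[OF x] by (simp add: r_def)
  define d where "d = z1 x * w2 x - z2 x * w1 x"
  have n: "complex_of_real (sqrt n) \<noteq> 0" using gt by simp
  have \<beta>: "snd (\<Theta> x) / of_real (sqrt n) = d / of_real r" using n by (simp add: \<Theta>_def d_def r_def)
  have "(norm (d / of_real r))\<^sup>2 = r\<^sup>2 - level"
    unfolding norm_divide power_divide d_def fibre_norm[OF x] r_def[symmetric] using r by simp
  then have R: "sqrt (level + (norm (d / of_real r))\<^sup>2) = r" using r by simp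
  have rr: "of_real r * of_real r = z1 x * cnj (z1 x) + z2 x * cnj (z2 x)"
  proof -
    have "complex_of_real (r\<^sup>2) = z1 x * cnj (z1 x) + z2 x * cnj (z2 x)"
      unfolding r_def znorm_power2 of_real_add complex_norm_square ..
    then show ?thesis by (simp add: power2_eq_square)
  qed
  have ort: "cnj (z1 x) * w1 x + cnj (z2 x) * w2 x = 0" using x unfolding mem_Z by blast
  have "- d * cnj (z2 x) = w1 x * (of_real r * of_real r)" "d * cnj (z1 x) = w2 x * (of_real r * of_real r)"
    unfolding rr d_def using ort by algebra+
  then have w: "- (d / of_real r) * cnj (z2 x / of_real r) = w1 x" "(d / of_real r) * cnj (z1 x / of_real r) = w2 x"
    using r by (simp_all add: field_simps)
  have v: "fst (\<Theta> x) $ 1 = z1 x / of_real r" "fst (\<Theta> x) $ 2 = z2 x / of_real r"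
    by (simp_all add: \<Theta>_def vec2_nth r_def)
  have "\<Theta>' (\<Theta> x) = ((z1 x, w1 x), (z2 x, w2 x))"
    unfolding \<Theta>'_def Let_def \<beta> R v w using r by simp
  then show ?thesis by simp
qed

lemma \<Theta>_\<Theta>': assumes y: "y \<in> Z'" shows "\<Theta> (\<Theta>' y) = y"
proof -
  define \<beta> where "\<beta> = snd y / of_real (sqrt n)"
  define a where "a = fst y $ 1"
  define b where "b = fst y $ 2"
  define R where "R = sqrt (level + (norm (snd y / of_real (sqrt n)))\<^sup>2)"
  note c = \<Theta>'_components[OF y, folded \<beta>_def a_def b_def R_def]
  have "(znorm (\<Theta>' y))\<^sup>2 = R\<^sup>2 * ((norm a)\<^sup>2 + (norm b)\<^sup>2)"
    unfolding znorm_power2 c(1) by (simp add: norm_mult power_mult_distrib algebra_simps)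
  then have zn: "znorm (\<Theta>' y) = R" unfolding c(2) using c(3) by (simp add: znorm_def)
  have "complex_of_real ((norm a)\<^sup>2 + (norm b)\<^sup>2) = 1" using c(2) by simp
  then have 1: "a * cnj a + b * cnj b = 1" by (simp only: of_real_add complex_norm_square)
  have "of_real R * a * (\<beta> * cnj a) - of_real R * b * (- \<beta> * cnj b) = of_real R * \<beta> * (a * cnj a + b * cnj b)"
    by (simp add: algebra_simps)
  then have f: "(of_real R * a * (\<beta> * cnj a) - of_real R * b * (- \<beta> * cnj b)) / of_real R = \<beta>"
    unfolding 1 using c(3) by simp
  have "complex_of_real (sqrt n) * \<beta> = snd y" using gt by (simp add: \<beta>_def)
  moreover have "vec2 (of_real R * a / of_real R) (of_real R * b / of_real R) = fst y"
    unfolding vec2_eq_iff vec2_nth using c(3) by (simp add: a_def b_def)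
  ultimately show ?thesis
    unfolding \<Theta>_def zn unfolding c(1) fst_conv snd_conv f by (simp add: prod_eq_iff)
qed

lemma \<Theta>_act: assumes "norm \<tau> = 1" shows "\<Theta> (act \<tau> x) = dact \<tau> (\<Theta> x)"
proof -
  have zn: "znorm (act \<tau> x) = znorm x" using assms by (simp add: znorm_def act_def norm_mult)
  have "\<tau> * \<tau> ^ (n - 1) = \<tau> ^ n" using gt by (metis Suc_diff_1 less_trans pos2 power_Suc)
  moreover have "\<tau> * z1 x * (\<tau> ^ (n - 1) * w2 x) - \<tau> * z2 x * (\<tau> ^ (n - 1) * w1 x) =
      (\<tau> * \<tau> ^ (n - 1)) * (z1 x * w2 x - z2 x * w1 x)" by (simp add: algebra_simps)
  ultimately have "\<tau> * z1 x * (\<tau> ^ (n - 1) * w2 x) - \<tau> * z2 x * (\<tau> ^ (n - 1) * w1 x) =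
      \<tau> ^ n * (z1 x * w2 x - z2 x * w1 x)" by (simp only:)
  then show ?thesis
    unfolding \<Theta>_def dact_def zn by (simp add: act_def vec2_eq_iff vec2_nth)
qed

lemma orbit_\<Theta>: assumes "x \<in> Z" "y \<in> Z" shows "pr x = pr y \<longleftrightarrow> pr' (\<Theta> x) = pr' (\<Theta> y)"
proof
  assume "pr x = pr y"
  then obtain \<tau> where "norm \<tau> = 1" "y = act \<tau> x" unfolding pr_eq_iff by blast
  then have "norm \<tau> = 1 \<and> \<Theta> y = dact \<tau> (\<Theta> x)" using \<Theta>_act by simp
  then show "pr' (\<Theta> x) = pr' (\<Theta> y)" unfolding pr'_eq_iff by blast
next
  assume "pr' (\<Theta> x) = pr' (\<Theta> y)"
  then obtain \<tau> where \<tau>: "norm \<tau> = 1" "\<Theta> y = \<Theta> (act \<tau> x)" unfolding pr'_eq_iff using \<Theta>_act by metis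
  then have "\<Theta>' (\<Theta> y) = \<Theta>' (\<Theta> (act \<tau> x))" by simp
  then have "y = act \<tau> x" using \<Theta>'_\<Theta> assms act_Z[OF \<tau>(1)] by simp
  then show "pr x = pr y" using \<tau>(1) pr_eq_iff by blast
qed

section \<open>Invariant functions\<close>

text \<open>The products of coordinates of z with conjugates of coordinates of z determine z up to a phase. Once
  the phase is chosen, the products of a coordinate of w with the power \<open>n - 1\<close> of the conjugate of a
  nonzero coordinate of z determine w. So these functions separate the orbits.\<close>

definition invariant_functions :: "(quat \<times> quat \<Rightarrow> complex) set" where
  "invariant_functions = {\<lambda>x. L x * cnj (K x) ^ m | L K m.
     K \<in> {z1, z2} \<and> (L \<in> {z1, z2} \<and> m = 1 \<or> L \<in> {w1, w2} \<and> m = n - 1)}"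

lemma invariant_functionsE:
  assumes "h \<in> invariant_functions"
  obtains L K m where "h = (\<lambda>x. L x * cnj (K x) ^ m)" "bounded_linear L" "bounded_linear K"
    "\<And>x. norm (L x) \<le> norm x" "\<And>x. norm (K x) \<le> norm x"
    "\<And>\<tau> x. norm \<tau> = 1 \<Longrightarrow> h (act \<tau> x) = h x"
proof -
  from assms obtain L K m where h: "h = (\<lambda>x. L x * cnj (K x) ^ m)" and K: "K \<in> {z1, z2}"
    and L: "L \<in> {z1, z2} \<and> m = 1 \<or> L \<in> {w1, w2} \<and> m = n - 1"
    unfolding invariant_functions_def mem_Collect_eq by (elim exE conjE)
  have lin: "bounded_linear z1" "bounded_linear z2" "bounded_linear w1" "bounded_linear w2"
    by (auto intro!: bounded_linear_intros bounded_linear_fst_comp bounded_linear_snd_comp)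
  have norm: "norm (z1 x) \<le> norm x" "norm (z2 x) \<le> norm x" "norm (w1 x) \<le> norm x" "norm (w2 x) \<le> norm x"
    for x :: "quat \<times> quat"
  proof -
    have "norm (fst x) \<le> norm x" "norm (snd x) \<le> norm x"
      by (metis norm_fst_le prod.collapse, metis norm_snd_le prod.collapse)
    moreover have "norm (fst y) \<le> norm y" "norm (snd y) \<le> norm y" for y :: quat
      by (metis norm_fst_le prod.collapse, metis norm_snd_le prod.collapse)
    ultimately show "norm (z1 x) \<le> norm x" "norm (z2 x) \<le> norm x" "norm (w1 x) \<le> norm x" "norm (w2 x) \<le> norm x"
      by (meson order.trans)+
  qed
  have inv: "h (act \<tau> x) = h x" if \<tau>: "norm \<tau> = 1" for \<tau> x
  proof -
    have 1: "\<tau> * cnj \<tau> = 1" using \<tau> by (metis complex_norm_square of_real_1 power_one)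
    have k: "L (act \<tau> x) = \<tau> ^ m * L x" "K (act \<tau> x) = \<tau> * K x"
      using L K by (auto simp: act_def)
    have "h (act \<tau> x) = (\<tau> * cnj \<tau>) ^ m * h x"
      unfolding h k by (simp add: power_mult_distrib mult_ac)
    then show ?thesis unfolding 1 by simp
  qed
  show thesis
    by (rule that[OF h _ _ _ _ inv]) (use L K lin norm in auto)
qed

lemma invariant_functions_separate:
  assumes x: "x \<in> Z" and y: "y \<in> Z" and eq: "\<And>h. h \<in> invariant_functions \<Longrightarrow> h x = h y"
  shows "pr x = pr y"
proof -
  have zz: "L x * cnj (K x) = L y * cnj (K y)" if "L \<in> {z1, z2}" "K \<in> {z1, z2}" for L K
  proof -
    have "(\<lambda>x. L x * cnj (K x) ^ 1) \<in> invariant_functions"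
      unfolding invariant_functions_def mem_Collect_eq
      by (rule exI[of _ L], rule exI[of _ K], rule exI[of _ 1]) (intro conjI refl that disjI1)
    from eq[OF this] show ?thesis by simp
  qed
  have wz: "L x * cnj (K x) ^ (n - 1) = L y * cnj (K y) ^ (n - 1)" if "L \<in> {w1, w2}" "K \<in> {z1, z2}" for L K
  proof -
    have "(\<lambda>x. L x * cnj (K x) ^ (n - 1)) \<in> invariant_functions"
      unfolding invariant_functions_def mem_Collect_eq
      by (rule exI[of _ L], rule exI[of _ K], rule exI[of _ "n - 1"]) (intro conjI refl that disjI2)
    from eq[OF this] show ?thesis .
  qed
  have "z1 x \<noteq> 0 \<or> z2 x \<noteq> 0" using z_norm_pos[OF x] by auto
  then have "\<exists>K. K \<in> {z1, z2} \<and> K x \<noteq> 0" by (elim disjE) (rule exI[of _ z1], simp, rule exI[of _ z2], simp)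
  then obtain K where K: "K \<in> {z1, z2}" "K x \<noteq> 0" by blast
  have "K x * cnj (K x) = K y * cnj (K y)" by (rule zz[OF K(1,1)])
  then have nK: "norm (K x) = norm (K y)"
    by (metis complex_norm_square norm_ge_zero of_real_eq_iff power2_eq_imp_eq)
  define \<tau> where "\<tau> = K y / K x"
  have \<tau>: "norm \<tau> = 1" unfolding \<tau>_def norm_divide nK[symmetric] using K(2) by simp
  have Ky: "K y = \<tau> * K x" unfolding \<tau>_def using K(2) by simp
  have t: "\<tau> * cnj \<tau> = 1" using \<tau> by (metis complex_norm_square of_real_1 power_one)
  have cK: "cnj (K x) = \<tau> * cnj (K y)" unfolding Ky complex_cnj_mult using t by (simp add: mult.assoc[symmetric])
  have "norm (K y) \<noteq> 0" using K(2) unfolding nK[symmetric] by simp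
  then have cKy: "cnj (K y) \<noteq> 0" by simp
  have z: "L y = \<tau> * L x" if "L \<in> {z1, z2}" for L
    using zz[OF that K(1)] cKy unfolding cK by (simp add: mult_ac)
  have w: "L y = \<tau> ^ (n - 1) * L x" if "L \<in> {w1, w2}" for L
    using wz[OF that K(1)] cKy unfolding cK power_mult_distrib by (simp add: mult_ac)
  have "y = act \<tau> x"
    unfolding act_def prod_eq_iff fst_conv snd_conv
    using z[of z1] z[of z2] w[of w1] w[of w2] by simp
  then show ?thesis using \<tau> pr_eq_iff by blast
qed

text \<open>The functions are products of linear forms and their conjugates, and these are bounded by 1 on the
  ball.\<close>

lemma invariant_function_derivative:
  assumes "h \<in> invariant_functions"
  obtains h' C where "C > 0" "\<And>x. (h has_derivative h' x) (at x)"
    "\<And>x v. norm x < 1 \<Longrightarrow> norm (h' x v) \<le> C * norm v"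
proof -
  obtain L K m where h: "h = (\<lambda>x. L x * cnj (K x) ^ m)" and bl: "bounded_linear L" "bounded_linear K"
    and nL: "\<And>x. norm (L x) \<le> norm x" and nK: "\<And>x. norm (K x) \<le> norm x"
    using assms by (rule invariant_functionsE) blast
  let ?h' = "\<lambda>x v. L x * (of_nat m * cnj (K v) * cnj (K x) ^ (m - 1)) + L v * cnj (K x) ^ m"
  have "(h has_derivative ?h' x) (at x)" for x
  proof -
    have L: "(L has_derivative L) (at x)" and K: "((\<lambda>x. cnj (K x)) has_derivative (\<lambda>v. cnj (K v))) (at x)"
      using bl bounded_linear_compose[OF bounded_linear_cnj bl(2)]
      by (auto intro: bounded_linear_imp_has_derivative)
    show ?thesis unfolding h by (rule has_derivative_mult[OF L has_derivative_power[OF K]])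
  qed
  moreover have "norm (?h' x v) \<le> (real m + 1) * norm v" if x: "norm x < 1" for x v
  proof -
    have p: "norm (cnj (K x) ^ k) \<le> 1" for k
      using nK[of x] x by (simp add: norm_power power_le_one)
    have "norm (?h' x v) \<le> norm (L x) * (real m * norm (K v) * norm (cnj (K x) ^ (m - 1))) + norm (L v) * norm (cnj (K x) ^ m)"
      by (rule order.trans[OF norm_triangle_ineq]) (simp add: norm_mult)
    also have "\<dots> \<le> 1 * (real m * norm v * 1) + norm v * 1"
      using nL[of x] nL[of v] nK[of v] p x by (intro add_mono mult_mono) auto
    finally show ?thesis by (simp add: algebra_simps)
  qed
  ultimately show thesis by (intro that[of "real m + 1" ?h']) auto
qed

lemma invariant_function_continuous: "h \<in> invariant_functions \<Longrightarrow> continuous_on S h"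
  by (rule invariant_function_derivative)
    (auto intro!: continuous_at_imp_continuous_on has_derivative_continuous)

lemma invariant_function_orbit:
  assumes "h \<in> invariant_functions" "pr x = pr y" shows "h x = h y"
proof -
  obtain \<tau> where \<tau>: "norm \<tau> = 1" "y = act \<tau> x" using assms(2) unfolding pr_eq_iff by blast
  have "h (act \<tau> x) = h x" by (rule invariant_functionsE[OF assms(1)]) (use \<tau>(1) in blast)
  then show ?thesis using \<tau>(2) by simp
qed

sublocale M: smooth_quotient Z pr
proof
  fix x assume x: "x \<in> Z"
  obtain V \<sigma> \<psi> where sl: "slice Z' pr' V \<sigma> \<psi>" "\<Theta> x \<in> \<sigma> ` V"
    using disk_bundle_slice[OF \<Theta>_Z'[OF x]] by blast
  have "slice Z pr V (\<lambda>u. \<Theta>' (\<sigma> u)) (\<lambda>x. \<psi> (\<Theta> x))"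
    by (rule slice_transfer[OF sl(1) smooth_\<Theta> _ smooth_\<Theta>' _ \<Theta>_\<Theta>' orbit_\<Theta>]) (use \<Theta>_Z' \<Theta>'_Z in auto)
  moreover have "x \<in> (\<lambda>u. \<Theta>' (\<sigma> u)) ` V" using sl(2) \<Theta>'_\<Theta>[OF x] by (metis (no_types, lifting) image_iff)
  ultimately show "\<exists>V \<sigma> \<psi>. slice Z pr V \<sigma> \<psi> \<and> x \<in> \<sigma> ` V" by blast
next
  fix x y assume "x \<in> Z" "y \<in> Z" "pr x = pr y"
  then obtain \<tau> where \<tau>: "norm \<tau> = 1" "y = act \<tau> x" unfolding pr_eq_iff by blast
  have "continuous_on Z (act \<tau>)" by (rule linear_continuous_on) (rule linear_act[unfolded linear_conv_bounded_linear])
  then show "\<exists>\<Phi>. continuous_on Z \<Phi> \<and> \<Phi> ` Z \<subseteq> Z \<and> (\<forall>z\<in>Z. pr (\<Phi> z) = pr z) \<and> \<Phi> x = y"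
    using act_Z[OF \<tau>(1)] pr_act[OF \<tau>(1)] \<tau>(2) by (intro exI[of _ "act \<tau>"]) auto
next
  fix x y assume "x \<in> Z" "y \<in> Z" "pr x \<noteq> pr y"
  then obtain h where "h \<in> invariant_functions" "h x \<noteq> h y" using invariant_functions_separate by blast
  then show "\<exists>h :: quat \<times> quat \<Rightarrow> complex. continuous_on Z h \<and>
      (\<forall>z\<in>Z. \<forall>z'\<in>Z. pr z = pr z' \<longrightarrow> h z = h z') \<and> h x \<noteq> h y"
    using invariant_function_continuous invariant_function_orbit by blast
qed

sublocale L: smooth_quotient Z' pr'
proof
  fix y assume "y \<in> Z'"
  then show "\<exists>V \<sigma> \<psi>. slice Z' pr' V \<sigma> \<psi> \<and> y \<in> \<sigma> ` V" by (rule disk_bundle_slice)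
next
  fix x y assume "x \<in> Z'" "y \<in> Z'" "pr' x = pr' y"
  then obtain \<tau> where \<tau>: "norm \<tau> = 1" "y = dact \<tau> x" unfolding pr'_eq_iff by blast
  have "pr' (dact \<tau> z) = pr' z" for z using pr'_eq_iff \<tau>(1) by metis
  moreover have "continuous_on Z' (dact \<tau>)"
    unfolding dact_def[abs_def] vector_scalar_mult_def by (intro continuous_intros)
  ultimately show "\<exists>\<Phi>. continuous_on Z' \<Phi> \<and> \<Phi> ` Z' \<subseteq> Z' \<and> (\<forall>z\<in>Z'. pr' (\<Phi> z) = pr' z) \<and> \<Phi> x = y"
    using dact_Z'[OF \<tau>(1)] \<tau>(2) by (intro exI[of _ "dact \<tau>"]) auto
next
  fix x y assume xy: "x \<in> Z'" "y \<in> Z'" "pr' x \<noteq> pr' y"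
  have orb: "pr (\<Theta>' x) = pr (\<Theta>' y) \<longleftrightarrow> pr' x = pr' y" if "x \<in> Z'" "y \<in> Z'" for x y
    using orbit_\<Theta>[OF \<Theta>'_Z \<Theta>'_Z, OF that] \<Theta>_\<Theta>' that by simp
  then obtain h where h: "h \<in> invariant_functions" "h (\<Theta>' x) \<noteq> h (\<Theta>' y)"
    using invariant_functions_separate[OF \<Theta>'_Z \<Theta>'_Z] xy by metis
  have "continuous_on Z' (\<lambda>y. h (\<Theta>' y))"
    by (rule continuous_on_compose2[OF invariant_function_continuous[OF h(1), of UNIV]
          smooth_on_imp_continuous_on[OF smooth_\<Theta>']]) simp
  then show "\<exists>h :: (complex^2) \<times> complex \<Rightarrow> complex. continuous_on Z' h \<and>
      (\<forall>z\<in>Z'. \<forall>z'\<in>Z'. pr' z = pr' z' \<longrightarrow> h z = h z') \<and> h x \<noteq> h y"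
    using h orb invariant_function_orbit by (intro exI[of _ "\<lambda>y. h (\<Theta>' y)"]) blast
qed

lemma quotient_diffeomorphism: "\<exists>F. diffeomorphism M.X M.A L.X L.A F"
proof (rule exI, rule diffeomorphism_induced[OF M.smooth_quotient_axioms L.smooth_quotient_axioms
      smooth_\<Theta> _ _ smooth_\<Theta>'])
  show "\<Theta> ` Z \<subseteq> Z'" "\<Theta>' ` Z' \<subseteq> Z" using \<Theta>_Z' \<Theta>'_Z by blast+
  show "pr' (\<Theta> (M.rep (pr x))) = pr' (\<Theta> x)" if "x \<in> Z" for x
    using orbit_\<Theta>[of "M.rep (pr x)" x] M.rep[of "pr x"] that by blast
  show "pr (\<Theta>' (L.rep (pr' y))) = pr (\<Theta>' y)" if "y \<in> Z'" for y
  proof -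
    have r: "L.rep (pr' y) \<in> Z'" "pr' (L.rep (pr' y)) = pr' y" using L.rep[of "pr' y"] that by blast+
    show ?thesis using orbit_\<Theta>[OF \<Theta>'_Z[OF r(1)] \<Theta>'_Z[OF that]] r \<Theta>_\<Theta>' that by simp
  qed
qed (fact \<Theta>'_\<Theta> \<Theta>_\<Theta>')+

end

section \<open>The zero set of the moment map is a submanifold\<close>

lemma dim_coordinate_subspace:
  "subspace {y :: quat \<times> quat. Re (z1 y) = 0 \<and> z2 y = 0}"
  "dim {y :: quat \<times> quat. Re (z1 y) = 0 \<and> z2 y = 0} = 5"
proof -
  let ?S = "{y :: quat \<times> quat. Re (z1 y) = 0 \<and> z2 y = 0}"
  show "subspace ?S" unfolding subspace_def by simp
  define L :: "real \<times> complex \<times> complex \<Rightarrow> quat \<times> quat"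
    where "L u = ((\<i> * of_real (fst u), fst (snd u)), (0, snd (snd u)))" for u
  have lin: "linear L" by (rule linearI) (simp_all add: L_def algebra_simps scaleR_conv_of_real)
  have "inj L" by (rule injI) (simp add: L_def prod_eq_iff)
  then have "dim (L ` UNIV) = dim (UNIV :: (real \<times> complex \<times> complex) set)"
    using lin by (intro dim_image_eq) (auto intro: inj_on_subset)
  moreover have "L ` UNIV = ?S"
  proof (intro equalityI subsetI)
    fix y assume "y \<in> ?S"
    then have "y = L (Im (z1 y), w1 y, w2 y)" by (simp add: L_def prod_eq_iff complex_eq_iff)
    then show "y \<in> L ` UNIV" by blast
  qed (auto simp: L_def)
  ultimately show "dim ?S = 5" by simp
qed

context odd_weight begin

text \<open>Near a given point the coordinates are: the value of the moment map along i in place of the real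
  part of the coordinate of z along the given unit vector (the latter is recovered as a positive
  square root), the rest of z, and the coordinates of w in the unitary basis given by z. The first of
  the latter is the other component of the moment map.\<close>

lemma submanifold_Z: "smooth_submanifold 5 Z"
  unfolding smooth_submanifold_def
proof
  fix x0 assume x0: "x0 \<in> Z"
  define a where "a = z1 x0 / of_real (znorm x0)"
  define b where "b = z2 x0 / of_real (znorm x0)"
  have ab: "(norm a)\<^sup>2 + (norm b)\<^sup>2 = 1"
    using \<Theta>_Z'[OF x0] unfolding mem_Z' by (simp add: \<Theta>_def vec2_nth a_def b_def)
  define y1 where "y1 x = cnj a * z1 x + cnj b * z2 x" for x
  define y2 where "y2 x = a * z2 x - b * z1 x" for x
  define U where "U = {x :: quat \<times> quat. norm x < 1 \<and> 0 < Re (y1 x)}"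
  define \<rho> where "\<rho> x = (norm (z1 x))\<^sup>2 + (norm (z2 x))\<^sup>2 - (norm (w1 x))\<^sup>2 - (norm (w2 x))\<^sup>2 - level" for x
  define fr where "fr r c d w v = (cnj (c / of_real r) * w + cnj (d / of_real r) * v,
      (c / of_real r) * v - (d / of_real r) * w)" for r :: real and c d w v
  define F where "F x = ((Complex (\<rho> x) (Im (y1 x)), y2 x), fr (znorm x) (z1 x) (z2 x) (w1 x) (w2 x))" for x
  \<comment> \<open>In terms of the coordinates of y, the value of \<open>|z|\<^sup>2\<close> is \<open>R2 y\<close>, the coordinate of z along
    \<open>(a, b)\<close> is \<open>Y1 y\<close>, and \<open>(P y, Q y)\<close> is the unit vector in the direction of z.\<close>
  define R2 where "R2 y = Re (z1 y) + level + (norm (z2 y))\<^sup>2 + (norm (w2 y))\<^sup>2" for y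
  define Y1 where "Y1 y = Complex (sqrt (R2 y - (Im (z1 y))\<^sup>2 - (norm (w1 y))\<^sup>2)) (Im (z1 y))" for y
  define Za where "Za y = a * Y1 y - cnj b * w1 y" for y
  define Zb where "Zb y = b * Y1 y + cnj a * w1 y" for y
  define P where "P y = Za y / of_real (sqrt (R2 y))" for y
  define Q where "Q y = Zb y / of_real (sqrt (R2 y))" for y
  define F' where "F' y = ((Za y, P y * z2 y - cnj (Q y) * w2 y), (Zb y, Q y * z2 y + cnj (P y) * w2 y))" for y
  define T where "T = {y :: quat \<times> quat. (Im (z1 y))\<^sup>2 + (norm (w1 y))\<^sup>2 < R2 y \<and>
      R2 y + (norm (z2 y))\<^sup>2 + (norm (w2 y))\<^sup>2 < 1}"
  define S where "S = {y :: quat \<times> quat. Re (z1 y) = 0 \<and> z2 y = 0}"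
  have unit: "(norm (c / of_real r))\<^sup>2 + (norm (d / of_real r))\<^sup>2 = 1"
    if "0 < r" "(norm c)\<^sup>2 + (norm d)\<^sup>2 = r\<^sup>2" for r and c d :: complex
    unfolding norm_divide power_divide add_divide_distrib[symmetric] using that by simp
  have zn: "0 < znorm x" "(znorm x)\<^sup>2 = (norm (y1 x))\<^sup>2 + (norm (y2 x))\<^sup>2" if "x \<in> U" for x
  proof -
    show e: "(znorm x)\<^sup>2 = (norm (y1 x))\<^sup>2 + (norm (y2 x))\<^sup>2"
      unfolding znorm_power2 by (rule unitary_coordinates(3)[OF ab y1_def y2_def])
    have "y1 x \<noteq> 0" using that unfolding U_def by auto
    then have "0 < (znorm x)\<^sup>2" unfolding e by (simp add: add_pos_nonneg)
    then show "0 < znorm x" unfolding znorm_def by simp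
  qed
  have F: "F x \<in> T \<and> F' (F x) = x" if x: "x \<in> U" for x
  proof -
    note r = zn[OF x]
    have u: "(norm (z1 x / of_real (znorm x)))\<^sup>2 + (norm (z2 x / of_real (znorm x)))\<^sup>2 = 1"
      by (rule unit[OF r(1)]) (simp add: znorm_power2)
    have f: "z2 (F x) = cnj (z1 x / of_real (znorm x)) * w1 x + cnj (z2 x / of_real (znorm x)) * w2 x"
      "w2 (F x) = (z1 x / of_real (znorm x)) * w2 x - (z2 x / of_real (znorm x)) * w1 x"
      "w1 (F x) = y2 x" "Re (z1 (F x)) = \<rho> x" "Im (z1 (F x)) = Im (y1 x)"
      by (simp_all add: F_def fr_def)
    note w = unitary_coordinates[OF u f(1,2)]
    have R2: "R2 (F x) = (znorm x)\<^sup>2"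
      unfolding R2_def f(4) \<rho>_def znorm_power2 using w(3) by simp
    have re: "R2 (F x) - (Im (z1 (F x)))\<^sup>2 - (norm (w1 (F x)))\<^sup>2 = (Re (y1 x))\<^sup>2"
      unfolding R2 r(2) f by (simp add: cmod_power2)
    have pos: "0 < Re (y1 x)" "norm x < 1" using x unfolding U_def by simp_all
    have "sqrt (R2 (F x) - (Im (z1 (F x)))\<^sup>2 - (norm (w1 (F x)))\<^sup>2) = Re (y1 x)"
      unfolding re using pos(1) by simp
    then have "Y1 (F x) = y1 x" unfolding Y1_def by (simp add: f(5) complex_eq_iff)
    then have Z: "Za (F x) = z1 x" "Zb (F x) = z2 x"
      unfolding Za_def Zb_def f(3) using unitary_coordinates(1,2)[OF ab y1_def y2_def, of x] by simp_all
    have s: "sqrt (R2 (F x)) = znorm x" unfolding R2 using r(1) by simp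
    have "F' (F x) = ((z1 x, w1 x), (z2 x, w2 x))"
      unfolding F'_def P_def Q_def Z s by (simp only: w(1,2)[symmetric])
    then have "F' (F x) = x" by simp
    moreover have "F x \<in> T"
    proof -
      have "0 < (Re (y1 x))\<^sup>2" using pos(1) by simp
      moreover have "R2 (F x) + (norm (z2 (F x)))\<^sup>2 + (norm (w2 (F x)))\<^sup>2 = (norm x)\<^sup>2"
        unfolding R2 znorm_power2 norm_quat_pair[of x] using w(3) by simp
      moreover have "(norm x)\<^sup>2 < 1" using pos(2) by (simp add: norm_less_one_iff_power2)
      ultimately have "(Im (z1 (F x)))\<^sup>2 + (norm (w1 (F x)))\<^sup>2 < R2 (F x)"
        "R2 (F x) + (norm (z2 (F x)))\<^sup>2 + (norm (w2 (F x)))\<^sup>2 < 1" using re by linarith+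
      then show ?thesis unfolding T_def by simp
    qed
    ultimately show ?thesis by blast
  qed
  have F': "F' y \<in> U \<and> F (F' y) = y" if y: "y \<in> T" for y
  proof -
    have y': "(Im (z1 y))\<^sup>2 + (norm (w1 y))\<^sup>2 < R2 y" "R2 y + (norm (z2 y))\<^sup>2 + (norm (w2 y))\<^sup>2 < 1"
      using y unfolding T_def by simp_all
    have R2: "0 < R2 y" using y'(1) by (smt (verit) zero_le_power2)
    have Y: "(norm (Y1 y))\<^sup>2 + (norm (w1 y))\<^sup>2 = R2 y" "0 < Re (Y1 y)"
      using y'(1) by (simp_all add: Y1_def cmod_power2)
    have Zy: "cnj a * Za y + cnj b * Zb y = Y1 y" "a * Zb y - b * Za y = w1 y"
      by (rule unitary_coordinates_inverse[OF ab Za_def Zb_def])+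
    have Zn: "(norm (Za y))\<^sup>2 + (norm (Zb y))\<^sup>2 = (sqrt (R2 y))\<^sup>2"
      using unitary_coordinates(3)[OF ab Zy(1)[symmetric] Zy(2)[symmetric]] Y(1) R2 by simp
    have u: "(norm (P y))\<^sup>2 + (norm (Q y))\<^sup>2 = 1"
      unfolding P_def Q_def by (rule unit[OF _ Zn]) (simp add: R2)
    note w = unitary_coordinates_inverse[OF u refl refl, of "z2 y" "w2 y"]
    note wn = unitary_coordinates(3)[OF u w(1)[symmetric] w(2)[symmetric]]
    have f: "z1 (F' y) = Za y" "z2 (F' y) = Zb y" "w1 (F' y) = P y * z2 y - cnj (Q y) * w2 y"
      "w2 (F' y) = Q y * z2 y + cnj (P y) * w2 y" by (simp_all add: F'_def)
    have zn': "znorm (F' y) = sqrt (R2 y)" unfolding znorm_def f Zn using R2 by simp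
    have yy: "y1 (F' y) = Y1 y" "y2 (F' y) = w1 y" unfolding y1_def y2_def f using Zy by simp_all
    have "\<rho> (F' y) = Re (z1 y)"
      unfolding \<rho>_def f(1,2) Zn using wn R2 unfolding f(3,4) by (simp add: R2_def)
    moreover have "fr (znorm (F' y)) (z1 (F' y)) (z2 (F' y)) (w1 (F' y)) (w2 (F' y)) = (z2 y, w2 y)"
      unfolding fr_def zn' f P_def[symmetric] Q_def[symmetric] w ..
    ultimately have "F (F' y) = y"
      unfolding F_def yy by (simp add: prod_eq_iff complex_eq_iff Y1_def)
    moreover have "(norm (F' y))\<^sup>2 = R2 y + (norm (z2 y))\<^sup>2 + (norm (w2 y))\<^sup>2"
      unfolding norm_quat_pair f using Zn wn R2 by simp
    then have "norm (F' y) < 1" using y'(2) by (simp add: norm_less_one_iff_power2)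
    ultimately show ?thesis unfolding U_def using yy(1) Y(2) by simp
  qed
  have img: "F ` U = T"
  proof (intro equalityI subsetI)
    fix y assume "y \<in> T"
    then have "F' y \<in> U" "y = F (F' y)" using F' by simp_all
    then show "y \<in> F ` U" by blast
  qed (use F in blast)
  have opU: "open U"
  proof -
    have "open {x :: quat \<times> quat. norm x < 1}" by (intro open_Collect_less continuous_intros)
    moreover have "open {x :: quat \<times> quat. 0 < Re (y1 x)}"
      unfolding y1_def by (intro open_Collect_less continuous_intros)
    ultimately show ?thesis unfolding U_def by (simp add: open_Collect_conj)
  qed
  have opT: "open T"
  proof -
    have "open {y :: quat \<times> quat. (Im (z1 y))\<^sup>2 + (norm (w1 y))\<^sup>2 < R2 y}"
      "open {y :: quat \<times> quat. R2 y + (norm (z2 y))\<^sup>2 + (norm (w2 y))\<^sup>2 < 1}"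
      unfolding R2_def by (intro open_Collect_less continuous_intros)+
    then show ?thesis unfolding T_def by (simp add: open_Collect_conj)
  qed
  have smF: "smooth_on U F"
  proof -
    have z: "smooth_on U znorm" unfolding znorm_def[abs_def]
    proof (intro smooth_on_sqrt smooth_on_add smooth_on_norm_power2 smooth_on_fst smooth_on_snd smooth_on_ident)
      fix x assume "x \<in> U"
      then show "0 < (norm (z1 x))\<^sup>2 + (norm (z2 x))\<^sup>2" using zn(1) unfolding znorm_def by simp
    qed
    have nz: "complex_of_real (znorm x) \<noteq> 0" if "x \<in> U" for x using zn(1)[OF that] by simp
    have p: "smooth_on U (\<lambda>x. z1 x / of_real (znorm x))" "smooth_on U (\<lambda>x. z2 x / of_real (znorm x))"
      by (intro smooth_on_divide smooth_on_complex_of_real z smooth_on_fst smooth_on_snd smooth_on_ident; erule nz)+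
    show ?thesis
      unfolding F_def[abs_def] fr_def \<rho>_def y1_def y2_def
      by (intro smooth_on_Pair smooth_on_Complex smooth_on_Im smooth_on_diff smooth_on_add smooth_on_mult
          smooth_on_norm_power2 smooth_on_cnj p smooth_on_fst smooth_on_snd smooth_on_ident smooth_on_const)
  qed
  have smF': "smooth_on T F'"
  proof -
    have pos: "0 < R2 y" "0 < R2 y - (Im (z1 y))\<^sup>2 - (norm (w1 y))\<^sup>2" if "y \<in> T" for y
      using that unfolding T_def by (auto intro: order.strict_trans1[of _ "(Im (z1 y))\<^sup>2 + (norm (w1 y))\<^sup>2"])
    have R: "smooth_on T R2" unfolding R2_def[abs_def]
      by (intro smooth_on_add smooth_on_norm_power2 smooth_on_Re smooth_on_fst smooth_on_snd smooth_on_ident smooth_on_const)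
    have Y: "smooth_on T Y1" unfolding Y1_def[abs_def] power2_eq_square[of "Im _"]
      by (intro smooth_on_Complex smooth_on_sqrt smooth_on_diff R smooth_on_mult smooth_on_Im smooth_on_norm_power2
          smooth_on_fst smooth_on_snd smooth_on_ident) (use pos(2) in \<open>simp add: power2_eq_square\<close>)
    have Zs: "smooth_on T Za" "smooth_on T Zb" unfolding Za_def[abs_def] Zb_def[abs_def]
      by (intro smooth_on_add smooth_on_diff smooth_on_mult smooth_on_const Y smooth_on_fst smooth_on_snd smooth_on_ident)+
    have nz: "complex_of_real (sqrt (R2 y)) \<noteq> 0" if "y \<in> T" for y using pos(1)[OF that] by simp
    have PQ: "smooth_on T P" "smooth_on T Q" unfolding P_def[abs_def] Q_def[abs_def]
      by (intro smooth_on_divide Zs smooth_on_complex_of_real smooth_on_sqrt R pos(1); (erule nz | assumption))+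
    show ?thesis unfolding F'_def[abs_def]
      by (intro smooth_on_Pair smooth_on_add smooth_on_diff smooth_on_mult smooth_on_cnj Zs PQ
          smooth_on_fst smooth_on_snd smooth_on_ident)
  qed
  have Z_iff: "x \<in> Z \<longleftrightarrow> F x \<in> S" if x: "x \<in> U" for x
  proof -
    have "(norm x)\<^sup>2 < 1" using x unfolding U_def by (simp add: norm_less_one_iff_power2)
    moreover have "z2 (F x) = (cnj (z1 x) * w1 x + cnj (z2 x) * w2 x) / of_real (znorm x)"
      by (simp add: F_def fr_def add_divide_distrib)
    ultimately show ?thesis
      unfolding S_def mem_Z using zn(1)[OF x] by (auto simp: F_def \<rho>_def)
  qed
  have "F ` (U \<inter> Z) = F ` U \<inter> S" using Z_iff by blast
  moreover have "x0 \<in> U"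
  proof -
    have p: "0 < znorm x0" by (rule znorm_pos[OF x0])
    have "y1 x0 * of_real (znorm x0) = cnj (z1 x0) * z1 x0 + cnj (z2 x0) * z2 x0"
      using p by (simp add: y1_def a_def b_def field_simps)
    also have "\<dots> = of_real ((znorm x0)\<^sup>2)"
      unfolding znorm_power2 of_real_add complex_norm_square by (simp add: mult.commute)
    finally have "y1 x0 = of_real (znorm x0)" using p by (simp add: power2_eq_square)
    then show ?thesis unfolding U_def using p norm_less_one[OF x0] by simp
  qed
  moreover have "subspace S" "dim S = 5" unfolding S_def by (rule dim_coordinate_subspace)+
  ultimately show "\<exists>U (F :: quat \<times> quat \<Rightarrow> quat \<times> quat) F' S. open U \<and> x0 \<in> U \<and> open (F ` U) \<and>
      smooth_on U F \<and> smooth_on (F ` U) F' \<and> (\<forall>y\<in>U. F' (F y) = y) \<and>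
      subspace S \<and> dim S = 5 \<and> F ` (U \<inter> Z) = F ` U \<inter> S"
    using opU opT smF smF' F unfolding img by (intro exI[of _ U] exI[of _ F] exI[of _ F'] exI[of _ S]) (simp add: img)
qed

section \<open>The quotient metric and its completeness\<close>

sublocale R: riemannian_quotient Z pr hyperbolic_metric \<xi>
proof
  show "smooth_submanifold 5 Z" by (rule submanifold_Z)
  show "smooth_on (Z \<times> UNIV \<times> UNIV) (\<lambda>(x, v, w). hyperbolic_metric x v w)"
    by (rule smooth_on_hyperbolic_metric[OF norm_less_one])
  show "smooth_on Z \<xi>" unfolding \<xi>_def[abs_def]
    by (intro smooth_on_Pair smooth_on_mult smooth_on_const smooth_on_fst smooth_on_snd smooth_on_ident)
  show "bilinear (hyperbolic_metric x)" for x by (rule bilinear_hyperbolic_metric)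
  show "hyperbolic_metric x v w = hyperbolic_metric x w v" for x v w
    by (simp add: hyperbolic_metric_def inner_commute)
  show "0 < hyperbolic_metric x v v" if "x \<in> Z" "v \<noteq> 0" for x v
  proof -
    have "0 < (norm v)\<^sup>2" using that(2) by simp
    also have "\<dots> \<le> hyperbolic_metric x v v" by (rule hyperbolic_metric_ge(1)[OF norm_less_one[OF that(1)]])
    finally show ?thesis .
  qed
  show "\<xi> x \<noteq> 0" if "x \<in> Z" for x using z_norm_pos[OF that] by (auto simp: \<xi>_def prod_eq_iff)
  show "\<exists>\<gamma> e. e > 0 \<and> smooth_on {-e<..<e} \<gamma> \<and> \<gamma> ` {-e<..<e} \<subseteq> Z \<and>
      \<gamma> 0 = x \<and> (\<gamma> has_vector_derivative \<xi> x) (at 0) \<and> (\<forall>t\<in>{-e<..<e}. pr (\<gamma> t) = pr x)" if "x \<in> Z" for x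
  proof (rule exI[of _ "\<lambda>t. act (cis t) x"], rule exI[of _ 1], intro conjI vertical_curve)
    have "act (cis t) x \<in> Z" for t by (rule act_Z[OF _ that]) simp
    then show "(\<lambda>t. act (cis t) x) ` {- 1<..<1} \<subseteq> Z" by blast
    show "act (cis 0) x = x" by (simp add: act_one)
    show "\<forall>t\<in>{- 1<..<1}. pr (act (cis t) x) = pr x" by (intro ballI pr_act) simp
  qed simp
  show "\<exists>\<Phi>. linear \<Phi> \<and> \<Phi> ` Z \<subseteq> Z \<and> (\<forall>z\<in>Z. pr (\<Phi> z) = pr z) \<and> \<Phi> x = y \<and>
      (\<forall>z\<in>Z. \<forall>v w. hyperbolic_metric (\<Phi> z) (\<Phi> v) (\<Phi> w) = hyperbolic_metric z v w)"
    if "x \<in> Z" "y \<in> Z" "pr x = pr y" for x y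
  proof -
    obtain \<tau> where \<tau>: "norm \<tau> = 1" "y = act \<tau> x" using \<open>pr x = pr y\<close> unfolding pr_eq_iff by blast
    show ?thesis
      using linear_act act_Z[OF \<tau>(1)] pr_act[OF \<tau>(1)] hyperbolic_metric_act[OF \<tau>(1)] \<tau>(2)
      by (intro exI[of _ "act \<tau>"]) auto
  qed
qed

text \<open>The differential of this function is \<open>2 \<langle>v, x\<rangle> / (1 - |x|\<^sup>2)\<close>, which the second term of the
  hyperbolic metric dominates, and the function tends to infinity at the boundary of the ball. This is
  where completeness comes from.\<close>

definition height :: "quat \<times> quat \<Rightarrow> real" where "height x = - ln (1 - (norm x)\<^sup>2)"

lemma height_gradient_bounded: "gradient_bounded M.X M.A R.G 2 (\<lambda>q. height (M.rep q))"
proof (rule R.gradient_bounded_quotient[where h' = "\<lambda>x v. 2 * (x \<bullet> v) / (1 - (norm x)\<^sup>2)"])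
  fix x assume x: "x \<in> Z"
  have p: "0 < 1 - (norm x)\<^sup>2" using x unfolding mem_Z by simp
  have "((\<lambda>x. - ln (1 - x \<bullet> x)) has_derivative (\<lambda>v. 2 * (x \<bullet> v) / (1 - x \<bullet> x))) (at x within Z)"
    using p unfolding power2_norm_eq_inner
    by (auto intro!: derivative_eq_intros simp: inner_commute field_simps)
  then show "(height has_derivative (\<lambda>v. 2 * (x \<bullet> v) / (1 - (norm x)\<^sup>2))) (at x within Z)"
    unfolding height_def[abs_def] power2_norm_eq_inner .
  show "norm (2 * (x \<bullet> v) / (1 - (norm x)\<^sup>2)) \<le> 2 * sqrt (hyperbolic_metric x v v)" for v
  proof -
    have "\<bar>(v \<bullet> x) / (1 - (norm x)\<^sup>2)\<bar> \<le> sqrt (hyperbolic_metric x v v)"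
      using real_sqrt_le_mono[OF hyperbolic_metric_ge(2)[OF norm_less_one[OF x], of v]] by simp
    then show ?thesis by (simp add: abs_mult inner_commute)
  qed
next
  fix x y assume "pr x = pr y"
  then obtain \<tau> where \<tau>: "norm \<tau> = 1" "y = act \<tau> x" unfolding pr_eq_iff by blast
  show "height x = height y" unfolding height_def \<tau>(2) norm_act[OF \<tau>(1)] ..
qed simp

lemma invariant_function_gradient_bounded:
  assumes "h \<in> invariant_functions"
  obtains C where "gradient_bounded M.X M.A R.G C (\<lambda>q. h (M.rep q))"
proof -
  obtain h' C where h: "C > 0" "\<And>x. (h has_derivative h' x) (at x)"
    "\<And>x v. norm x < 1 \<Longrightarrow> norm (h' x v) \<le> C * norm v"
    by (rule invariant_function_derivative[OF assms]) (rule that; assumption)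
  have "gradient_bounded M.X M.A R.G C (\<lambda>q. h (M.rep q))"
  proof (rule R.gradient_bounded_quotient[OF h(1), where h' = h'])
    fix x v assume x: "x \<in> Z"
    show "(h has_derivative h' x) (at x within Z)" by (rule has_derivative_at_withinI[OF h(2)])
    have "norm v \<le> sqrt (hyperbolic_metric x v v)"
      using real_sqrt_le_mono[OF hyperbolic_metric_ge(1)[OF norm_less_one[OF x], of v]] by simp
    then have "C * norm v \<le> C * sqrt (hyperbolic_metric x v v)" using h(1) by (intro mult_left_mono) auto
    then show "norm (h' x v) \<le> C * sqrt (hyperbolic_metric x v v)"
      using h(3)[OF norm_less_one[OF x], of v] by linarith
  qed (rule invariant_function_orbit[OF assms])
  then show thesis by (rule that)
qed

lemma connected_Z: "connected Z"
proof -
  have eq: "Z' = sphere 0 1 \<times> ball 0 1" by (auto simp: disk_bundle_cover_def)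
  have "connected (sphere (0 :: complex^2) 1)" by (rule connected_sphere) simp
  then have "connected Z'" unfolding eq by (rule connected_Times) (simp add: convex_connected)
  then have "connected (\<Theta>' ` Z')"
    by (rule connected_continuous_image[OF smooth_on_imp_continuous_on[OF smooth_\<Theta>']])
  moreover have "\<Theta>' ` Z' = Z"
  proof (intro equalityI subsetI)
    fix x assume "x \<in> Z"
    then have "\<Theta> x \<in> Z'" "x = \<Theta>' (\<Theta> x)" using \<Theta>_Z' \<Theta>'_\<Theta> by simp_all
    then show "x \<in> \<Theta>' ` Z'" by blast
  qed (use \<Theta>'_Z in blast)
  ultimately show ?thesis by simp
qed

text \<open>The sublevel sets of the height are cut out of a closed ball of radius less than 1 by the equations
  of the level set, so they are compact before and after projection.\<close>

lemma compact_sublevel: "compactin M.X {q \<in> topspace M.X. height (M.rep q) \<le> b}"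
proof -
  let ?K = "{x \<in> Z. height x \<le> b}"
  have sub: "height x \<le> b \<longleftrightarrow> (norm x)\<^sup>2 \<le> 1 - exp (- b)" if "x \<in> Z" for x
  proof -
    have p: "0 < 1 - (norm x)\<^sup>2" using that unfolding mem_Z by simp
    have "height x \<le> b \<longleftrightarrow> - b \<le> ln (1 - (norm x)\<^sup>2)" by (auto simp: height_def)
    also have "\<dots> \<longleftrightarrow> exp (- b) \<le> 1 - (norm x)\<^sup>2" by (rule ln_ge_iff[OF p])
    finally show ?thesis by auto
  qed
  have lt: "1 - exp (- b) < 1" by simp
  have K: "?K = {x. (norm x)\<^sup>2 \<le> 1 - exp (- b) \<and>
     (norm (z1 x))\<^sup>2 + (norm (z2 x))\<^sup>2 - (norm (w1 x))\<^sup>2 - (norm (w2 x))\<^sup>2 = level \<and>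
     cnj (z1 x) * w1 x + cnj (z2 x) * w2 x = 0}" (is "_ = ?K'")
  proof (intro equalityI subsetI)
    fix x assume "x \<in> ?K"
    then show "x \<in> ?K'" using sub[of x] unfolding mem_Z by blast
  next
    fix x assume x: "x \<in> ?K'"
    then have "(norm x)\<^sup>2 < 1" using lt by (auto intro: order.strict_trans1)
    then have "x \<in> Z" unfolding mem_Z using x by blast
    then show "x \<in> ?K" using sub[of x] x by blast
  qed
  have "closed ?K'"
    by (intro closed_Collect_conj closed_Collect_le closed_Collect_eq continuous_intros)
  moreover have "?K' \<subseteq> cball 0 1"
  proof
    fix x assume "x \<in> ?K'"
    then have "(norm x)\<^sup>2 < 1" using lt by (auto intro: order.strict_trans1)
    then show "x \<in> cball 0 1" using norm_less_one_iff_power2[of x] by simp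
  qed
  then have "bounded ?K'" by (rule bounded_subset[OF bounded_cball])
  ultimately have "compact ?K" unfolding K compact_eq_bounded_closed by blast
  then have "compactin (top_of_set Z) ?K" by (simp add: compactin_subtopology)
  then have "compactin M.X (pr ` ?K)" by (rule image_compactin[OF _ M.continuous_map_pr])
  moreover have "pr ` ?K = {q \<in> topspace M.X. height (M.rep q) \<le> b}"
  proof -
    have "height (M.rep (pr x)) = height x" if "x \<in> Z" for x
    proof -
      have "pr (M.rep (pr x)) = pr x" using M.rep(2)[of "pr x"] that by blast
      then obtain \<tau> where \<tau>: "norm \<tau> = 1" "x = act \<tau> (M.rep (pr x))" unfolding pr_eq_iff by blast
      have "norm x = norm (M.rep (pr x))" using norm_act[OF \<tau>(1)] \<tau>(2) by metis
      then show ?thesis by (simp add: height_def)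
    qed
    then show ?thesis unfolding M.topspace_X by auto
  qed
  ultimately show ?thesis by simp
qed

lemma complete: "riemannian_complete M.X M.A R.G"
proof -
  interpret riemannian_manifold M.X M.A R.G
    by unfold_locales (rule M.smooth_manifold_quotient, rule R.riemannian_metric_quotient)
  show ?thesis
  proof (rule complete_if_proper_function[OF _ _ height_gradient_bounded compact_sublevel])
    have "connectedin M.X (pr ` Z)"
      by (rule connectedin_continuous_map_image[OF M.continuous_map_pr])
        (simp add: connectedin_subtopology connected_Z)
    then show "connected_space M.X" using M.topspace_X connectedin_topspace by metis
    fix q r assume qr: "q \<in> topspace M.X" "r \<in> topspace M.X" "q \<noteq> r"
    then have "q \<in> pr ` Z" "r \<in> pr ` Z" unfolding M.topspace_X by simp_all
    then have q: "M.rep q \<in> Z" "pr (M.rep q) = q" and r: "M.rep r \<in> Z" "pr (M.rep r) = r"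
      by (simp_all add: M.rep)
    obtain h where h: "h \<in> invariant_functions" "h (M.rep q) \<noteq> h (M.rep r)"
      using invariant_functions_separate[OF q(1) r(1)] q(2) r(2) qr(3) by auto
    obtain C where "gradient_bounded M.X M.A R.G C (\<lambda>q. h (M.rep q))"
      using invariant_function_gradient_bounded[OF h(1)] .
    then show "\<exists>C (h :: _ \<Rightarrow> complex). gradient_bounded M.X M.A R.G C h \<and> h q \<noteq> h r" using h(2) by blast
  qed
qed

section \<open>The action of U(2)\<close>

lemma unitary_action_eq:
  "unitary_action T x =
    ((T $ 1 $ 1 * z1 x + T $ 1 $ 2 * z2 x, T $ 1 $ 1 * w1 x + T $ 1 $ 2 * w2 x),
     (T $ 2 $ 1 * z1 x + T $ 2 $ 2 * z2 x, T $ 2 $ 1 * w1 x + T $ 2 $ 2 * w2 x))"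
  by (cases x) (simp add: unitary_action_def quat_mult_def quat_of_complex_def)

lemma unitary_entries:
  assumes "T \<in> unitary_group"
  shows "cnj (T $ 1 $ i) * T $ 1 $ j + cnj (T $ 2 $ i) * T $ 2 $ j = (if i = j then 1 else 0)"
proof -
  have "(map_matrix cnj (transpose T) ** T) $ i $ j = (mat 1 :: complex^2^2) $ i $ j"
    using assms unfolding unitary_group_def by simp
  then show ?thesis by (simp add: matrix_matrix_mult_def transpose_def map_matrix_def mat_def sum_2)
qed

lemma unitary_pairing:
  assumes "T \<in> unitary_group"
  shows "quat_pairing (unitary_action T v) (unitary_action T x) = quat_pairing v x"
    "cnj (z1 (unitary_action T x)) * w1 (unitary_action T x) + cnj (z2 (unitary_action T x)) * w2 (unitary_action T x) =
      cnj (z1 x) * w1 x + cnj (z2 x) * w2 x"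
    "(norm (z1 (unitary_action T x)))\<^sup>2 + (norm (z2 (unitary_action T x)))\<^sup>2 = (norm (z1 x))\<^sup>2 + (norm (z2 x))\<^sup>2"
    "(norm (w1 (unitary_action T x)))\<^sup>2 + (norm (w2 (unitary_action T x)))\<^sup>2 = (norm (w1 x))\<^sup>2 + (norm (w2 x))\<^sup>2"
proof -
  define a where "a = T $ 1 $ 1"
  define b where "b = T $ 1 $ 2"
  define c where "c = T $ 2 $ 1"
  define d where "d = T $ 2 $ 2"
  have e: "cnj a * a + cnj c * c = 1" "cnj a * b + cnj c * d = 0" "cnj b * a + cnj d * c = 0"
    "cnj b * b + cnj d * d = 1"
    using unitary_entries[OF assms, of 1 1] unitary_entries[OF assms, of 1 2]
      unitary_entries[OF assms, of 2 1] unitary_entries[OF assms, of 2 2]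
    unfolding a_def b_def c_def d_def by simp_all
  have U: "unitary_action T x = ((a * z1 x + b * z2 x, a * w1 x + b * w2 x), (c * z1 x + d * z2 x, c * w1 x + d * w2 x))" for x
    unfolding unitary_action_eq a_def b_def c_def d_def ..
  have h: "cnj (a * s + b * t) * (a * s' + b * t') + cnj (c * s + d * t) * (c * s' + d * t') = cnj s * s' + cnj t * t'"
    for s t s' t'
    unfolding complex_cnj_add complex_cnj_mult using e by algebra
  show "quat_pairing (unitary_action T v) (unitary_action T x) = quat_pairing v x"
  proof -
    have "quat_pairing v x =
        ((cnj (z1 v) * z1 x + cnj (z2 v) * z2 x) + (cnj (w1 x) * w1 v + cnj (w2 x) * w2 v),
         (cnj (z1 v) * w1 x + cnj (z2 v) * w2 x) - (cnj (z1 x) * w1 v + cnj (z2 x) * w2 v))" for v x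
      by (simp add: quat_pairing_eq algebra_simps)
    then show ?thesis by (simp only: U fst_conv snd_conv h)
  qed
  show "cnj (z1 (unitary_action T x)) * w1 (unitary_action T x) + cnj (z2 (unitary_action T x)) * w2 (unitary_action T x) =
      cnj (z1 x) * w1 x + cnj (z2 x) * w2 x"
    unfolding U fst_conv snd_conv by (rule h)
  have n: "(norm (a * s + b * t))\<^sup>2 + (norm (c * s + d * t))\<^sup>2 = (norm s)\<^sup>2 + (norm t)\<^sup>2" for s t
  proof -
    have "complex_of_real ((norm (a * s + b * t))\<^sup>2 + (norm (c * s + d * t))\<^sup>2) = complex_of_real ((norm s)\<^sup>2 + (norm t)\<^sup>2)"
      unfolding of_real_add complex_norm_square using h[of s t s t] by (simp only: mult.commute)
    then show ?thesis by (simp only: of_real_eq_iff)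
  qed
  show "(norm (z1 (unitary_action T x)))\<^sup>2 + (norm (z2 (unitary_action T x)))\<^sup>2 = (norm (z1 x))\<^sup>2 + (norm (z2 x))\<^sup>2"
    "(norm (w1 (unitary_action T x)))\<^sup>2 + (norm (w2 (unitary_action T x)))\<^sup>2 = (norm (w1 x))\<^sup>2 + (norm (w2 x))\<^sup>2"
    unfolding U fst_conv snd_conv by (rule n)+
qed

lemma unitary_Z: assumes "T \<in> unitary_group" "x \<in> Z" shows "unitary_action T x \<in> Z"
proof -
  have "(norm (unitary_action T x))\<^sup>2 = (norm x)\<^sup>2"
    unfolding norm_quat_pair[of "unitary_action T x"] norm_quat_pair[of x]
    using unitary_pairing(3,4)[OF assms(1), of x] by simp
  then show ?thesis
    using assms(2) unitary_pairing(2,3,4)[OF assms(1), of x] unfolding mem_Z by (simp add: algebra_simps)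
qed

lemma linear_unitary_action: "linear (unitary_action T)"
  by (rule linearI) (simp_all add: unitary_action_eq algebra_simps scaleR_conv_of_real)

lemma unitary_action_pr: "unitary_action T ` pr x = pr (unitary_action T x)"
proof -
  have "unitary_action T (act \<tau> x) = act \<tau> (unitary_action T x)" for \<tau>
    by (simp add: unitary_action_eq act_def algebra_simps)
  moreover have "pr y = (\<lambda>\<tau>. act \<tau> y) ` {\<tau>. norm \<tau> = 1}" for y unfolding pr_eq by blast
  ultimately show ?thesis by (simp only: image_image)
qed

lemma unitary_action_mult: "unitary_action (S ** T) x = unitary_action S (unitary_action T x)"
  by (simp add: unitary_action_eq matrix_matrix_mult_def sum_2 algebra_simps)

lemma unitary_action_one: "unitary_action (mat 1) x = x"
  by (simp add: unitary_action_eq mat_def)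

lemma hyperbolic_metric_unitary:
  assumes "T \<in> unitary_group"
  shows "hyperbolic_metric (unitary_action T x) (unitary_action T v) (unitary_action T w) = hyperbolic_metric x v w"
  by (rule hyperbolic_metric_invariant[where c = 1]) (simp_all add: unitary_pairing(1)[OF assms])

lemma unitary_inverse:
  assumes "T \<in> unitary_group"
  obtains T' where "T' \<in> unitary_group" "T' ** T = mat 1" "T ** T' = mat 1"
proof -
  let ?T' = "map_matrix cnj (transpose T)"
  have l: "?T' ** T = mat 1" using assms unfolding unitary_group_def by simp
  then have r: "T ** ?T' = mat 1" by (simp add: matrix_left_right_inverse)
  have "map_matrix cnj (transpose ?T') = T"
    by (simp add: vec_eq_iff map_matrix_def transpose_def)
  then have "?T' \<in> unitary_group" using r unfolding unitary_group_def by simp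
  then show thesis using l r by (rule that)
qed

text \<open>The action map descends because the projection is open.\<close>

lemma continuous_unitary_action:
  "continuous_map (prod_topology (top_of_set unitary_group) M.X) M.X (\<lambda>(T, q). unitary_action T ` q)"
proof -
  let ?P = "prod_topology (top_of_set unitary_group) M.X"
  let ?PZ = "prod_topology (top_of_set unitary_group) (top_of_set Z)"
  have "continuous_on (unitary_group \<times> Z) (\<lambda>p. unitary_action (fst p) (snd p))"
    unfolding unitary_action_eq by (intro continuous_intros)
  moreover have "(\<lambda>p. unitary_action (fst p) (snd p)) ` (unitary_group \<times> Z) \<subseteq> Z"
    by (rule image_subsetI, elim SigmaE) (simp add: unitary_Z)
  moreover have "?PZ = top_of_set (unitary_group \<times> Z)"
    by (simp add: subtopology_Times[symmetric] euclidean_product_topology)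
  ultimately have "continuous_map ?PZ (top_of_set Z) (\<lambda>p. unitary_action (fst p) (snd p))"
    by (simp add: continuous_map_in_subtopology image_subset_iff_funcset)
  from continuous_map_compose[OF this M.continuous_map_pr]
  have c: "continuous_map ?PZ M.X (\<lambda>p. pr (unitary_action (fst p) (snd p)))" by (simp add: o_def)
  show ?thesis
    unfolding continuous_map_def
  proof (intro conjI allI impI)
    show "(\<lambda>(T, q). unitary_action T ` q) \<in> topspace ?P \<rightarrow> topspace M.X"
      using unitary_Z by (auto simp: M.topspace_X unitary_action_pr)
    fix U assume U: "openin M.X U"
    let ?V = "{p \<in> topspace ?P. (case p of (T, q) \<Rightarrow> unitary_action T ` q) \<in> U}"
    have op: "openin ?PZ {p \<in> topspace ?PZ. pr (unitary_action (fst p) (snd p)) \<in> U}"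
      using c U unfolding continuous_map_def by blast
    show "openin ?P ?V"
    proof (subst openin_subopen, rule ballI)
      fix p assume p: "p \<in> ?V"
      obtain T q where Tq: "p = (T, q)" by (cases p)
      with p have T: "T \<in> unitary_group" and q: "q \<in> pr ` Z" and TU: "unitary_action T ` q \<in> U"
        by (auto simp: M.topspace_X)
      obtain x where x: "x \<in> Z" "q = pr x" using q by blast
      have "(T, x) \<in> {p \<in> topspace ?PZ. pr (unitary_action (fst p) (snd p)) \<in> U}"
        using T x TU by (simp add: unitary_action_pr)
      from op[unfolded openin_prod_topology_alt, THEN spec, THEN spec, THEN mp, OF this]
      obtain N1 N2 where N: "openin (top_of_set unitary_group) N1" "openin (top_of_set Z) N2"
        "T \<in> N1" "x \<in> N2" "N1 \<times> N2 \<subseteq> {p \<in> topspace ?PZ. pr (unitary_action (fst p) (snd p)) \<in> U}"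
        by (elim exE conjE) (rule that; assumption)
      have "openin M.X (pr ` N2)" using M.open_map_pr N(2) unfolding open_map_def by blast
      then have "openin ?P (N1 \<times> pr ` N2)" using N(1) by (simp add: openin_prod_Times_iff)
      moreover have "p \<in> N1 \<times> pr ` N2" using N(3,4) x(2) Tq by blast
      moreover have "N1 \<times> pr ` N2 \<subseteq> ?V"
      proof
        fix p' assume "p' \<in> N1 \<times> pr ` N2"
        then obtain S y where S: "p' = (S, pr y)" "S \<in> N1" "y \<in> N2" by blast
        then have "(S, y) \<in> {p \<in> topspace ?PZ. pr (unitary_action (fst p) (snd p)) \<in> U}" using N(5) by blast
        then show "p' \<in> ?V" using S(1) by (simp add: unitary_action_pr M.topspace_X)
      qed
      ultimately show "\<exists>W. openin ?P W \<and> p \<in> W \<and> W \<subseteq> ?V" by blast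
    qed
  qed
qed

lemma isometry_unitary:
  assumes T: "T \<in> unitary_group"
  shows "isometry M.X M.A R.G (\<lambda>q. unitary_action T ` q)"
  unfolding isometry_def
proof
  obtain T' where T': "T' \<in> unitary_group" "T' ** T = mat 1" "T ** T' = mat 1"
    using unitary_inverse[OF T] .
  have inv: "unitary_action T' (unitary_action T x) = x" "unitary_action T (unitary_action T' x) = x" for x
    unfolding unitary_action_mult[symmetric] T'(2,3) by (rule unitary_action_one)+
  show "diffeomorphism M.X M.A M.X M.A (\<lambda>q. unitary_action T ` q)"
    by (rule diffeomorphism_induced[OF M.smooth_quotient_axioms M.smooth_quotient_axioms
          smooth_on_linear[OF linear_unitary_action] _ unitary_action_pr
          smooth_on_linear[OF linear_unitary_action] _ unitary_action_pr inv])
      (use unitary_Z T T'(1) in auto)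
  show "preserves_metric M.A R.G (\<lambda>q. unitary_action T ` q)"
    by (rule R.preserves_metric_covering[OF linear_unitary_action _ hyperbolic_metric_unitary[OF T] unitary_action_pr])
      (use unitary_Z[OF T] in blast)
qed

lemma U2_invariant_weights: "U2_invariant weights"
  unfolding U2_invariant_def acts_by_isometries_def qk_quotient_def qk_atlas_def qk_metric_def
proof (intro conjI ballI)
  show "unitary_action (mat 1) ` q = q" for q by (simp add: unitary_action_one)
  show "unitary_action (S ** T) ` q = unitary_action S ` unitary_action T ` q" for S T q
    by (simp add: unitary_action_mult image_image)
  show "continuous_map (prod_topology (top_of_set unitary_group) M.X) M.X (\<lambda>(T, q). unitary_action T ` q)"
    by (rule continuous_unitary_action)
  show "isometry M.X M.A R.G ((`) (unitary_action T))" if "T \<in> unitary_group" for T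
    using isometry_unitary[OF that] .
qed

end

theorem theorem3p5:
  fixes p k :: int
  assumes "p = 2 * k + 1" and "p > 2"
  shows "let w = (p - 2, p, p) in
    smooth_submanifold 5 (moment_zero w) \<and>
    smooth_manifold (qk_quotient w) (qk_atlas w) \<and>
    riemannian_metric (qk_atlas w) (qk_metric w) \<and>
    riemannian_submersion (moment_zero w) hyperbolic_metric (qk_atlas w) (qk_metric w)
      (circle_orbit w) \<and>
    riemannian_complete (qk_quotient w) (qk_atlas w) (qk_metric w) \<and>
    U2_invariant w \<and>
    smooth_manifold (disk_bundle p) (disk_bundle_atlas p) \<and>
    (\<exists>F. diffeomorphism (qk_quotient w) (qk_atlas w) (disk_bundle p) (disk_bundle_atlas p) F)"
proof -
  define n where "n = nat p"
  have p: "p = int n" using assms(2) by (simp add: n_def)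
  have "odd p" using assms(1) by simp
  then have "odd n" unfolding p by simp
  moreover have "2 < n" using assms(2) unfolding p by simp
  ultimately interpret odd_weight n by unfold_locales
  show ?thesis
    unfolding Let_def p qk_quotient_def qk_atlas_def qk_metric_def disk_bundle_def disk_bundle_atlas_def
    by (intro conjI submanifold_Z M.smooth_manifold_quotient R.riemannian_metric_quotient
        R.riemannian_submersion_quotient complete U2_invariant_weights L.smooth_manifold_quotient
        quotient_diffeomorphism)
qed

end
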